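(* Let $P$ be reversible and ergodic with stationary distribution $\pi$, and let $(X_n)_{n\ge0}$ be a stationary Markov chain with kernel $P$. Let $h\in L^1(\pi)$ with $\pi(h)=0$, $S_n=\sum_{k=0}^{n-1}h(X_k)$ and $A_n=\operatorname{Var}_\pi(S_n)/n$. If $(S_n/\sqrt n)_{n\ge1}$ is bounded in probability, then $S_n/\sqrt n\Rightarrow \mathsf N(0,\sigma^2)$ for some $0\le\sigma^2<\infty$, and $$\sup_{n\ge1}A_{2n}\le 2\sigma^2,\qquad \lim_{n\to\infty}A_{2n}=\sigma^2.$$ When $\sigma^2=0$, $S_{2n}=0$ almost surely for every $n\ge1$.
   Context: $P$ is a Markov transition kernel on a Polish space $\mathcal X$ with its Borel sigma-algebra, with stationary probability distribution $\pi$. Ergodic means $\phi$-irreducible and aperiodic. Reversible means $\pi(dx)P(x,dy)$ is symmetric on $\mathcal X\times\mathcal X$. Stationary means $X_0\sim\pi$; $\operatorname{Var}_\pi$ is variance under $X_0\sim\pi$ (possibly $\infty$), and $\pi(h)=\int h\,d\pi$. Bounded in probability (tight): $\lim_{N\to\infty}\sup_n\mathbb P(|S_n/\sqrt n|\ge N)=0$. $\Rightarrow$ denotes weak convergence and $\mathsf N(0,0)$ is the point mass at $0$. *)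

theory Defs
  imports "HOL-Probability.Probability"
begin

definition markov_kernel :: "('a::polish_space \<Rightarrow> 'a measure) \<Rightarrow> bool" where
  "markov_kernel P \<longleftrightarrow> P \<in> borel \<rightarrow>\<^sub>M prob_algebra borel"

definition stationary_distribution ::
  "('a::polish_space \<Rightarrow> 'a measure) \<Rightarrow> 'a measure \<Rightarrow> bool" where
  "stationary_distribution P \<pi> \<longleftrightarrow> sets \<pi> = sets borel \<and> prob_space \<pi> \<and> \<pi> \<bind> P = \<pi>"

primrec kernel_power ::
  "('a::polish_space \<Rightarrow> 'a measure) \<Rightarrow> nat \<Rightarrow> 'a \<Rightarrow> 'a measure" where
  "kernel_power P 0 x = return borel x"
| "kernel_power P (Suc n) x = P x \<bind> kernel_power P n"

definition phi_irreducible :: "('a::polish_space \<Rightarrow> 'a measure) \<Rightarrow> bool" where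
  "phi_irreducible P \<longleftrightarrow>
     (\<exists>\<phi>. sets \<phi> = sets borel \<and> sigma_finite_measure \<phi> \<and> emeasure \<phi> UNIV \<noteq> 0 \<and>
        (\<forall>A\<in>sets borel. emeasure \<phi> A > 0 \<longrightarrow>
           (\<forall>x. \<exists>n\<ge>1. emeasure (kernel_power P n x) A > 0)))"

text \<open>The convention is the usual one for a kernel with a given stationary distribution: there
  is no cycle of at least two disjoint sets, of positive \<open>\<pi>\<close>-measure, through which the chain moves
  deterministically.  For a \<open>\<phi>\<close>-irreducible kernel this is the same as period one with respect to
  a maximal irreducibility measure, since an absorbing set is then \<open>\<pi>\<close>-null or \<open>\<pi>\<close>-full.\<close>

definition aperiodic :: "('a::polish_space \<Rightarrow> 'a measure) \<Rightarrow> 'a measure \<Rightarrow> bool" where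
  "aperiodic P \<pi> \<longleftrightarrow>
     \<not> (\<exists>d\<ge>2. \<exists>D :: nat \<Rightarrow> 'a set.
          (\<forall>i<d. D i \<in> sets borel) \<and> disjoint_family_on D {..<d} \<and>
          (\<forall>i<d. \<forall>x\<in>D i. emeasure (P x) (D (Suc i mod d)) = 1) \<and>
          emeasure \<pi> (D 0) > 0)"

definition ergodic :: "('a::polish_space \<Rightarrow> 'a measure) \<Rightarrow> 'a measure \<Rightarrow> bool" where
  "ergodic P \<pi> \<longleftrightarrow> phi_irreducible P \<and> aperiodic P \<pi>"

text \<open>The measure \<open>\<pi>(dx) P(x,dy)\<close> on the product space.\<close>

definition edge_measure ::
  "'a measure \<Rightarrow> ('a::polish_space \<Rightarrow> 'a measure) \<Rightarrow> ('a \<times> 'a) measure" where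
  "edge_measure \<pi> P = \<pi> \<bind> (\<lambda>x. distr (P x) (borel \<Otimes>\<^sub>M borel) (Pair x))"

definition reversible :: "('a::polish_space \<Rightarrow> 'a measure) \<Rightarrow> 'a measure \<Rightarrow> bool" where
  "reversible P \<pi> \<longleftrightarrow>
     distr (edge_measure \<pi> P) (borel \<Otimes>\<^sub>M borel) prod.swap = edge_measure \<pi> P"

definition natural_filtration ::
  "'w measure \<Rightarrow> (nat \<Rightarrow> 'w \<Rightarrow> 'a::topological_space) \<Rightarrow> nat \<Rightarrow> 'w measure" where
  "natural_filtration M X n =
     sigma (space M) {X k -` A \<inter> space M | k A. k \<le> n \<and> A \<in> sets borel}"

definition stationary_markov_chain ::
  "'w measure \<Rightarrow> ('a::polish_space \<Rightarrow> 'a measure) \<Rightarrow> 'a measure \<Rightarrow> (nat \<Rightarrow> 'w \<Rightarrow> 'a) \<Rightarrow> bool" where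
  "stationary_markov_chain M P \<pi> X \<longleftrightarrow>
     prob_space M \<and>
     (\<forall>n. X n \<in> M \<rightarrow>\<^sub>M borel) \<and>
     distr M borel (X 0) = \<pi> \<and>
     (\<forall>n. \<forall>A\<in>sets borel. AE w in M.
        real_cond_exp M (natural_filtration M X n) (\<lambda>w. indicator A (X (Suc n) w)) w =
        measure (P (X n w)) A)"

definition partial_sum :: "('a \<Rightarrow> real) \<Rightarrow> (nat \<Rightarrow> 'w \<Rightarrow> 'a) \<Rightarrow> nat \<Rightarrow> 'w \<Rightarrow> real" where
  "partial_sum h X n w = (\<Sum>k<n. h (X k w))"

text \<open>The variance as an extended nonnegative real, with value \<open>\<infinity>\<close> if \<open>Y\<close> is not square integrable.
  It is only meaningful for integrable \<open>Y\<close>.\<close>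

definition ext_variance :: "'w measure \<Rightarrow> ('w \<Rightarrow> real) \<Rightarrow> ennreal" where
  "ext_variance M Y = (\<integral>\<^sup>+ w. ennreal ((Y w - integral\<^sup>L M Y)\<^sup>2) \<partial>M)"

text \<open>The supremum is over the indices \<open>n \<ge> 1\<close> of the sequence.  The predicate \<open>tight\<close> of
  \<open>HOL-Probability\<close> is a statement about laws indexed from \<open>0\<close>.\<close>

definition bounded_in_probability :: "'w measure \<Rightarrow> (nat \<Rightarrow> 'w \<Rightarrow> real) \<Rightarrow> bool" where
  "bounded_in_probability M Y \<longleftrightarrow>
     ((\<lambda>N::real. SUP n\<in>{1..}. measure M {w \<in> space M. \<bar>Y n w\<bar> \<ge> N}) \<longlongrightarrow> 0) at_top"

text \<open>The parameter \<open>v\<close> is the variance, whereas \<open>normal_density\<close> expects the standard deviation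
  and is not a probability density for standard deviation \<open>0\<close>.\<close>

definition normal_law :: "real \<Rightarrow> real \<Rightarrow> real measure" where
  "normal_law m v =
     (if v = 0 then return borel m
      else density lborel (\<lambda>x. ennreal (normal_density m (sqrt v) x)))"

end

theory Submission
  imports Defs "HOL-Real_Asymp.Real_Asymp"
begin

text \<open>Write \<open>\<langle>f, g\<rangle>\<close> for the inner product of \<open>L\<^sup>2(\<pi>)\<close> and \<open>N(\<psi>) = \<langle>\<psi>, (1 - P\<^sup>2) \<psi>\<rangle>\<close>. The kernel is only ever
  applied to bounded functions; \<open>h\<close> enters through the functional \<open>\<psi> \<mapsto> \<langle>h, (1 + P) \<psi>\<rangle>\<close>.

  Tightness bounds this functional by \<open>C \<surd>N(\<psi>)\<close>. The functions \<open>u\<^sub>k(x) = E\<^sub>x exp (i t S\<^sub>k)\<close> satisfy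
  \<open>u\<^sub>k\<^sub>+\<^sub>1 = exp (i t h) P u\<^sub>k\<close>, so their squared norm drops by \<open>N(u\<^sub>k)\<close> in each step and these energies
  sum up to at most \<open>1\<close>. Test the recursion against \<open>(1 + P) \<psi>\<close> and sum over \<open>k < K\<close>, where \<open>t\<close> is of
  order \<open>1 / \<surd>K\<close>: the right-hand side is at most \<open>\<surd>K \<surd>N(\<psi>) + O(1)\<close>, and as functions of small
  energy are weakly close to constants, the left-hand side is about
  \<open>t \<langle>h, (1 + P) \<psi>\<rangle> (\<Sum>k<K. E exp (i t S\<^sub>k))\<close>, where tightness keeps the expectations away from \<open>0\<close>.

  Let \<open>\<sigma>\<^sup>2\<close> be the supremum of \<open>2 \<langle>h, (1 + P) \<psi>\<rangle> - N(\<psi>)\<close>. For a near-maximiser \<open>f\<close>, the remainder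
  \<open>r = h - (f - P f)\<close> satisfies \<open>|\<langle>r, (1 + P) \<psi>\<rangle>| \<le> \<epsilon> \<surd>N(\<psi>)\<close>, and \<open>N(f)\<close> is close to \<open>\<sigma>\<^sup>2\<close>. For bounded
  \<open>\<psi>\<close>, reversibility makes \<open>S\<^sub>2\<^sub>n(\<psi> - P \<psi>)\<close> the sum of a forward and a backward martingale, whence
  \<open>E S\<^sub>2\<^sub>n(\<psi> - P \<psi>)\<^sup>2 \<le> 4 n N(\<psi>)\<close>; by duality \<open>E S\<^sub>2\<^sub>n(r)\<^sup>2 \<le> 4 n \<epsilon>\<^sup>2\<close>, and likewise
  \<open>E S\<^sub>2\<^sub>n(h)\<^sup>2 \<le> 4 n \<sigma>\<^sup>2\<close>. Up to this remainder and a bounded boundary term, \<open>S\<^sub>n(h)\<close> is a martingale with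
  bounded stationary increments of variance \<open>N(f)\<close>.\<close>

text \<open>Since \<open>h\<close> is merely integrable, \<open>S_n\<close> need not have a variance
  and \<open>P h\<close> need not lie in L2, so operators act on bounded test functions only, and
  second moments of \<open>S_n\<close> are obtained afterwards, by duality. The factor
  \<open>1 + P\<close> comes from <(1 - P) f, (1 + P) \<psi>> = \<open>form f \<psi>\<close>: paired
  in this way, a coboundary \<open>f - P f\<close> sees exactly the energy of the two-step kernel,
  and \<open>form \<psi> \<psi>\<close> is also the variance of the martingale difference
  \<open>\<psi>(X_1) - P \<psi>(X_0)\<close>. Even indices enter because the times 2i and 2i + 1
  together contribute one forward increment and one backward increment. The inequality (x + y)^2 <=
  2 x^2 + 2 y^2 then costs 2 for each of the two martingales, which gives 4 n and, after division by
  2 n, the factor 2 in the supremum bound. Ergodicity enters only through the convergence of the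
  iterates of \<open>P\<close>: irreducibility removes nonconstant eigenfunctions for 1,
  aperiodicity removes those for -1. The latter is what makes \<open>1 + P\<close> invertible in the
  approximate sense on which the duality rests.\<close>

definition bounded_borel :: "('a::topological_space \<Rightarrow> real) \<Rightarrow> bool" where
  "bounded_borel f \<longleftrightarrow> f \<in> borel_measurable borel \<and> (\<exists>c. \<forall>x. \<bar>f x\<bar> \<le> c)"

definition kernel_op :: "('a \<Rightarrow> 'a measure) \<Rightarrow> ('a \<Rightarrow> real) \<Rightarrow> 'a \<Rightarrow> real" where
  "kernel_op P f x = (\<integral>y. f y \<partial>P x)"

named_theorems bb

section \<open>Bounded Borel functions\<close>

lemma bounded_borelI:
  "f \<in> borel_measurable borel \<Longrightarrow> (\<And>x. \<bar>f x\<bar> \<le> c) \<Longrightarrow> bounded_borel f"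
  by (auto simp: bounded_borel_def)

lemma bounded_borelE:
  assumes "bounded_borel f"
  obtains c where "c > 0" "\<And>x. \<bar>f x\<bar> \<le> c"
proof -
  from assms obtain c where c: "\<And>x. \<bar>f x\<bar> \<le> c" by (auto simp: bounded_borel_def)
  show ?thesis
    by (rule that[of "\<bar>c\<bar> + 1"]) (use c in \<open>auto intro: order_trans[OF c] simp: le_less_trans\<close>)
qed

lemma bounded_borel_measurable [measurable_dest]:
  "bounded_borel f \<Longrightarrow> f \<in> borel_measurable borel"
  by (auto simp: bounded_borel_def)

lemma bounded_borel_const [bb]: "bounded_borel (\<lambda>_. c)"
  by (rule bounded_borelI[of _ "\<bar>c\<bar>"]) auto

lemma bounded_borel_add [bb]:
  assumes "bounded_borel f" "bounded_borel g" shows "bounded_borel (\<lambda>x. f x + g x)"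
proof -
  obtain c d where "\<And>x. \<bar>f x\<bar> \<le> c" "\<And>x. \<bar>g x\<bar> \<le> d" by (metis assms bounded_borelE)
  then have "\<bar>f x + g x\<bar> \<le> c + d" for x by (meson abs_triangle_ineq add_mono order_trans)
  moreover have "(\<lambda>x. f x + g x) \<in> borel_measurable borel"
    using assms[THEN bounded_borel_measurable] by measurable
  ultimately show ?thesis by (rule bounded_borelI[rotated])
qed

lemma bounded_borel_mult [bb]:
  assumes "bounded_borel f" "bounded_borel g" shows "bounded_borel (\<lambda>x. f x * g x)"
proof -
  obtain c d where "\<And>x. \<bar>f x\<bar> \<le> c" "\<And>x. \<bar>g x\<bar> \<le> d" by (metis assms bounded_borelE)
  then have "\<bar>f x * g x\<bar> \<le> c * d" for x
    unfolding abs_mult by (smt (verit) abs_ge_zero mult_mono)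
  moreover have "(\<lambda>x. f x * g x) \<in> borel_measurable borel"
    using assms[THEN bounded_borel_measurable] by measurable
  ultimately show ?thesis by (rule bounded_borelI[rotated])
qed

lemma bounded_borel_uminus [bb]: "bounded_borel f \<Longrightarrow> bounded_borel (\<lambda>x. - f x)"
  using bounded_borel_mult[OF bounded_borel_const[of "-1"]] by simp

lemma bounded_borel_diff [bb]:
  "bounded_borel f \<Longrightarrow> bounded_borel g \<Longrightarrow> bounded_borel (\<lambda>x. f x - g x)"
  using bounded_borel_add[OF _ bounded_borel_uminus] by simp

lemma bounded_borel_power [bb]: "bounded_borel f \<Longrightarrow> bounded_borel (\<lambda>x. f x ^ n)"
  by (induction n) (auto intro: bb)

lemma bounded_borel_sum [bb]:
  "(\<And>i. i \<in> A \<Longrightarrow> bounded_borel (f i)) \<Longrightarrow> bounded_borel (\<lambda>x. \<Sum>i\<in>A. f i x)"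
  by (induction A rule: infinite_finite_induct) (auto intro: bb)

lemma bounded_borel_abs [bb]: "bounded_borel f \<Longrightarrow> bounded_borel (\<lambda>x. \<bar>f x\<bar>)"
  unfolding bounded_borel_def by auto

lemma bounded_borel_indicator [bb]: "A \<in> sets borel \<Longrightarrow> bounded_borel (indicator A)"
  by (rule bounded_borelI[of _ 1]) (auto simp: indicator_def)

lemma bounded_borel_sin [bb]: "f \<in> borel_measurable borel \<Longrightarrow> bounded_borel (\<lambda>x. sin (f x))"
  by (rule bounded_borelI[of _ 1]) auto

lemma bounded_borel_cos [bb]: "f \<in> borel_measurable borel \<Longrightarrow> bounded_borel (\<lambda>x. cos (f x))"
  by (rule bounded_borelI[of _ 1]) auto

lemma integrable_bounded_borel:
  assumes "finite_measure \<mu>" "sets \<mu> = sets borel" "bounded_borel f"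
  shows "integrable \<mu> f"
proof -
  interpret finite_measure \<mu> by fact
  obtain c where "\<And>x. \<bar>f x\<bar> \<le> c" using assms(3) bounded_borelE by blast
  moreover have "f \<in> borel_measurable \<mu>"
    using assms(2,3) bounded_borel_measurable measurable_cong_sets by blast
  ultimately show ?thesis by (intro integrable_const_bound[of _ c]) auto
qed

section \<open>Elementary inequalities and characteristic functions\<close>

text \<open>Discriminant criterion for \<open>a - 2 s b + s^2 c\<close> being nonnegative in
  \<open>s\<close>. It gives Cauchy-Schwarz for semidefinite forms, where \<open>c = 0\<close> can
  occur, and turns near-maximality of a quadratic functional into a dual norm bound.\<close>

lemma linear_le_quadratic_imp:
  fixes a b c :: real
  assumes "\<And>s. 2 * s * b \<le> a + s\<^sup>2 * c" "0 \<le> c"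
  shows "b\<^sup>2 \<le> a * c"
proof (cases "c = 0")
  case True
  have "b = 0"
  proof (rule ccontr)
    assume "b \<noteq> 0"
    then have "2 * ((a + 1) / (2 * b)) * b = a + 1" by simp
    then show False using assms(1)[of "(a + 1) / (2 * b)"] True by simp
  qed
  then show ?thesis using True by simp
next
  case False
  with assms(2) have "c > 0" by simp
  then show ?thesis using assms(1)[of "b / c"]
    by (simp add: field_simps power2_eq_square)
qed

lemma emeasure_eq_1_iff_AE:
  assumes "prob_space \<mu>" "A \<in> sets \<mu>"
  shows "emeasure \<mu> A = 1 \<longleftrightarrow> (AE x in \<mu>. x \<in> A)"
proof -
  interpret prob_space \<mu> by fact
  show ?thesis using assms(2) by (simp add: AE_in_set_eq_1 emeasure_eq_measure)
qed

lemma (in prob_space) Cauchy_Schwarz_expectation: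
  fixes Y Z :: "'a \<Rightarrow> real"
  assumes "integrable M (\<lambda>w. (Y w)\<^sup>2)" "integrable M (\<lambda>w. (Z w)\<^sup>2)" "integrable M (\<lambda>w. Y w * Z w)"
  shows "(expectation (\<lambda>w. Y w * Z w))\<^sup>2 \<le> expectation (\<lambda>w. (Y w)\<^sup>2) * expectation (\<lambda>w. (Z w)\<^sup>2)"
proof (rule linear_le_quadratic_imp)
  fix s
  have "0 \<le> expectation (\<lambda>w. (Y w - s * Z w)\<^sup>2)" by simp
  also have "(\<lambda>w. (Y w - s * Z w)\<^sup>2) = (\<lambda>w. (Y w)\<^sup>2 - (2 * s) * (Y w * Z w) + s\<^sup>2 * (Z w)\<^sup>2)"
    by (simp add: fun_eq_iff power2_eq_square algebra_simps)
  also have "expectation \<dots> =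
      expectation (\<lambda>w. (Y w)\<^sup>2) - (2 * s) * expectation (\<lambda>w. Y w * Z w) + s\<^sup>2 * expectation (\<lambda>w. (Z w)\<^sup>2)"
    using assms by simp
  finally show "2 * s * expectation (\<lambda>w. Y w * Z w) \<le>
      expectation (\<lambda>w. (Y w)\<^sup>2) + s\<^sup>2 * expectation (\<lambda>w. (Z w)\<^sup>2)" by simp
qed simp

lemma sum_sqrt_le:
  assumes "\<And>k. k < n \<Longrightarrow> 0 \<le> f k"
  shows "(\<Sum>k<n. sqrt (f k)) \<le> sqrt (real n) * sqrt (\<Sum>k<n. f k)"
proof -
  have "(\<Sum>k<n. 1 * sqrt (f k))\<^sup>2 \<le> (\<Sum>k<n. 1\<^sup>2) * (\<Sum>k<n. (sqrt (f k))\<^sup>2)"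
    by (rule Cauchy_Schwarz_ineq_sum)
  also have "(\<Sum>k<n. (sqrt (f k))\<^sup>2) = (\<Sum>k<n. f k)" using assms by (intro sum.cong) auto
  finally have "(\<Sum>k<n. sqrt (f k))\<^sup>2 \<le> real n * (\<Sum>k<n. f k)" by simp
  then show ?thesis by (metis real_le_rsqrt real_sqrt_mult)
qed

lemma cos_sin_approx:
  fixes x :: real
  shows "\<bar>cos x - 1\<bar> \<le> x\<^sup>2 / 2" "\<bar>sin x - x\<bar> \<le> x\<^sup>2 / 2" "\<bar>cos x - 1\<bar> \<le> \<bar>x\<bar>" "\<bar>sin x - x\<bar> \<le> 2 * \<bar>x\<bar>"
proof -
  have re: "Re (iexp x) = cos x" and im: "Im (iexp x) = sin x" by (simp_all add: Re_exp Im_exp)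
  have "cmod (iexp x - (1 + \<i> * x)) \<le> x\<^sup>2 / 2"
    using iexp_approx1[of x 1] by (simp add: numeral_2_eq_2)
  then show "\<bar>cos x - 1\<bar> \<le> x\<^sup>2 / 2" "\<bar>sin x - x\<bar> \<le> x\<^sup>2 / 2"
    using abs_Re_le_cmod[of "iexp x - (1 + \<i> * x)"] abs_Im_le_cmod[of "iexp x - (1 + \<i> * x)"] re im
    by simp_all
  have "cmod (iexp x - 1) \<le> \<bar>x\<bar>" using iexp_approx1[of x 0] by simp
  then show "\<bar>cos x - 1\<bar> \<le> \<bar>x\<bar>" using abs_Re_le_cmod[of "iexp x - 1"] re by simp
  show "\<bar>sin x - x\<bar> \<le> 2 * \<bar>x\<bar>" using abs_sin_x_le_abs_x[of x] by linarith
qed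

lemma iexp_diff_le: "cmod (iexp x - iexp y) \<le> \<bar>x - y\<bar>"
proof -
  have "iexp x - iexp y = iexp y * (iexp (x - y) - 1)"
    by (simp add: right_diff_distrib exp_add[symmetric] algebra_simps)
  then have "cmod (iexp x - iexp y) = cmod (iexp (x - y) - 1)" by (simp add: norm_mult)
  also have "\<dots> \<le> \<bar>x - y\<bar>" using iexp_approx1[of "x - y" 0] by simp
  finally show ?thesis .
qed

text \<open>As \<open>q\<close> has modulus at most 1, the errors of the single steps are never
  amplified and simply add up.\<close>

lemma geometric_recursion_error:
  fixes \<phi> :: "nat \<Rightarrow> complex" and q :: real
  assumes q: "\<bar>q\<bar> \<le> 1" and 0: "\<phi> 0 = 1"
    and step: "\<And>k. cmod (\<phi> (Suc k) - complex_of_real q * \<phi> k) \<le> e k"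
  shows "cmod (\<phi> n - complex_of_real q ^ n) \<le> (\<Sum>k<n. e k)"
proof (induction n)
  case (Suc n)
  have "\<phi> (Suc n) - complex_of_real q ^ Suc n = (\<phi> (Suc n) - complex_of_real q * \<phi> n) + complex_of_real q * (\<phi> n - complex_of_real q ^ n)"
    by (simp add: algebra_simps)
  also have "cmod \<dots> \<le> e n + cmod (complex_of_real q * (\<phi> n - complex_of_real q ^ n))"
    by (rule order_trans[OF norm_triangle_ineq]) (simp add: step)
  also have "cmod (complex_of_real q * (\<phi> n - complex_of_real q ^ n)) \<le> cmod (\<phi> n - complex_of_real q ^ n)"
    using q by (simp add: norm_mult mult_left_le_one_le)
  finally show ?case using Suc by simp
qed (simp add: 0)

text \<open>For nonzero \<open>\<sigma>\<close> the law is the image of the standard normal law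
  under scaling by the absolute value of \<open>\<sigma>\<close>; for \<open>\<sigma> = 0\<close> it
  is the point mass.\<close>

lemma char_normal_law: "char (normal_law 0 (\<sigma>\<^sup>2)) t = complex_of_real (exp (- (\<sigma>\<^sup>2 * t\<^sup>2) / 2))"
  and real_distribution_normal_law: "real_distribution (normal_law 0 (\<sigma>\<^sup>2))"
proof -
  have "char (normal_law 0 (\<sigma>\<^sup>2)) t = complex_of_real (exp (- (\<sigma>\<^sup>2 * t\<^sup>2) / 2)) \<and> real_distribution (normal_law 0 (\<sigma>\<^sup>2))"
  proof (cases "\<sigma> = 0")
    case True
    have "prob_space (return borel (0::real))" by (rule prob_space_return) simp
    then have "real_distribution (return borel (0::real))"
      by (simp add: real_distribution_def real_distribution_axioms_def)
    then show ?thesis using True by (simp add: normal_law_def char_def integral_return)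
  next
    case False
    define s where "s = \<bar>\<sigma>\<bar>"
    have s: "0 < s" "s\<^sup>2 = \<sigma>\<^sup>2" "sqrt (\<sigma>\<^sup>2) = s" using False by (simp_all add: s_def)
    interpret std: real_distribution std_normal_distribution by (rule real_dist_normal_dist)
    have "distributed std_normal_distribution lborel (\<lambda>x. x) std_normal_density"
      by (auto simp: distributed_def distr_id2)
    from std.normal_density_affine[OF this, of s 0] s(1)
    have "distributed std_normal_distribution lborel (\<lambda>x. s * x) (normal_density 0 s)" by simp
    then have eq: "distr std_normal_distribution lborel (\<lambda>x. s * x) = density lborel (\<lambda>x. ennreal (normal_density 0 s x))"
      by (simp add: distributed_def)
    have law: "normal_law 0 (\<sigma>\<^sup>2) = distr std_normal_distribution borel (\<lambda>x. s * x)"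
      using False s eq by (simp add: normal_law_def cong: distr_cong)
    have "char (normal_law 0 (\<sigma>\<^sup>2)) t = char std_normal_distribution (t * s)"
      unfolding law char_def by (subst integral_distr) (auto simp: mult.assoc)
    also have "\<dots> = complex_of_real (exp (- (\<sigma>\<^sup>2 * t\<^sup>2) / 2))"
      by (simp add: char_std_normal_distribution power_mult_distrib s mult.commute)
    finally show ?thesis unfolding law by auto
  qed
  then show "char (normal_law 0 (\<sigma>\<^sup>2)) t = complex_of_real (exp (- (\<sigma>\<^sup>2 * t\<^sup>2) / 2))"
    "real_distribution (normal_law 0 (\<sigma>\<^sup>2))" by auto
qed

text \<open>The triangle inequality of L2, used to compare the norm of a partial sum with that of
  its martingale part.\<close>

lemma (in prob_space) sqrt_expectation_square_add_le:
  fixes Y Z :: "'a \<Rightarrow> real"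
  assumes Y: "integrable M (\<lambda>w. (Y w)\<^sup>2)" and Z: "integrable M (\<lambda>w. (Z w)\<^sup>2)"
    and [measurable]: "Y \<in> borel_measurable M" "Z \<in> borel_measurable M"
  shows "integrable M (\<lambda>w. (Y w + Z w)\<^sup>2)"
    "sqrt (expectation (\<lambda>w. (Y w + Z w)\<^sup>2)) \<le>
      sqrt (expectation (\<lambda>w. (Y w)\<^sup>2)) + sqrt (expectation (\<lambda>w. (Z w)\<^sup>2))"
proof -
  have YZ: "integrable M (\<lambda>w. Y w * Z w)"
  proof (rule Bochner_Integration.integrable_bound[OF Bochner_Integration.integrable_add[OF Y Z]])
    have "\<bar>Y w * Z w\<bar> \<le> (Y w)\<^sup>2 + (Z w)\<^sup>2" for w
      using sum_squares_bound[of "\<bar>Y w\<bar>" "\<bar>Z w\<bar>"] abs_ge_zero[of "Y w * Z w"]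
      unfolding abs_mult power2_abs by linarith
    then show "AE w in M. norm (Y w * Z w) \<le> norm ((Y w)\<^sup>2 + (Z w)\<^sup>2)" by simp
  qed measurable
  have eq: "(\<lambda>w. (Y w + Z w)\<^sup>2) = (\<lambda>w. (Y w)\<^sup>2 + 2 * (Y w * Z w) + (Z w)\<^sup>2)"
    by (simp add: fun_eq_iff power2_sum algebra_simps)
  show "integrable M (\<lambda>w. (Y w + Z w)\<^sup>2)" unfolding eq using Y Z YZ by simp
  let ?y = "sqrt (expectation (\<lambda>w. (Y w)\<^sup>2))" and ?z = "sqrt (expectation (\<lambda>w. (Z w)\<^sup>2))"
  have "expectation (\<lambda>w. Y w * Z w) \<le> \<bar>expectation (\<lambda>w. Y w * Z w)\<bar>" by simp
  also have "\<dots> = sqrt ((expectation (\<lambda>w. Y w * Z w))\<^sup>2)" by simp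
  also have "\<dots> \<le> ?y * ?z"
    unfolding real_sqrt_mult[symmetric] by (intro real_sqrt_le_mono Cauchy_Schwarz_expectation Y Z YZ)
  finally have "expectation (\<lambda>w. (Y w + Z w)\<^sup>2) \<le> (?y + ?z)\<^sup>2"
    unfolding eq using Y Z YZ by (simp add: power2_sum mult.assoc)
  then show "sqrt (expectation (\<lambda>w. (Y w + Z w)\<^sup>2)) \<le> ?y + ?z"
    by (intro real_le_lsqrt) auto
qed

lemma (in prob_space) expectation_abs_le_sqrt:
  fixes Y :: "'a \<Rightarrow> real"
  assumes "integrable M (\<lambda>w. (Y w)\<^sup>2)" "integrable M Y"
  shows "expectation (\<lambda>w. \<bar>Y w\<bar>) \<le> sqrt (expectation (\<lambda>w. (Y w)\<^sup>2))"
  using Cauchy_Schwarz_expectation[of "\<lambda>w. \<bar>Y w\<bar>" "\<lambda>_. 1"] assms prob_space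
  by (intro real_le_rsqrt) simp

subsection \<open>Stationary kernels\<close>

locale stationary_kernel =
  fixes P :: "'a::polish_space \<Rightarrow> 'a measure" and \<pi> :: "'a measure"
  assumes kernel: "markov_kernel P" and stationary: "stationary_distribution P \<pi>"
begin

abbreviation "Op \<equiv> kernel_op P"
abbreviation "I \<equiv> integral\<^sup>L \<pi>"

lemma kernel_prob [measurable]: "P \<in> borel \<rightarrow>\<^sub>M prob_algebra borel"
  using kernel by (simp add: markov_kernel_def)

lemma kernel_subprob [measurable]: "P \<in> borel \<rightarrow>\<^sub>M subprob_algebra borel"
  by (rule measurable_prob_algebraD[OF kernel_prob])

lemma prob_kernel: "prob_space (P x)"
  using measurable_space[OF kernel_prob, of x] by (simp add: space_prob_algebra)

lemma sets_kernel [simp, measurable_cong]: "sets (P x) = sets borel"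
  using measurable_space[OF kernel_prob, of x] by (simp add: space_prob_algebra)

lemma space_kernel [simp]: "space (P x) = UNIV"
  using sets_eq_imp_space_eq[OF sets_kernel] by simp

lemma sets_pi [simp, measurable_cong]: "sets \<pi> = sets borel"
  using stationary by (simp add: stationary_distribution_def)

lemma space_pi [simp]: "space \<pi> = UNIV"
  using sets_eq_imp_space_eq[OF sets_pi] by simp

lemma prob_pi: "prob_space \<pi>"
  using stationary by (simp add: stationary_distribution_def)

lemma pi_bind: "\<pi> \<bind> P = \<pi>"
  using stationary by (simp add: stationary_distribution_def)

sublocale pi: prob_space \<pi> by (rule prob_pi)

lemma bb_kernel: "bounded_borel f \<Longrightarrow> integrable (P x) f"
  using prob_kernel[of x] by (intro integrable_bounded_borel) (auto simp: prob_space_def)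

lemma bb_pi: "bounded_borel f \<Longrightarrow> integrable \<pi> f"
  by (intro integrable_bounded_borel pi.finite_measure_axioms) auto

lemma pi_mult_bb: "integrable \<pi> g \<Longrightarrow> bounded_borel f \<Longrightarrow> integrable \<pi> (\<lambda>x. g x * f x)"
proof -
  assume g: "integrable \<pi> g" and f: "bounded_borel f"
  have [measurable]: "f \<in> borel_measurable borel" "g \<in> borel_measurable borel"
    using g f by (auto simp: bounded_borel_measurable)
  obtain c where c: "\<And>x. \<bar>f x\<bar> \<le> c" using f by (metis bounded_borelE)
  have "\<bar>g x * f x\<bar> \<le> \<bar>c * g x\<bar>" for x
    using mult_right_mono[OF order_trans[OF c[of x] abs_ge_self[of c]] abs_ge_zero[of "g x"]]
    by (simp add: abs_mult mult.commute)
  then show ?thesis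
    by (intro Bochner_Integration.integrable_bound[OF integrable_mult_right[OF g, of c]]) auto
qed

lemma Op_bound:
  assumes "f \<in> borel_measurable borel" "\<And>x. \<bar>f x\<bar> \<le> c"
  shows "\<bar>Op f x\<bar> \<le> c"
proof -
  interpret p: prob_space "P x" by (rule prob_kernel)
  have f: "integrable (P x) f" by (rule bb_kernel, rule bounded_borelI) fact+
  have "\<bar>Op f x\<bar> \<le> (\<integral>y. \<bar>f y\<bar> \<partial>P x)" unfolding kernel_op_def by (rule integral_abs_bound)
  also have "\<dots> \<le> (\<integral>y. c \<partial>P x)" by (intro integral_mono) (use f assms in auto)
  finally show ?thesis using p.prob_space by simp
qed

lemma Op_measurable [measurable]:
  assumes [measurable]: "f \<in> borel_measurable borel" shows "Op f \<in> borel_measurable borel"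
  unfolding kernel_op_def by measurable

lemma bounded_borel_Op [bb]:
  assumes "bounded_borel f" shows "bounded_borel (Op f)"
proof -
  have [measurable]: "f \<in> borel_measurable borel" using assms by measurable
  obtain c where "\<And>x. \<bar>f x\<bar> \<le> c" using assms by (metis bounded_borelE)
  then show ?thesis by (intro bounded_borelI[of _ c] Op_bound) measurable
qed

lemma bounded_borel_Op_iter [bb]: "bounded_borel f \<Longrightarrow> bounded_borel ((Op ^^ n) f)"
  by (induction n) (auto intro: bb)

lemma Op_iter_bound:
  assumes "f \<in> borel_measurable borel" "\<And>x. \<bar>f x\<bar> \<le> c"
  shows "\<bar>(Op ^^ n) f x\<bar> \<le> c"
proof (induction n arbitrary: x)
  case (Suc n)
  have "bounded_borel ((Op ^^ n) f)" by (intro bb, rule bounded_borelI) fact+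
  then show ?case by (auto intro!: Op_bound Suc)
qed (use assms in auto)

lemma Op_const: "Op (\<lambda>_. c) = (\<lambda>_. c)"
  using prob_space.prob_space[OF prob_kernel] by (simp add: kernel_op_def fun_eq_iff)

lemma Op_add: "bounded_borel f \<Longrightarrow> bounded_borel g \<Longrightarrow> Op (\<lambda>x. f x + g x) = (\<lambda>x. Op f x + Op g x)"
  unfolding kernel_op_def by (simp add: bb_kernel fun_eq_iff)

lemma Op_diff: "bounded_borel f \<Longrightarrow> bounded_borel g \<Longrightarrow> Op (\<lambda>x. f x - g x) = (\<lambda>x. Op f x - Op g x)"
  unfolding kernel_op_def by (simp add: bb_kernel fun_eq_iff)

lemma Op_cmult: "Op (\<lambda>x. c * f x) = (\<lambda>x. c * Op f x)"
  unfolding kernel_op_def by (simp add: fun_eq_iff)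

lemma Op_sum: "(\<And>i. i \<in> A \<Longrightarrow> bounded_borel (f i)) \<Longrightarrow>
   Op (\<lambda>x. \<Sum>i\<in>A. f i x) = (\<lambda>x. \<Sum>i\<in>A. Op (f i) x)"
  unfolding kernel_op_def by (simp add: bb_kernel fun_eq_iff)

lemma Op_iter_const: "(Op ^^ n) (\<lambda>_. c) = (\<lambda>_. c)"
  by (induction n) (auto simp: Op_const)

lemma Op_iter_diff: "bounded_borel f \<Longrightarrow> bounded_borel g \<Longrightarrow>
   (Op ^^ n) (\<lambda>x. f x - g x) = (\<lambda>x. (Op ^^ n) f x - (Op ^^ n) g x)"
  by (induction n) (auto simp: Op_diff bb)

lemma Op_square_le: assumes f: "bounded_borel f" shows "(Op f x)\<^sup>2 \<le> Op (\<lambda>y. (f y)\<^sup>2) x"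
proof -
  have "0 \<le> Op (\<lambda>y. (f y - Op f x)\<^sup>2) x" unfolding kernel_op_def by simp
  also have "(\<lambda>y. (f y - Op f x)\<^sup>2) = (\<lambda>y. ((f y)\<^sup>2 - (2 * Op f x) * f y) + (Op f x)\<^sup>2)"
    by (simp add: fun_eq_iff power2_eq_square algebra_simps)
  also have "Op \<dots> x = Op (\<lambda>y. (f y)\<^sup>2) x - (2 * Op f x) * Op f x + (Op f x)\<^sup>2"
    using f by (simp add: Op_add Op_diff Op_cmult Op_const bb)
  finally show ?thesis by (simp add: power2_eq_square)
qed

lemma I_Op: assumes f: "bounded_borel f" shows "I (Op f) = I f"
proof -
  have [measurable]: "f \<in> borel_measurable borel" using f by measurable
  obtain c where c: "c > 0" "\<And>x. \<bar>f x\<bar> \<le> c" using f by (metis bounded_borelE)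
  \<comment> \<open>The shift makes the function nonnegative, so that the integral over
    \<open>\<pi> \<bind> P\<close> can be computed with \<open>nn_integral_bind\<close>; the
    constant cancels at the end.\<close>
  define g where "g = (\<lambda>x. f x + c)"
  have g: "bounded_borel g" unfolding g_def by (intro bb f)
  have [measurable]: "g \<in> borel_measurable borel" using g by measurable
  have g0: "g x \<ge> 0" for x using c(2)[of x] by (simp add: g_def)
  have Og0: "Op g x \<ge> 0" for x unfolding kernel_op_def using g0 by simp
  have "ennreal (I g) = (\<integral>\<^sup>+x. g x \<partial>\<pi>)"
    using g0 by (subst nn_integral_eq_integral) (auto intro: bb_pi g)
  also have "\<dots> = (\<integral>\<^sup>+x. g x \<partial>(\<pi> \<bind> P))" by (simp add: pi_bind)
  also have "\<dots> = (\<integral>\<^sup>+x. \<integral>\<^sup>+y. g y \<partial>P x \<partial>\<pi>)"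
    by (rule nn_integral_bind[where B=borel]) auto
  also have "\<dots> = (\<integral>\<^sup>+x. ennreal (Op g x) \<partial>\<pi>)"
    using g0 by (subst nn_integral_eq_integral) (auto intro: bb_kernel g simp: kernel_op_def)
  also have "\<dots> = ennreal (I (Op g))"
    using Og0 by (subst nn_integral_eq_integral) (auto intro!: bb_pi bb g)
  finally have "I g = I (Op g)" using g0 Og0 by (simp add: integral_nonneg_AE)
  then show ?thesis unfolding g_def
    using f by (simp add: Op_add Op_const bb bb_pi)
qed

lemma I_Op_iter: "bounded_borel f \<Longrightarrow> I ((Op ^^ n) f) = I f"
  by (induction n) (auto simp: I_Op bb)

section \<open>Absorbing sets\<close>

lemma kernel_eq_1_iff:
  "A \<in> sets borel \<Longrightarrow> emeasure (P x) A = 1 \<longleftrightarrow> (AE y in P x. y \<in> A)"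
  by (simp add: emeasure_eq_1_iff_AE prob_kernel)

lemma AE_kernel_full:
  assumes A [measurable]: "A \<in> sets borel" and ae: "AE x in \<pi>. x \<in> A"
  shows "AE x in \<pi>. emeasure (P x) A = 1"
proof -
  have "AE x in \<pi> \<bind> P. x \<in> A" using ae by (subst pi_bind)
  moreover have "(AE x in \<pi> \<bind> P. x \<in> A) \<longleftrightarrow> (AE x in \<pi>. AE y in P x. y \<in> A)"
    by (rule AE_bind[where B=borel]) measurable
  ultimately have "AE x in \<pi>. AE y in P x. y \<in> A" by simp
  then show ?thesis
    by eventually_elim (simp add: kernel_eq_1_iff)
qed

text \<open>Irreducibility and aperiodicity speak of every point, whereas the properties at hand
  hold only almost everywhere; this lemma bridges the gap. Points from which the chain may leave the
  set are removed repeatedly. Each removal is \<open>\<pi>\<close>-null by stationarity, and the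
  countable intersection is absorbing.\<close>

lemma absorbing_full_set:
  assumes Q [measurable]: "Measurable.pred borel Q" and ae: "AE x in \<pi>. Q x"
  obtains H where "H \<in> sets borel" "AE x in \<pi>. x \<in> H" "\<And>x. x \<in> H \<Longrightarrow> Q x"
    "\<And>x. x \<in> H \<Longrightarrow> emeasure (P x) H = 1"
proof -
  define H where "H = rec_nat {x. Q x} (\<lambda>_ S. {x \<in> S. emeasure (P x) S = 1})"
  have H0: "H 0 = {x. Q x}" and HS: "H (Suc k) = {x \<in> H k. emeasure (P x) (H k) = 1}" for k
    by (simp_all add: H_def)
  have m [measurable]: "H k \<in> sets borel" for k
  proof (induction k)
    case (Suc k)
    then have [measurable]: "(\<lambda>x. emeasure (P x) (H k)) \<in> borel_measurable borel"
      by (intro emeasure_measurable_subprob_algebra2[where N=borel]) auto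
    from Suc have [measurable]: "H k \<in> sets borel" .
    have "{x \<in> space borel. x \<in> H k \<and> emeasure (P x) (H k) = 1} \<in> sets borel" by measurable
    then show ?case by (simp add: HS)
  qed (use pred_def[THEN iffD1, OF Q] in \<open>simp add: H0\<close>)
  have full: "AE x in \<pi>. x \<in> H k" for k
  proof (induction k)
    case (Suc k)
    from Suc AE_kernel_full[OF m Suc] show ?case by eventually_elim (simp add: HS)
  qed (use ae in \<open>simp add: H0\<close>)
  show thesis
  proof (rule that[of "\<Inter>k. H k"])
    show "(\<Inter>k. H k) \<in> sets borel" by measurable
    show "AE x in \<pi>. x \<in> (\<Inter>k. H k)" using full by (simp add: AE_all_countable)
    show "Q x" if "x \<in> (\<Inter>k. H k)" for x using that H0 by auto
    show "emeasure (P x) (\<Inter>k. H k) = 1" if x: "x \<in> (\<Inter>k. H k)" for x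
    proof -
      interpret p: prob_space "P x" by (rule prob_kernel)
      have "emeasure (P x) (H k) = 1" for k using x HS[of k] by blast
      then have "AE y in P x. y \<in> H k" for k by (simp add: kernel_eq_1_iff)
      then have "AE y in P x. y \<in> (\<Inter>k. H k)" by (simp add: AE_all_countable)
      then show ?thesis by (simp add: kernel_eq_1_iff)
    qed
  qed
qed

lemma kernel_power_prob [measurable]: "kernel_power P n \<in> borel \<rightarrow>\<^sub>M prob_algebra borel"
proof (induction n)
  case (Suc n)
  have "(\<lambda>x. P x \<bind> kernel_power P n) \<in> borel \<rightarrow>\<^sub>M prob_algebra borel"
    by (rule measurable_bind_prob_space[OF kernel_prob Suc])
  then show ?case by (simp add: fun_eq_iff)
qed (simp add: measurable_return_prob_space)

lemma kernel_power_absorbing: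
  assumes [measurable]: "D \<in> sets borel" and D: "\<And>x. x \<in> D \<Longrightarrow> emeasure (P x) D = 1" and "x \<in> D"
  shows "emeasure (kernel_power P n x) D = 1"
  using \<open>x \<in> D\<close>
proof (induction n arbitrary: x)
  case (Suc n)
  interpret p: prob_space "P x" by (rule prob_kernel)
  have "AE y in P x. y \<in> D" using D[OF Suc.prems] by (simp add: kernel_eq_1_iff)
  then have "AE y in P x. emeasure (kernel_power P n y) D = 1" by eventually_elim (rule Suc.IH)
  moreover have "emeasure (kernel_power P (Suc n) x) D = (\<integral>\<^sup>+y. emeasure (kernel_power P n y) D \<partial>P x)"
    by (simp, rule emeasure_bind[where N=borel])
      (auto intro: measurable_prob_algebraD[OF kernel_power_prob] simp: measurable_cong_sets[OF sets_kernel refl])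
  ultimately show ?case
    by (simp add: nn_integral_cong_AE p.emeasure_space_1[simplified] cong: nn_integral_cong_AE)
qed simp

text \<open>The integrand is the integral of \<open>(f y - g x)^2\<close> over \<open>P x\<close>,
  so the hypothesis says that \<open>f(X_1) - g(X_0)\<close> has second moment 0. It is applied with
  \<open>g = f\<close> to harmonic and with \<open>g = - f\<close> to antiharmonic
  functions.\<close>

lemma AE_kernel_eqI:
  assumes f: "bounded_borel f" and g: "bounded_borel g"
    and 0: "I (\<lambda>x. Op (\<lambda>y. (f y)\<^sup>2) x - 2 * (g x * Op f x) + (g x)\<^sup>2) = 0"
  shows "AE x in \<pi>. AE y in P x. f y = g x"
proof -
  have eq: "Op (\<lambda>y. (f y)\<^sup>2) x - 2 * (g x * Op f x) + (g x)\<^sup>2 = (\<integral>y. (f y - g x)\<^sup>2 \<partial>P x)" for x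
    using f prob_space.prob_space[OF prob_kernel[of x]]
    by (simp add: power2_diff bb bb_kernel kernel_op_def)
  have "bounded_borel (\<lambda>x. Op (\<lambda>y. (f y)\<^sup>2) x - 2 * (g x * Op f x) + (g x)\<^sup>2)"
    by (intro bb f g)
  note int = bb_pi[OF this]
  have "AE x in \<pi>. Op (\<lambda>y. (f y)\<^sup>2) x - 2 * (g x * Op f x) + (g x)\<^sup>2 = 0"
    using 0 integral_nonneg_eq_0_iff_AE[OF int] by (simp add: eq)
  then show ?thesis
  proof eventually_elim
    case (elim x)
    have "integrable (P x) (\<lambda>y. (f y - g x)\<^sup>2)" by (intro bb_kernel bb f)
    then show ?case using elim by (simp add: eq integral_nonneg_eq_0_iff_AE)
  qed
qed

end

subsection \<open>Reversible kernels\<close>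

locale reversible_kernel = stationary_kernel +
  assumes reversible: "reversible P \<pi>"
begin

lemma nn_integral_edge:
  assumes [measurable]: "F \<in> borel_measurable (borel \<Otimes>\<^sub>M borel)"
  shows "(\<integral>\<^sup>+z. F z \<partial>edge_measure \<pi> P) = (\<integral>\<^sup>+x. \<integral>\<^sup>+y. F (x, y) \<partial>P x \<partial>\<pi>)"
proof -
  have K: "(\<lambda>x. distr (P x) (borel \<Otimes>\<^sub>M borel) (Pair x)) \<in> \<pi> \<rightarrow>\<^sub>M subprob_algebra (borel \<Otimes>\<^sub>M borel)"
    by (rule measurable_distr2[where M=borel]) auto
  have "(\<integral>\<^sup>+z. F z \<partial>edge_measure \<pi> P) =
      (\<integral>\<^sup>+x. \<integral>\<^sup>+z. F z \<partial>distr (P x) (borel \<Otimes>\<^sub>M borel) (Pair x) \<partial>\<pi>)"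
    unfolding edge_measure_def by (rule nn_integral_bind[OF _ K]) simp
  also have "\<dots> = (\<integral>\<^sup>+x. \<integral>\<^sup>+y. F (x, y) \<partial>P x \<partial>\<pi>)"
    by (intro nn_integral_cong nn_integral_distr) auto
  finally show ?thesis .
qed

lemma sets_edge [measurable_cong]: "sets (edge_measure \<pi> P) = sets (borel \<Otimes>\<^sub>M borel)"
  unfolding edge_measure_def by (rule sets_bind) auto

lemma nn_integral_edge_swap:
  assumes [measurable]: "F \<in> borel_measurable (borel \<Otimes>\<^sub>M borel)"
  shows "(\<integral>\<^sup>+x. \<integral>\<^sup>+y. F (x, y) \<partial>P x \<partial>\<pi>) = (\<integral>\<^sup>+x. \<integral>\<^sup>+y. F (y, x) \<partial>P x \<partial>\<pi>)"
proof -
  have m: "prod.swap \<in> edge_measure \<pi> P \<rightarrow>\<^sub>M borel \<Otimes>\<^sub>M borel"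
    unfolding prod.swap_def by measurable
  have "(\<integral>\<^sup>+z. F z \<partial>edge_measure \<pi> P) =
     (\<integral>\<^sup>+z. F z \<partial>distr (edge_measure \<pi> P) (borel \<Otimes>\<^sub>M borel) prod.swap)"
    using reversible by (simp add: reversible_def)
  also have "\<dots> = (\<integral>\<^sup>+z. F (prod.swap z) \<partial>edge_measure \<pi> P)"
    by (rule nn_integral_distr[OF m]) simp
  finally show ?thesis
    by (simp add: nn_integral_edge prod.swap_def)
qed

lemma I_Op_sym:
  assumes a: "bounded_borel a" and b: "bounded_borel b"
  shows "I (\<lambda>x. a x * Op b x) = I (\<lambda>x. Op a x * b x)"
proof -
  have *: "I (\<lambda>x. a x * Op b x) = I (\<lambda>x. Op a x * b x)"
    if a: "bounded_borel a" and b: "bounded_borel b" and a0: "\<And>x. 0 \<le> a x" and b0: "\<And>x. 0 \<le> b x" for a b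
  proof -
    have [measurable]: "a \<in> borel_measurable borel" "b \<in> borel_measurable borel"
      using a b by (auto dest: bounded_borel_measurable)
    have Op0: "0 \<le> Op a x" "0 \<le> Op b x" for x using a0 b0 by (auto simp: kernel_op_def)
    have "ennreal (I (\<lambda>x. a x * Op b x)) = (\<integral>\<^sup>+x. ennreal (a x * Op b x) \<partial>\<pi>)"
      using a0 Op0 by (subst nn_integral_eq_integral) (auto intro!: bb_pi bb a b)
    also have "\<dots> = (\<integral>\<^sup>+x. \<integral>\<^sup>+y. ennreal (a x * b y) \<partial>P x \<partial>\<pi>)"
      using a0 b0 by (subst nn_integral_eq_integral)
        (auto intro!: bb_kernel bb a b simp: kernel_op_def)
    also have "\<dots> = (\<integral>\<^sup>+x. \<integral>\<^sup>+y. ennreal (a y * b x) \<partial>P x \<partial>\<pi>)"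
      using nn_integral_edge_swap[of "\<lambda>(x, y). ennreal (a x * b y)"] by simp
    also have "\<dots> = (\<integral>\<^sup>+x. ennreal (Op a x * b x) \<partial>\<pi>)"
      using a0 b0 by (subst nn_integral_eq_integral)
        (auto intro!: bb_kernel bb a b simp: kernel_op_def)
    also have "\<dots> = ennreal (I (\<lambda>x. Op a x * b x))"
      using b0 Op0 by (subst nn_integral_eq_integral) (auto intro!: bb_pi bb a b)
    finally show ?thesis using a0 b0 Op0 by (simp add: integral_nonneg_AE)
  qed
  obtain c where c: "\<And>x. \<bar>a x\<bar> \<le> c" using a by (metis bounded_borelE)
  obtain d where d: "\<And>x. \<bar>b x\<bar> \<le> d" using b by (metis bounded_borelE)
  have pos: "0 \<le> a x + c" "0 \<le> b x + d" for x using c[of x] d[of x] by auto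
  \<comment> \<open>Symmetry of the edge measure was used for nonnegative functions; the terms
    created by the shifts cancel by invariance of \<open>\<pi>\<close>.\<close>
  have "I (\<lambda>x. (a x + c) * Op (\<lambda>x. b x + d) x) = I (\<lambda>x. Op (\<lambda>x. a x + c) x * (b x + d))"
    by (rule *) (auto intro!: bb a b pos)
  then show ?thesis
    using a b by (simp add: Op_add Op_const bb algebra_simps bb_pi I_Op)
qed

lemma I_Op_iter_sym:
  assumes "bounded_borel a" "bounded_borel b"
  shows "I (\<lambda>x. (Op ^^ m) a x * (Op ^^ n) b x) = I (\<lambda>x. a x * (Op ^^ (m + n)) b x)"
  using assms
proof (induction m arbitrary: n)
  case (Suc m)
  have "I (\<lambda>x. (Op ^^ Suc m) a x * (Op ^^ n) b x) = I (\<lambda>x. (Op ^^ m) a x * (Op ^^ Suc n) b x)"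
    using I_Op_sym[of "(Op ^^ m) a" "(Op ^^ n) b"] Suc.prems by (simp add: bb)
  also have "\<dots> = I (\<lambda>x. a x * (Op ^^ (Suc m + n)) b x)" using Suc by (simp del: funpow.simps)
  finally show ?case .
qed simp

lemma I_Op_square_le: "bounded_borel f \<Longrightarrow> I (\<lambda>x. (Op f x)\<^sup>2) \<le> I (\<lambda>x. (f x)\<^sup>2)"
  using integral_mono[of \<pi> "\<lambda>x. (Op f x)\<^sup>2" "Op (\<lambda>y. (f y)\<^sup>2)"] Op_square_le[of f]
  by (simp add: bb bb_pi I_Op)

text \<open>The Dirichlet form of the two-step kernel.\<close>

definition form :: "('a \<Rightarrow> real) \<Rightarrow> ('a \<Rightarrow> real) \<Rightarrow> real" where
  "form f g = I (\<lambda>x. f x * g x) - I (\<lambda>x. Op f x * Op g x)"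

lemma form_nonneg: "bounded_borel f \<Longrightarrow> 0 \<le> form f f"
  using I_Op_square_le[of f] by (simp add: form_def power2_eq_square)

lemma form_add:
  assumes "bounded_borel f" "bounded_borel g"
  shows "form (\<lambda>x. f x + s * g x) (\<lambda>x. f x + s * g x) = form f f + 2 * s * form f g + s\<^sup>2 * form g g"
proof -
  have 1: "(\<lambda>x. (f x + s * g x) * (f x + s * g x)) =
      (\<lambda>x. f x * f x + (2 * s) * (f x * g x) + s\<^sup>2 * (g x * g x))"
    by (simp add: fun_eq_iff algebra_simps power2_eq_square)
  have 2: "(\<lambda>x. (Op f x + s * Op g x) * (Op f x + s * Op g x)) =
      (\<lambda>x. Op f x * Op f x + (2 * s) * (Op f x * Op g x) + s\<^sup>2 * (Op g x * Op g x))"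
    by (simp add: fun_eq_iff algebra_simps power2_eq_square)
  show ?thesis
    using assms by (simp add: form_def Op_add Op_cmult bb 1 2 bb_pi) (simp add: right_diff_distrib)
qed

lemma form_Cauchy_Schwarz:
  assumes "bounded_borel f" "bounded_borel g"
  shows "(form f g)\<^sup>2 \<le> form f f * form g g"
proof (rule linear_le_quadratic_imp)
  fix s
  have "0 \<le> form (\<lambda>x. f x + (- s) * g x) (\<lambda>x. f x + (- s) * g x)"
    by (intro form_nonneg bb assms)
  then show "2 * s * form f g \<le> form f f + s\<^sup>2 * form g g"
    using assms by (simp only: form_add) simp
qed (rule form_nonneg, fact)

text \<open>This is (1 - P^2)^2 <= 1 - P^2 for an operator with 0 <= P^2 <= 1: the cross term equals
  the squared norm of \<open>Op u\<close>, which also dominates the squared norm of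
  \<open>Op (Op u)\<close>.\<close>

lemma I_diff_Op_Op_square_le:
  assumes u: "bounded_borel u"
  shows "I (\<lambda>x. (u x - Op (Op u) x)\<^sup>2) \<le> form u u"
proof -
  have "I (\<lambda>x. (u x - Op (Op u) x)\<^sup>2) =
      I (\<lambda>x. (u x)\<^sup>2) - 2 * I (\<lambda>x. u x * Op (Op u) x) + I (\<lambda>x. (Op (Op u) x)\<^sup>2)"
    using u by (simp add: power2_diff bb bb_pi mult.assoc)
  also have "I (\<lambda>x. u x * Op (Op u) x) = I (\<lambda>x. (Op u x)\<^sup>2)"
    using I_Op_sym[of u "Op u"] u by (simp add: bb power2_eq_square)
  also have "I (\<lambda>x. (Op (Op u) x)\<^sup>2) \<le> I (\<lambda>x. (Op u x)\<^sup>2)"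
    by (intro I_Op_square_le bb u)
  finally show ?thesis by (simp add: form_def power2_eq_square)
qed

section \<open>Ergodicity: harmonic functions and convergence of the iterates\<close>

text \<open>If neither \<open>A\<close> nor its complement were null, each would meet the absorbing
  full set \<open>H\<close>. A chain started in \<open>A \<inter> H\<close> never leaves
  \<open>A\<close>, so the irreducibility measure cannot charge the complement; by symmetry it
  cannot charge \<open>A\<close> either and would vanish.\<close>

lemma invariant_set_trivial:
  assumes irr: "phi_irreducible P" and [measurable]: "A \<in> sets borel"
    and inv: "AE x in \<pi>. if x \<in> A then emeasure (P x) A = 1 else emeasure (P x) (- A) = 1"
  shows "(AE x in \<pi>. x \<in> A) \<or> (AE x in \<pi>. x \<notin> A)"
proof (rule ccontr)
  assume non: "\<not> ?thesis"
  have [measurable]: "(\<lambda>x. emeasure (P x) B) \<in> borel_measurable borel" if "B \<in> sets borel" for B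
    using that by (intro emeasure_measurable_subprob_algebra2[where N=borel]) auto
  have "Measurable.pred borel (\<lambda>x. if x \<in> A then emeasure (P x) A = 1 else emeasure (P x) (- A) = 1)"
    by measurable
  from absorbing_full_set[OF this inv]
  obtain H where [measurable]: "H \<in> sets borel" and H: "AE x in \<pi>. x \<in> H"
    "\<And>x. x \<in> H \<Longrightarrow> if x \<in> A then emeasure (P x) A = 1 else emeasure (P x) (- A) = 1"
    "\<And>x. x \<in> H \<Longrightarrow> emeasure (P x) H = 1"
    by (auto simp only:)
  obtain \<phi> where \<phi>: "sets \<phi> = sets borel" "emeasure \<phi> UNIV \<noteq> 0"
    and reach: "\<And>A x. A \<in> sets borel \<Longrightarrow> emeasure \<phi> A > 0 \<Longrightarrow> \<exists>n\<ge>1. emeasure (kernel_power P n x) A > 0"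
    using irr by (auto simp: phi_irreducible_def)
  have null: "emeasure \<phi> (- B) = 0"
    if [measurable]: "B \<in> sets borel" and B: "\<And>x. x \<in> B \<inter> H \<Longrightarrow> emeasure (P x) B = 1"
      and nn: "\<not> (AE x in \<pi>. x \<notin> B)" for B
  proof (rule ccontr)
    assume "emeasure \<phi> (- B) \<noteq> 0"
    then have pos: "emeasure \<phi> (- B) > 0" by (simp add: zero_less_iff_neq_zero)
    obtain x where x: "x \<in> B \<inter> H"
    proof -
      have "\<exists>x. x \<in> B \<inter> H"
      proof (rule ccontr)
        assume "\<nexists>x. x \<in> B \<inter> H"
        with H(1) have "AE x in \<pi>. x \<notin> B" by (auto elim: eventually_mono)
        with nn show False by simp
      qed
      then show thesis using that by blast
    qed
    have D: "emeasure (P x) (B \<inter> H) = 1" if "x \<in> B \<inter> H" for x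
    proof -
      interpret p: prob_space "P x" by (rule prob_kernel)
      have "AE y in P x. y \<in> B" using B[OF that] by (simp add: kernel_eq_1_iff)
      moreover have "AE y in P x. y \<in> H" using H(3) that by (simp add: kernel_eq_1_iff)
      ultimately have "AE y in P x. y \<in> B \<inter> H" by eventually_elim simp
      then show ?thesis by (simp add: kernel_eq_1_iff)
    qed
    have "- B \<in> sets borel" by (simp add: borel_comp)
    from reach[OF this pos, of x] obtain n where n: "emeasure (kernel_power P n x) (- B) > 0" by auto
    have "kernel_power P n x \<in> space (prob_algebra borel)"
      using measurable_space[OF kernel_power_prob] by simp
    then have s: "sets (kernel_power P n x) = sets borel" and "prob_space (kernel_power P n x)"
      by (auto simp: space_prob_algebra)
    then interpret k: prob_space "kernel_power P n x" by simp
    have "emeasure (kernel_power P n x) (B \<inter> H) = 1" using D x by (intro kernel_power_absorbing) auto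
    then have "AE y in kernel_power P n x. y \<in> B \<inter> H"
      by (subst (asm) emeasure_eq_1_iff_AE[OF k.prob_space_axioms]) (auto simp: s)
    then have "AE y in kernel_power P n x. y \<notin> - B" by eventually_elim simp
    then have "emeasure (kernel_power P n x) (- B) = 0"
      using AE_iff_measurable[of "- B" "kernel_power P n x" "\<lambda>y. y \<notin> - B"] s sets_eq_imp_space_eq[OF s]
      by auto
    with n show False by simp
  qed
  have "emeasure \<phi> (- A) = 0" using non H(2) by (intro null) auto
  moreover have "emeasure \<phi> (- (- A)) = 0"
    using non H(2) by (intro null) (auto split: if_splits)
  moreover have "emeasure \<phi> UNIV \<le> emeasure \<phi> A + emeasure \<phi> (- A)"
    using emeasure_subadditive[of A \<phi> "- A"] \<phi> by (simp add: borel_comp Un_commute)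
  ultimately show False using \<phi>(2) by simp
qed

text \<open>A bounded harmonic function is constant along the edges of the chain because
  \<open>p(X_1) - p(X_0)\<close> has second moment 0. Its superlevel set at the mean is therefore
  invariant and hence null or full, and a function lying on one side of its own mean is almost
  everywhere equal to it.\<close>

lemma harmonic_const:
  assumes irr: "phi_irreducible P" and p: "bounded_borel p" and inv: "AE x in \<pi>. Op p x = p x"
  shows "AE x in \<pi>. p x = I p"
proof -
  have [measurable]: "p \<in> borel_measurable borel" using p by (rule bounded_borel_measurable)
  have "I (\<lambda>x. p x * Op p x) = I (\<lambda>x. (p x)\<^sup>2)"
    using inv by (intro integral_cong_AE) (auto simp: power2_eq_square intro: borel_measurable_times)
  then have "I (\<lambda>x. Op (\<lambda>y. (p y)\<^sup>2) x - 2 * (p x * Op p x) + (p x)\<^sup>2) = 0"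
    using p by (simp add: bb_pi bb I_Op)
  from AE_kernel_eqI[OF p p this] have ae: "AE x in \<pi>. AE y in P x. p y = p x" .
  define A where "A = {x. p x > I p}"
  have [measurable]: "A \<in> sets borel" unfolding A_def by measurable
  have "AE x in \<pi>. if x \<in> A then emeasure (P x) A = 1 else emeasure (P x) (- A) = 1"
    using ae
  proof eventually_elim
    case (elim x)
    interpret p: prob_space "P x" by (rule prob_kernel)
    show ?case
      using elim by (auto simp: kernel_eq_1_iff borel_comp simp: A_def elim: eventually_mono)
  qed
  from invariant_set_trivial[OF irr _ this] consider "AE x in \<pi>. x \<in> A" | "AE x in \<pi>. x \<notin> A" by auto
  then show ?thesis
  proof cases
    case 1
    then have "AE x in \<pi>. I p \<le> p x" by eventually_elim (simp add: A_def)
    then have "AE x in \<pi>. I p = p x"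
      by (rule integral_ineq_eq_0_then_AE) (auto intro: bb_pi p simp: pi.prob_space[simplified])
    then show ?thesis by eventually_elim simp
  next
    case 2
    then have "AE x in \<pi>. p x \<le> I p" by eventually_elim (simp add: A_def)
    then show ?thesis
      by (rule integral_ineq_eq_0_then_AE) (auto intro: bb_pi p simp: pi.prob_space[simplified])
  qed
qed

text \<open>Here \<open>m(X_1) = - m(X_0)\<close> almost surely, so the chain alternates between the
  sets where \<open>m\<close> is positive and where it is negative. Cut down to an absorbing full
  set, these two form a cycle of length 2 in the pointwise sense required by
  \<open>aperiodic\<close>.\<close>

lemma antiharmonic_zero:
  assumes aper: "aperiodic P \<pi>" and m: "bounded_borel m" and inv: "AE x in \<pi>. Op m x = - m x"
  shows "AE x in \<pi>. m x = 0"
proof -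
  have [measurable]: "m \<in> borel_measurable borel" using m by (rule bounded_borel_measurable)
  have "I (\<lambda>x. - m x * Op m x) = I (\<lambda>x. (m x)\<^sup>2)"
    using inv by (intro integral_cong_AE) (auto simp: power2_eq_square intro: borel_measurable_times)
  then have "I (\<lambda>x. Op (\<lambda>y. (m y)\<^sup>2) x - 2 * (- m x * Op m x) + (- m x)\<^sup>2) = 0"
    using m by (simp add: bb_pi bb I_Op)
  from AE_kernel_eqI[OF m bounded_borel_uminus[OF m] this]
  have ae: "AE x in \<pi>. AE y in P x. m y = - m x" .
  define A where "A s = {x. s * m x > 0}" for s :: real
  have A [measurable]: "A s \<in> sets borel" for s unfolding A_def by measurable
  have [measurable]: "(\<lambda>x. emeasure (P x) B) \<in> borel_measurable borel" if "B \<in> sets borel" for B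
    using that by (intro emeasure_measurable_subprob_algebra2[where N=borel]) auto
  define Q where "Q x \<longleftrightarrow> (x \<in> A 1 \<longrightarrow> emeasure (P x) (A (-1)) = 1) \<and> (x \<in> A (-1) \<longrightarrow> emeasure (P x) (A 1) = 1)" for x
  have Qm: "Measurable.pred borel Q" unfolding Q_def by measurable
  have "AE x in \<pi>. Q x"
    using ae
  proof eventually_elim
    case (elim x)
    interpret p: prob_space "P x" by (rule prob_kernel)
    show ?case unfolding Q_def
      using elim by (auto simp: kernel_eq_1_iff borel_comp simp: A_def elim: eventually_mono)
  qed
  then obtain H where [measurable]: "H \<in> sets borel" and H: "AE x in \<pi>. x \<in> H"
    "\<And>x. x \<in> H \<Longrightarrow> Q x" "\<And>x. x \<in> H \<Longrightarrow> emeasure (P x) H = 1"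
    by (rule absorbing_full_set[OF Qm]) blast
  have step: "emeasure (P x) (A (- s) \<inter> H) = 1" if "x \<in> A s \<inter> H" "s = 1 \<or> s = - 1" for x s
  proof -
    interpret p: prob_space "P x" by (rule prob_kernel)
    have "emeasure (P x) (A (- s)) = 1" using H(2)[of x] that by (auto simp: Q_def)
    then have "AE y in P x. y \<in> A (- s)" by (simp add: kernel_eq_1_iff)
    moreover have "AE y in P x. y \<in> H" using H(3) that by (simp add: kernel_eq_1_iff)
    ultimately have "AE y in P x. y \<in> A (- s) \<inter> H" by eventually_elim simp
    then show ?thesis by (simp add: kernel_eq_1_iff)
  qed
  have null: "emeasure \<pi> (A s \<inter> H) = 0" if s: "s = 1 \<or> s = - 1" for s
  proof (rule ccontr)
    assume "emeasure \<pi> (A s \<inter> H) \<noteq> 0"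
    then have pos: "emeasure \<pi> (A s \<inter> H) > 0" by (simp add: zero_less_iff_neq_zero)
    \<comment> \<open>The cycle is started at whichever sign is assumed to have positive measure,
      since \<open>aperiodic\<close> asks for this of \<open>D 0\<close>.\<close>
    define D where "D i = (if i = 0 then A s else A (- s)) \<inter> H" for i :: nat
    have "\<exists>D :: nat \<Rightarrow> 'a set. (\<forall>i<2. D i \<in> sets borel) \<and> disjoint_family_on D {..<2} \<and>
          (\<forall>i<2. \<forall>x\<in>D i. emeasure (P x) (D (Suc i mod 2)) = 1) \<and> emeasure \<pi> (D 0) > 0"
    proof (intro exI[of _ D] conjI allI impI ballI)
      show "D i \<in> sets borel" for i unfolding D_def by measurable
      show "disjoint_family_on D {..<2}"
        by (auto simp: disjoint_family_on_def D_def A_def)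
      show "emeasure (P x) (D (Suc i mod 2)) = 1" if "i < 2" "x \<in> D i" for i x
        using that step[of x s] step[of x "- s"] s by (cases "i = 0") (auto simp: D_def less_2_cases_iff)
    qed (use pos in \<open>simp add: D_def\<close>)
    with aper show False unfolding aperiodic_def by blast
  qed
  have "AE x in \<pi>. x \<notin> A s \<inter> H" if "s = 1 \<or> s = - 1" for s
    by (rule AE_I[OF _ null[OF that]]) auto
  then have "AE x in \<pi>. x \<notin> A 1 \<inter> H" "AE x in \<pi>. x \<notin> A (- 1) \<inter> H" by simp_all
  with H(1) show ?thesis by eventually_elim (auto simp: A_def)
qed

lemma I_abs_square_le:
  assumes f: "bounded_borel f"
  shows "(I (\<lambda>x. \<bar>f x\<bar>))\<^sup>2 \<le> I (\<lambda>x. (f x)\<^sup>2)"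
proof -
  let ?m = "I (\<lambda>x. \<bar>f x\<bar>)"
  have "0 \<le> I (\<lambda>x. (\<bar>f x\<bar> - ?m)\<^sup>2)" by simp
  also have "\<dots> = I (\<lambda>x. (f x)\<^sup>2 - (2 * ?m) * \<bar>f x\<bar> + ?m\<^sup>2)"
    by (intro Bochner_Integration.integral_cong) (auto simp: power2_diff)
  also have "\<dots> = I (\<lambda>x. (f x)\<^sup>2) - (2 * ?m) * ?m + ?m\<^sup>2"
    using f pi.prob_space by (simp add: bb bb_pi)
  finally show ?thesis by (simp add: power2_eq_square)
qed

text \<open>The squared norms of the iterates converge and determine the inner products of the even
  iterates, which therefore form a Cauchy sequence in \<open>L\<^sup>2\<close>; their limit is fixed by the two-step kernel, hence splits into
  a harmonic and an anti-harmonic part.\<close>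

lemma Op_iter_L2_tendsto_0:
  assumes irr: "phi_irreducible P" and aper: "aperiodic P \<pi>"
    and f: "bounded_borel f" and If: "I f = 0"
  shows "(\<lambda>n. I (\<lambda>x. ((Op ^^ n) f x)\<^sup>2)) \<longlonglongrightarrow> 0"
proof -
  define a where "a n = I (\<lambda>x. ((Op ^^ n) f x)\<^sup>2)" for n
  define v where "v n = (Op ^^ (2 * n)) f" for n
  have v [bb]: "bounded_borel (v n)" for n unfolding v_def by (intro bb f)
  have [measurable]: "v n \<in> borel_measurable borel" for n by (rule bounded_borel_measurable[OF v])
  \<comment> \<open>By self-adjointness the inner product of two iterates depends only on the sum of
    the exponents; it is a squared norm if that sum is even. This is why only even iterates
    \<open>v n\<close> are considered.\<close>
  have a_alt: "I (\<lambda>x. (Op ^^ m) f x * (Op ^^ n) f x) = a k" if "m + n = 2 * k" for m n k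
    unfolding a_def power2_eq_square using f that by (simp add: I_Op_iter_sym mult_2)
  have a0: "0 \<le> a n" for n unfolding a_def by simp
  have "decseq a"
    unfolding a_def by (intro decseq_SucI) (use f in \<open>simp add: I_Op_square_le bb\<close>)
  then obtain L where L: "a \<longlonglongrightarrow> L" using a0 by (metis decseq_convergent)
  have d: "I (\<lambda>x. (v n x - v m x)\<^sup>2) = a (2 * n) + a (2 * m) - 2 * a (n + m)" for n m
  proof -
    have "(\<lambda>x. (v n x - v m x)\<^sup>2) = (\<lambda>x. v n x * v n x + v m x * v m x - 2 * (v n x * v m x))"
      by (simp add: fun_eq_iff power2_eq_square algebra_simps)
    then have "I (\<lambda>x. (v n x - v m x)\<^sup>2) = I (\<lambda>x. v n x * v n x) + I (\<lambda>x. v m x * v m x) - 2 * I (\<lambda>x. v n x * v m x)"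
      by (simp add: bb bb_pi)
    moreover have "I (\<lambda>x. v n x * v n x) = a (2 * n)" "I (\<lambda>x. v m x * v m x) = a (2 * m)"
      "I (\<lambda>x. v n x * v m x) = a (n + m)"
      unfolding v_def by (intro a_alt, simp)+
    ultimately show ?thesis by simp
  qed
  have cauchy: "\<exists>N. \<forall>n\<ge>N. \<forall>m\<ge>N. I (\<lambda>x. (v n x - v m x)\<^sup>2) \<le> e" if "e > 0" for e
  proof -
    from L that obtain N where N: "\<And>n. n \<ge> N \<Longrightarrow> \<bar>a n - L\<bar> < e / 4"
      by (metis LIMSEQ_iff divide_pos_pos real_norm_def zero_less_numeral)
    have "I (\<lambda>x. (v n x - v m x)\<^sup>2) \<le> e" if "n \<ge> N" "m \<ge> N" for n m
      using N[of "2 * n"] N[of "2 * m"] N[of "n + m"] that unfolding d by linarith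
    then show ?thesis by blast
  qed
  \<comment> \<open>Riesz-Fischer by hand: gaps of size 2^-k in L2 are summable in L1, so the
    subsequence converges almost everywhere, and its limit is an actual Borel function.\<close>
  obtain r where r: "strict_mono r"
    and rI: "\<And>k. \<forall>n\<ge>r k. \<forall>m\<ge>r k. I (\<lambda>x. (v n x - v m x)\<^sup>2) \<le> ((1/2) ^ k)\<^sup>2"
  proof -
    have "\<exists>r. \<forall>k. (\<forall>n\<ge>r k. \<forall>m\<ge>r k. I (\<lambda>x. (v n x - v m x)\<^sup>2) \<le> ((1/2) ^ k)\<^sup>2) \<and> r k < r (Suc k)"
    proof (rule dependent_nat_choice)
      show "\<exists>N. \<forall>n\<ge>N. \<forall>m\<ge>N. I (\<lambda>x. (v n x - v m x)\<^sup>2) \<le> ((1/2) ^ 0)\<^sup>2"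
        by (rule cauchy) simp
    next
      fix N :: nat and k
      obtain N' where "\<forall>n\<ge>N'. \<forall>m\<ge>N'. I (\<lambda>x. (v n x - v m x)\<^sup>2) \<le> ((1/2) ^ Suc k)\<^sup>2"
        using cauchy[of "((1/2) ^ Suc k)\<^sup>2"] by auto
      then show "\<exists>y. (\<forall>n\<ge>y. \<forall>m\<ge>y. I (\<lambda>x. (v n x - v m x)\<^sup>2) \<le> ((1/2) ^ Suc k)\<^sup>2) \<and> N < y"
        by (intro exI[of _ "max N' (Suc N)"]) auto
    qed
    then show thesis using that by (auto simp: strict_mono_Suc_iff)
  qed
  define dd where "dd k x = v (r (Suc k)) x - v (r k) x" for k x
  have dd [bb]: "bounded_borel (dd k)" for k unfolding dd_def by (intro bb)
  have [measurable]: "dd k \<in> borel_measurable borel" for k by (rule bounded_borel_measurable[OF dd])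
  have Idd: "I (\<lambda>x. \<bar>dd k x\<bar>) \<le> (1/2) ^ k" for k
  proof -
    have "(I (\<lambda>x. \<bar>dd k x\<bar>))\<^sup>2 \<le> I (\<lambda>x. (dd k x)\<^sup>2)" by (intro I_abs_square_le bb)
    also have "\<dots> \<le> ((1/2) ^ k)\<^sup>2"
      unfolding dd_def using rI[of k] strict_monoD[OF r, of k "Suc k"] by simp
    finally show ?thesis by (rule power2_le_imp_le) simp
  qed
  have "(\<integral>\<^sup>+x. (\<Sum>k. ennreal \<bar>dd k x\<bar>) \<partial>\<pi>) = (\<Sum>k. \<integral>\<^sup>+x. ennreal \<bar>dd k x\<bar> \<partial>\<pi>)"
    by (rule nn_integral_suminf) measurable
  also have "\<dots> = (\<Sum>k. ennreal (I (\<lambda>x. \<bar>dd k x\<bar>)))"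
    by (subst nn_integral_eq_integral) (auto intro!: bb_pi bb)
  also have "\<dots> \<le> (\<Sum>k. ennreal ((1/2) ^ k))"
    by (intro suminf_le ennreal_leI Idd) auto
  also have "\<dots> = ennreal (\<Sum>k. (1/2) ^ k)"
    by (rule suminf_ennreal2) (auto intro: summable_geometric)
  also have "\<dots> < \<infinity>" by simp
  finally have "(\<integral>\<^sup>+x. (\<Sum>k. ennreal \<bar>dd k x\<bar>) \<partial>\<pi>) \<noteq> \<infinity>" by simp
  then have "AE x in \<pi>. (\<Sum>k. ennreal \<bar>dd k x\<bar>) \<noteq> \<infinity>"
    by (intro nn_integral_PInf_AE) measurable
  then have conv: "AE x in \<pi>. convergent (\<lambda>k. v (r k) x)"
  proof eventually_elim
    case (elim x)
    then have "summable (\<lambda>k. \<bar>dd k x\<bar>)" by (intro summable_suminf_not_top) auto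
    then have "summable (\<lambda>k. dd k x)" by (rule summable_rabs_cancel)
    then have "convergent (\<lambda>n. \<Sum>k<n. dd k x)" by (simp add: summable_iff_convergent)
    moreover have "(\<Sum>k<n. dd k x) = v (r n) x - v (r 0) x" for n
      unfolding dd_def by (rule sum_lessThan_telescope)
    ultimately show ?case
      using convergent_add[OF _ convergent_const[of "v (r 0) x"], of "\<lambda>n. v (r n) x - v (r 0) x"] by simp
  qed
  obtain c where c: "\<And>x. \<bar>f x\<bar> \<le> c" using f by (metis bounded_borelE)
  have vc: "\<bar>v n x\<bar> \<le> c" for n x
    unfolding v_def by (rule Op_iter_bound) (use f c in \<open>auto dest: bounded_borel_measurable\<close>)
  have c0: "0 \<le> c" using c abs_ge_zero order_trans by blast
  \<comment> \<open>\<open>lim\<close> is unspecified where the sequence diverges; truncation at the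
    common bound \<open>c\<close> makes \<open>u\<close> bounded everywhere without changing it at
    points of convergence.\<close>
  define u where "u x = max (- c) (min c (lim (\<lambda>k. v (r k) x)))" for x
  have [measurable]: "u \<in> borel_measurable borel"
    unfolding u_def by measurable
  have uc: "\<bar>u x\<bar> \<le> c" for x unfolding u_def using c0 by auto
  have u [bb]: "bounded_borel u" by (rule bounded_borelI[OF _ uc]) measurable
  have lim: "AE x in \<pi>. (\<lambda>k. v (r k) x) \<longlonglongrightarrow> u x"
    using conv
  proof eventually_elim
    case (elim x)
    then have *: "(\<lambda>k. v (r k) x) \<longlonglongrightarrow> lim (\<lambda>k. v (r k) x)" by (simp add: convergent_LIMSEQ_iff)
    have "lim (\<lambda>k. v (r k) x) \<le> c" by (rule LIMSEQ_le_const2[OF *]) (use vc in \<open>auto simp: abs_le_iff\<close>)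
    moreover have "- c \<le> lim (\<lambda>k. v (r k) x)"
      by (rule LIMSEQ_le_const[OF *]) (use vc in \<open>auto simp: abs_le_iff minus_le_iff\<close>)
    ultimately show ?case using * by (simp add: u_def)
  qed
  have L2: "(\<lambda>k. I (\<lambda>x. (v (r k) x - u x)\<^sup>2)) \<longlonglongrightarrow> 0"
  proof -
    have "(\<lambda>k. I (\<lambda>x. (v (r k) x - u x)\<^sup>2)) \<longlonglongrightarrow> I (\<lambda>x. 0)"
    proof (rule integral_dominated_convergence[where w="\<lambda>x. (2 * c)\<^sup>2"])
      show "AE x in \<pi>. (\<lambda>k. (v (r k) x - u x)\<^sup>2) \<longlonglongrightarrow> 0"
        using lim by eventually_elim (auto intro!: tendsto_eq_intros)
      show "AE x in \<pi>. norm ((v (r k) x - u x)\<^sup>2) \<le> (2 * c)\<^sup>2" for k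
      proof (rule AE_I2)
        fix x
        have "\<bar>v (r k) x - u x\<bar> \<le> 2 * c" using vc[of "r k" x] uc[of x] by linarith
        then show "norm ((v (r k) x - u x)\<^sup>2) \<le> (2 * c)\<^sup>2"
          using power_mono[of "\<bar>v (r k) x - u x\<bar>" "2 * c" 2] by simp
      qed
    qed auto
    then show ?thesis by simp
  qed
  have OpOp_v: "Op (Op (v n)) = v (Suc n)" for n by (simp add: v_def)
  have fixed: "I (\<lambda>x. (Op (Op u) x - u x)\<^sup>2) = 0"
  proof -
    have le: "I (\<lambda>x. (Op (Op u) x - u x)\<^sup>2) \<le>
      3 * (2 * I (\<lambda>x. (v (r k) x - u x)\<^sup>2) + I (\<lambda>x. (v (Suc (r k)) x - v (r k) x)\<^sup>2))" for k
    proof -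
      have "I (\<lambda>x. (Op (Op u) x - u x)\<^sup>2) \<le> I (\<lambda>x. 3 * ((v (Suc (r k)) x - Op (Op u) x)\<^sup>2
         + (v (Suc (r k)) x - v (r k) x)\<^sup>2 + (v (r k) x - u x)\<^sup>2))"
      proof (intro integral_mono bb_pi bb)
        fix x
        have "(p - q)\<^sup>2 \<le> 3 * ((s - p)\<^sup>2 + (s - t)\<^sup>2 + (t - q)\<^sup>2)" for p q s t :: real by sos
        then show "(Op (Op u) x - u x)\<^sup>2 \<le> 3 * ((v (Suc (r k)) x - Op (Op u) x)\<^sup>2
         + (v (Suc (r k)) x - v (r k) x)\<^sup>2 + (v (r k) x - u x)\<^sup>2)" .
      qed
      also have "\<dots> = 3 * (I (\<lambda>x. (v (Suc (r k)) x - Op (Op u) x)\<^sup>2)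
         + I (\<lambda>x. (v (Suc (r k)) x - v (r k) x)\<^sup>2) + I (\<lambda>x. (v (r k) x - u x)\<^sup>2))"
        by (simp add: bb bb_pi)
      also have "I (\<lambda>x. (v (Suc (r k)) x - Op (Op u) x)\<^sup>2) \<le> I (\<lambda>x. (v (r k) x - u x)\<^sup>2)"
      proof -
        have "(\<lambda>x. v (Suc (r k)) x - Op (Op u) x) = Op (Op (\<lambda>x. v (r k) x - u x))"
          by (simp add: Op_diff bb OpOp_v)
        then show ?thesis
          using I_Op_square_le[of "Op (\<lambda>x. v (r k) x - u x)"] I_Op_square_le[of "\<lambda>x. v (r k) x - u x"]
          by (simp add: bb fun_eq_iff)
      qed
      finally show ?thesis by simp
    qed
    have r_top: "filterlim r at_top sequentially" by (rule filterlim_subseq[OF r])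
    have "(\<lambda>n. a (2 * n + 2) + a (2 * n) - 2 * a (2 * n + 1)) \<longlonglongrightarrow> L + L - 2 * L"
      by (intro tendsto_intros filterlim_compose[OF L])
        (auto intro!: filterlim_subseq simp: strict_mono_def)
    moreover have "2 * Suc n = 2 * n + 2" "Suc n + n = 2 * n + 1" for n by auto
    ultimately have "(\<lambda>n. I (\<lambda>x. (v (Suc n) x - v n x)\<^sup>2)) \<longlonglongrightarrow> 0" by (simp only: d) simp
    from filterlim_compose[OF this r_top]
    have "(\<lambda>k. 3 * (2 * I (\<lambda>x. (v (r k) x - u x)\<^sup>2) + I (\<lambda>x. (v (Suc (r k)) x - v (r k) x)\<^sup>2)))
       \<longlonglongrightarrow> 3 * (2 * 0 + 0)"
      by (intro tendsto_intros L2)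
    then have "I (\<lambda>x. (Op (Op u) x - u x)\<^sup>2) \<le> 0"
      by (intro LIMSEQ_le_const) (use le in auto)
    then show ?thesis by (simp add: antisym)
  qed
  then have fixed': "AE x in \<pi>. Op (Op u) x = u x"
    using integral_nonneg_eq_0_iff_AE[of \<pi> "\<lambda>x. (Op (Op u) x - u x)\<^sup>2"] by (simp add: bb bb_pi)
  have Iu: "I u = 0"
  proof -
    have "(\<lambda>k. I (v (r k))) \<longlonglongrightarrow> I u"
      by (rule integral_dominated_convergence[where w="\<lambda>_. c"]) (use lim vc in auto)
    moreover have "I (v (r k)) = 0" for k unfolding v_def using f If by (simp add: I_Op_iter)
    ultimately show ?thesis by (simp add: LIMSEQ_const_iff)
  qed
  \<comment> \<open>With \<open>Op (Op u) = u\<close> almost everywhere, \<open>u + Op u\<close> is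
    harmonic of mean 0 and \<open>u - Op u\<close> is antiharmonic. Both vanish, hence so does their
    sum \<open>2 u\<close>.\<close>
  have "AE x in \<pi>. u x + Op u x = I (\<lambda>x. u x + Op u x)"
    by (rule harmonic_const[OF irr]) (use fixed' in \<open>auto intro!: bb simp: Op_add bb\<close>)
  moreover have "I (\<lambda>x. u x + Op u x) = 0" using Iu by (simp add: bb bb_pi I_Op)
  moreover have "AE x in \<pi>. u x - Op u x = 0"
    by (rule antiharmonic_zero[OF aper]) (use fixed' in \<open>auto intro!: bb simp: Op_diff bb\<close>)
  ultimately have "AE x in \<pi>. u x = 0" by auto
  then have "I (\<lambda>x. (v (r k) x - u x)\<^sup>2) = a (2 * r k)" for k
    unfolding a_def v_def[symmetric] by (intro integral_cong_AE) auto
  with L2 have "(\<lambda>k. a (2 * r k)) \<longlonglongrightarrow> 0" by simp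
  moreover have "(\<lambda>k. a (2 * r k)) \<longlonglongrightarrow> L"
    by (intro filterlim_compose[OF L] filterlim_subseq) (use r in \<open>auto simp: strict_mono_def\<close>)
  ultimately have "L = 0" using LIMSEQ_unique by blast
  with L show ?thesis by (simp add: a_def[abs_def])
qed

lemma integrable_approx_bounded:
  assumes g: "integrable \<pi> g" and e: "0 < e"
  obtains g' where "bounded_borel g'" "I (\<lambda>x. \<bar>g x - g' x\<bar>) < e"
proof -
  have [measurable]: "g \<in> borel_measurable borel" using g by (auto dest: borel_measurable_integrable)
  define t where "t k x = (if \<bar>g x\<bar> \<le> real k then g x else 0)" for k :: nat and x
  have [measurable]: "t k \<in> borel_measurable borel" for k unfolding t_def by measurable
  have "(\<lambda>k. I (\<lambda>x. \<bar>g x - t k x\<bar>)) \<longlonglongrightarrow> I (\<lambda>x. 0)"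
  proof (rule integral_dominated_convergence[where w="\<lambda>x. \<bar>g x\<bar>"])
    show "AE x in \<pi>. (\<lambda>k. \<bar>g x - t k x\<bar>) \<longlonglongrightarrow> 0"
    proof (rule AE_I2, rule tendsto_eventually)
      fix x
      obtain k0 where "\<bar>g x\<bar> \<le> real k0" using real_arch_simple by blast
      then show "\<forall>\<^sub>F k in sequentially. \<bar>g x - t k x\<bar> = 0"
        by (intro eventually_sequentiallyI[of k0]) (auto simp: t_def)
    qed
  qed (use g in \<open>auto simp: t_def\<close>)
  then have "eventually (\<lambda>k. I (\<lambda>x. \<bar>g x - t k x\<bar>) < e) sequentially"
    using e by (auto dest: order_tendstoD)
  then obtain k where "I (\<lambda>x. \<bar>g x - t k x\<bar>) < e" by (auto simp: eventually_sequentially)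
  moreover have "bounded_borel (t k)"
    by (rule bounded_borelI[of _ "real k"]) (auto simp: t_def)
  ultimately show thesis using that by blast
qed

lemma Op_iter_L1_tendsto_0:
  assumes irr: "phi_irreducible P" and aper: "aperiodic P \<pi>"
    and f: "bounded_borel f" and If: "I f = 0"
  shows "(\<lambda>n. I (\<lambda>x. \<bar>(Op ^^ n) f x\<bar>)) \<longlonglongrightarrow> 0"
proof -
  have "(\<lambda>n. sqrt (I (\<lambda>x. ((Op ^^ n) f x)\<^sup>2))) \<longlonglongrightarrow> sqrt 0"
    by (intro tendsto_real_sqrt Op_iter_L2_tendsto_0 assms)
  then have lim: "(\<lambda>n. sqrt (I (\<lambda>x. ((Op ^^ n) f x)\<^sup>2))) \<longlonglongrightarrow> 0" by simp
  have "I (\<lambda>x. \<bar>(Op ^^ n) f x\<bar>) \<le> sqrt (I (\<lambda>x. ((Op ^^ n) f x)\<^sup>2))" for n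
    by (intro real_le_rsqrt I_abs_square_le bb f)
  then show ?thesis
    by (intro tendsto_sandwich[OF _ _ tendsto_const lim] always_eventually) auto
qed

text \<open>L2 convergence cannot be tested directly against a merely integrable \<open>g\<close>.
  Splitting \<open>g\<close> into a bounded part and a part small in L1, the uniform bound on the
  iterates controls the latter and their L1 convergence the former.\<close>

lemma integral_mult_Op_iter_tendsto:
  assumes irr: "phi_irreducible P" and aper: "aperiodic P \<pi>"
    and g: "integrable \<pi> g" and f: "bounded_borel f"
  shows "(\<lambda>n. I (\<lambda>x. g x * (Op ^^ n) f x)) \<longlonglongrightarrow> I g * I f"
proof -
  define f0 where "f0 x = f x - I f" for x
  have f0 [bb]: "bounded_borel f0" unfolding f0_def by (intro bb f)
  have If0: "I f0 = 0" unfolding f0_def using f pi.prob_space by (simp add: bb bb_pi)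
  obtain c where c: "c > 0" "\<And>x. \<bar>f0 x\<bar> \<le> c" using f0 by (metis bounded_borelE)
  have cn: "\<bar>(Op ^^ n) f0 x\<bar> \<le> c" for n x
    by (rule Op_iter_bound) (use f0 c in \<open>auto dest: bounded_borel_measurable\<close>)
  have lim: "(\<lambda>n. I (\<lambda>x. g x * (Op ^^ n) f0 x)) \<longlonglongrightarrow> 0"
  proof (rule LIMSEQ_I)
    fix e :: real assume e: "0 < e"
    then have "0 < e / (2 * c)" using c(1) by simp
    from integrable_approx_bounded[OF g this]
    obtain g' where g': "bounded_borel g'" "I (\<lambda>x. \<bar>g x - g' x\<bar>) < e / (2 * c)" .
    obtain d where d: "d > 0" "\<And>x. \<bar>g' x\<bar> \<le> d" using g' by (metis bounded_borelE)
    have "eventually (\<lambda>n. I (\<lambda>x. \<bar>(Op ^^ n) f0 x\<bar>) < e / (2 * d)) sequentially"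
      using order_tendstoD(2)[OF Op_iter_L1_tendsto_0[OF irr aper f0 If0]] e d(1) by simp
    then obtain N where N: "\<And>n. n \<ge> N \<Longrightarrow> I (\<lambda>x. \<bar>(Op ^^ n) f0 x\<bar>) < e / (2 * d)"
      by (auto simp: eventually_sequentially)
    have "norm (I (\<lambda>x. g x * (Op ^^ n) f0 x) - 0) < e" if "n \<ge> N" for n
    proof -
      have "\<bar>I (\<lambda>x. g x * (Op ^^ n) f0 x)\<bar> \<le> I (\<lambda>x. \<bar>g x * (Op ^^ n) f0 x\<bar>)"
        by (rule integral_abs_bound)
      also have "\<dots> \<le> I (\<lambda>x. c * \<bar>g x - g' x\<bar> + d * \<bar>(Op ^^ n) f0 x\<bar>)"
      proof (intro integral_mono)
        fix x
        have "\<bar>g x * (Op ^^ n) f0 x\<bar> \<le> \<bar>g x - g' x\<bar> * \<bar>(Op ^^ n) f0 x\<bar> + \<bar>g' x\<bar> * \<bar>(Op ^^ n) f0 x\<bar>"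
          unfolding abs_mult[symmetric] by (rule order_trans[OF _ abs_triangle_ineq]) (simp add: algebra_simps)
        also have "\<dots> \<le> \<bar>g x - g' x\<bar> * c + d * \<bar>(Op ^^ n) f0 x\<bar>"
          by (intro add_mono mult_left_mono mult_right_mono cn d) auto
        finally show "\<bar>g x * (Op ^^ n) f0 x\<bar> \<le> c * \<bar>g x - g' x\<bar> + d * \<bar>(Op ^^ n) f0 x\<bar>"
          by (simp add: mult.commute)
      qed (intro Bochner_Integration.integrable_add integrable_mult_right integrable_abs
          Bochner_Integration.integrable_diff g pi_mult_bb bb_pi[OF g'(1)] bounded_borel_Op_iter f0
          bb_pi[OF bounded_borel_Op_iter[OF f0]])+
      also have "\<dots> = c * I (\<lambda>x. \<bar>g x - g' x\<bar>) + d * I (\<lambda>x. \<bar>(Op ^^ n) f0 x\<bar>)"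
        using g g'(1) by (simp add: bb bb_pi)
      also have "\<dots> < c * (e / (2 * c)) + d * (e / (2 * d))"
        using g'(2) N[OF that] c(1) d(1) by (intro add_strict_mono mult_strict_left_mono) auto
      finally show ?thesis using c(1) d(1) by simp
    qed
    then show "\<exists>no. \<forall>n\<ge>no. norm (I (\<lambda>x. g x * (Op ^^ n) f0 x) - 0) < e" by blast
  qed
  have "I (\<lambda>x. g x * (Op ^^ n) f x) = I (\<lambda>x. g x * (Op ^^ n) f0 x) + I g * I f" for n
  proof -
    have "(Op ^^ n) f0 = (\<lambda>x. (Op ^^ n) f x - I f)"
      unfolding f0_def using f by (simp add: Op_iter_diff Op_iter_const bb)
    then have "I (\<lambda>x. g x * (Op ^^ n) f0 x) = I (\<lambda>x. g x * (Op ^^ n) f x - I f * g x)"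
      by (simp add: algebra_simps)
    also have "\<dots> = I (\<lambda>x. g x * (Op ^^ n) f x) - I f * I g"
      using g f by (simp add: pi_mult_bb bb)
    finally show ?thesis by simp
  qed
  then show ?thesis using tendsto_add[OF lim tendsto_const[of "I g * I f"]] by simp
qed

text \<open>\<open>\<psi>\<close> approximates \<open>(1 + P)\<^sup>-\<^sup>1 \<phi>\<close>.\<close>

lemma inverse_one_plus_Op_approx:
  assumes \<phi>: "bounded_borel \<phi>"
  obtains \<psi> where "bounded_borel \<psi>" "\<And>x. \<psi> x + Op \<psi> x = \<phi> x - (Op ^^ (2 * m)) \<phi> x"
    "form \<psi> \<psi> \<le> I (\<lambda>x. \<phi> x * (\<psi> x - Op \<psi> x))"
proof -
  define \<eta> where "\<eta> x = \<phi> x - Op \<phi> x" for x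
  have \<eta> [bb]: "bounded_borel \<eta>" unfolding \<eta>_def by (intro bb \<phi>)
  \<comment> \<open>A truncated Neumann series: (1 + P)^-1 = (1 - P) (1 - P^2)^-1, the second factor
    being the sum of the powers P^(2i). Applying \<open>1 + P\<close> makes the sum
    telescope.\<close>
  define \<psi> where "\<psi> x = (\<Sum>i<m. (Op ^^ (2 * i)) \<eta> x)" for x
  have \<psi> [bb]: "bounded_borel \<psi>" unfolding \<psi>_def by (intro bb)
  have Op\<psi>: "Op \<psi> x = (\<Sum>i<m. (Op ^^ (2 * i + 1)) \<eta> x)" for x
    unfolding \<psi>_def by (simp add: Op_sum bb)
  have T\<eta>: "(Op ^^ k) \<eta> x = (Op ^^ k) \<phi> x - (Op ^^ Suc k) \<phi> x" for k x
    unfolding \<eta>_def using \<phi> by (simp add: Op_iter_diff bb funpow_swap1)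
  have sum: "\<psi> x + Op \<psi> x = \<phi> x - (Op ^^ (2 * m)) \<phi> x" for x
  proof -
    have "\<psi> x + Op \<psi> x = (\<Sum>i<m. (Op ^^ (2 * i)) \<eta> x + (Op ^^ (2 * i + 1)) \<eta> x)"
      by (simp add: Op\<psi> \<psi>_def sum.distrib)
    also have "\<dots> = (\<Sum>i<m. (Op ^^ (2 * i)) \<phi> x - (Op ^^ (2 * Suc i)) \<phi> x)"
      by (intro sum.cong refl) (simp only: T\<eta>, simp)
    also have "\<dots> = \<phi> x - (Op ^^ (2 * m)) \<phi> x"
      using sum_lessThan_telescope'[of "\<lambda>i. (Op ^^ (2 * i)) \<phi> x" m] by simp
    finally show ?thesis .
  qed
  have diff: "\<psi> x - Op \<psi> x = (\<Sum>i<m. (Op ^^ (2 * i)) (\<lambda>x. \<eta> x - Op \<eta> x) x)" for x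
    by (simp add: Op\<psi> \<psi>_def sum_subtractf Op_iter_diff bb funpow_swap1)
  \<comment> \<open>The truncation error enters the energy with a favourable sign: after moving all
    powers to one side, each term is <\<eta>, P^(2k) \<eta>> with k = i + m, the squared norm of P^k
    \<eta>.\<close>
  have "0 \<le> I (\<lambda>x. (Op ^^ (2 * i)) (\<lambda>x. \<eta> x - Op \<eta> x) x * (Op ^^ (2 * m)) \<phi> x)" for i
  proof -
    let ?k = "i + m"
    have "I (\<lambda>x. (Op ^^ (2 * i)) (\<lambda>x. \<eta> x - Op \<eta> x) x * (Op ^^ (2 * m)) \<phi> x) =
        I (\<lambda>x. (\<eta> x - Op \<eta> x) * (Op ^^ (2 * ?k)) \<phi> x)"
      by (simp add: I_Op_iter_sym bb \<phi> distrib_left)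
    also have "\<dots> = I (\<lambda>x. \<eta> x * (Op ^^ (2 * ?k)) \<phi> x) - I (\<lambda>x. Op \<eta> x * (Op ^^ (2 * ?k)) \<phi> x)"
      by (simp add: left_diff_distrib bb bb_pi \<phi>)
    also have "I (\<lambda>x. Op \<eta> x * (Op ^^ (2 * ?k)) \<phi> x) = I (\<lambda>x. \<eta> x * (Op ^^ Suc (2 * ?k)) \<phi> x)"
      by (simp add: I_Op_sym bb \<phi>)
    also have "I (\<lambda>x. \<eta> x * (Op ^^ (2 * ?k)) \<phi> x) - I (\<lambda>x. \<eta> x * (Op ^^ Suc (2 * ?k)) \<phi> x) =
        I (\<lambda>x. \<eta> x * (Op ^^ (2 * ?k)) \<eta> x)"
      unfolding T\<eta> right_diff_distrib by (rule Bochner_Integration.integral_diff[symmetric]; intro bb_pi bb \<phi>)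
    also have "\<dots> = I (\<lambda>x. (Op ^^ ?k) \<eta> x * (Op ^^ ?k) \<eta> x)"
      by (simp only: I_Op_iter_sym[OF \<eta> \<eta>] mult_2)
    also have "\<dots> \<ge> 0" by simp
    finally show ?thesis by simp
  qed
  then have pos: "0 \<le> (\<Sum>i<m. I (\<lambda>x. (Op ^^ (2 * i)) (\<lambda>x. \<eta> x - Op \<eta> x) x * (Op ^^ (2 * m)) \<phi> x))"
    by (intro sum_nonneg) auto
  have "form \<psi> \<psi> = I (\<lambda>x. \<psi> x * \<psi> x - Op \<psi> x * Op \<psi> x)"
    by (simp add: form_def bb bb_pi)
  \<comment> \<open>The factor \<open>\<psi> + Op \<psi>\<close> can now be replaced by
    \<open>\<phi>\<close> minus the truncation error.\<close>
  also have "\<dots> = I (\<lambda>x. (\<psi> x - Op \<psi> x) * (\<psi> x + Op \<psi> x))"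
    by (intro Bochner_Integration.integral_cong) (auto simp: algebra_simps)
  also have "\<dots> = I (\<lambda>x. \<phi> x * (\<psi> x - Op \<psi> x) -
      (\<Sum>i<m. (Op ^^ (2 * i)) (\<lambda>x. \<eta> x - Op \<eta> x) x * (Op ^^ (2 * m)) \<phi> x))"
    unfolding sum_distrib_right[symmetric] diff[symmetric] sum
    by (intro Bochner_Integration.integral_cong) (auto simp: algebra_simps)
  also have "\<dots> = I (\<lambda>x. \<phi> x * (\<psi> x - Op \<psi> x)) -
      (\<Sum>i<m. I (\<lambda>x. (Op ^^ (2 * i)) (\<lambda>x. \<eta> x - Op \<eta> x) x * (Op ^^ (2 * m)) \<phi> x))"
    by (subst Bochner_Integration.integral_diff, (intro bb_pi bb \<phi>)+,
        subst Bochner_Integration.integral_sum, (intro bb_pi bb \<phi>)+) simp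
  also have "\<dots> \<le> I (\<lambda>x. \<phi> x * (\<psi> x - Op \<psi> x))" using pos by simp
  finally show thesis using that[OF \<psi> sum] by blast
qed

section \<open>Decoupling of functions of small energy\<close>

text \<open>Replacing \<open>\<eta>\<close> by \<open>Op (Op \<eta>)\<close> moves
  \<open>1 - P^2\<close> onto \<open>u\<close> and costs at most \<open>c\<close> times the norm of
  \<open>u - Op (Op u)\<close>, which the square root of the energy bounds. After \<open>m\<close>
  such replacements \<open>\<eta>\<close> has been mixed by \<open>2 m\<close> steps of the
  chain.\<close>

lemma I_mult_le_form:
  assumes \<eta>: "bounded_borel \<eta>" "\<And>x. \<bar>\<eta> x\<bar> \<le> c" and u: "bounded_borel u" "\<And>x. \<bar>u x\<bar> \<le> 1"
  shows "\<bar>I (\<lambda>x. \<eta> x * u x)\<bar> \<le> I (\<lambda>x. \<bar>(Op ^^ (2 * m)) \<eta> x\<bar>) + real m * c * sqrt (form u u)"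
proof -
  note [bb] = \<eta>(1) u(1)
  have c0: "0 \<le> c" using \<eta>(2) abs_ge_zero order_trans by blast
  have c: "\<bar>(Op ^^ n) \<eta> x\<bar> \<le> c" for n x
    using \<eta> by (intro Op_iter_bound) (auto dest: bounded_borel_measurable)
  have step: "\<bar>I (\<lambda>x. (Op ^^ n) \<eta> x * u x) - I (\<lambda>x. (Op ^^ (n + 2)) \<eta> x * u x)\<bar> \<le> c * sqrt (form u u)" for n
  proof -
    have "I (\<lambda>x. (Op ^^ (n + 2)) \<eta> x * u x) = I (\<lambda>x. (Op ^^ n) \<eta> x * Op (Op u) x)"
      using I_Op_iter_sym[of "(Op ^^ n) \<eta>" u 2 0] by (simp add: bb numeral_2_eq_2)
    then have "I (\<lambda>x. (Op ^^ n) \<eta> x * u x) - I (\<lambda>x. (Op ^^ (n + 2)) \<eta> x * u x) =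
        I (\<lambda>x. (Op ^^ n) \<eta> x * (u x - Op (Op u) x))"
      by (simp add: right_diff_distrib bb bb_pi)
    also have "\<bar>\<dots>\<bar> \<le> I (\<lambda>x. \<bar>(Op ^^ n) \<eta> x * (u x - Op (Op u) x)\<bar>)"
      by (rule integral_abs_bound)
    also have "\<dots> \<le> I (\<lambda>x. c * \<bar>u x - Op (Op u) x\<bar>)"
      by (intro integral_mono bb_pi bb) (simp add: abs_mult mult_right_mono c)
    also have "\<dots> = c * I (\<lambda>x. \<bar>u x - Op (Op u) x\<bar>)" by simp
    also have "I (\<lambda>x. \<bar>u x - Op (Op u) x\<bar>) \<le> sqrt (form u u)"
    proof (rule real_le_rsqrt)
      have "(I (\<lambda>x. \<bar>u x - Op (Op u) x\<bar>))\<^sup>2 \<le> I (\<lambda>x. (u x - Op (Op u) x)\<^sup>2)"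
        by (intro I_abs_square_le bb)
      also have "\<dots> \<le> form u u" by (intro I_diff_Op_Op_square_le bb)
      finally show "(I (\<lambda>x. \<bar>u x - Op (Op u) x\<bar>))\<^sup>2 \<le> form u u" .
    qed
    finally show ?thesis using c0 by (simp add: mult_left_mono)
  qed
  have "\<bar>I (\<lambda>x. \<eta> x * u x) - I (\<lambda>x. (Op ^^ (2 * m)) \<eta> x * u x)\<bar> \<le> real m * (c * sqrt (form u u))"
  proof (induction m)
    case (Suc m)
    then show ?case using step[of "2 * m"] by (simp add: algebra_simps)
  qed simp
  moreover have "\<bar>I (\<lambda>x. (Op ^^ (2 * m)) \<eta> x * u x)\<bar> \<le> I (\<lambda>x. \<bar>(Op ^^ (2 * m)) \<eta> x\<bar>)"
  proof -
    have "\<bar>I (\<lambda>x. (Op ^^ (2 * m)) \<eta> x * u x)\<bar> \<le> I (\<lambda>x. \<bar>(Op ^^ (2 * m)) \<eta> x * u x\<bar>)"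
      by (rule integral_abs_bound)
    also have "\<dots> \<le> I (\<lambda>x. \<bar>(Op ^^ (2 * m)) \<eta> x\<bar>)"
      by (intro integral_mono bb_pi bb) (simp add: abs_mult mult_left_le u(2))
    finally show ?thesis .
  qed
  ultimately show ?thesis by (simp add: mult.assoc)
qed

text \<open>A sequence of bounded functions of small total energy is, on average, weakly close to
  constants.\<close>

lemma average_decoupling:
  assumes irr: "phi_irreducible P" and aper: "aperiodic P \<pi>"
    and \<xi>: "integrable \<pi> \<xi>" and e: "0 < e"
  obtains K0 where "\<And>K a. K \<ge> K0 \<Longrightarrow> (\<And>k. bounded_borel (a k)) \<Longrightarrow> (\<And>k x. \<bar>a k x\<bar> \<le> 1) \<Longrightarrow>
    (\<Sum>k<K. form (a k) (a k)) \<le> 1 \<Longrightarrow>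
    \<bar>\<Sum>k<K. I (\<lambda>x. \<xi> x * Op (a k) x) - I \<xi> * I (a k)\<bar> \<le> e * real K"
proof -
  have "0 < e / 4" using e by simp
  from integrable_approx_bounded[OF \<xi> this] obtain \<xi>' where \<xi>' [bb]: "bounded_borel \<xi>'"
    and \<xi>\<xi>': "I (\<lambda>x. \<bar>\<xi> x - \<xi>' x\<bar>) < e / 4" .
  \<comment> \<open>Since <\<xi>', P a> = <P \<xi>', a>, the bounded part of the decoupling error is
    the pairing of this centred function with \<open>a\<close>.\<close>
  define \<eta> where "\<eta> x = Op \<xi>' x - I \<xi>'" for x
  have \<eta> [bb]: "bounded_borel \<eta>" unfolding \<eta>_def by (intro bb)
  have I\<eta>: "I \<eta> = 0" unfolding \<eta>_def using pi.prob_space by (simp add: bb bb_pi I_Op)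
  obtain c where c: "c > 0" "\<And>x. \<bar>\<eta> x\<bar> \<le> c" using \<eta> by (metis bounded_borelE)
  have "eventually (\<lambda>n. I (\<lambda>x. \<bar>(Op ^^ n) \<eta> x\<bar>) < e / 4) sequentially"
    using \<open>0 < e / 4\<close> by (rule order_tendstoD(2)[OF Op_iter_L1_tendsto_0[OF irr aper \<eta> I\<eta>]])
  then obtain m where m: "\<And>n. n \<ge> m \<Longrightarrow> I (\<lambda>x. \<bar>(Op ^^ n) \<eta> x\<bar>) < e / 4"
    by (auto simp: eventually_sequentially)
  have m2: "I (\<lambda>x. \<bar>(Op ^^ (2 * m)) \<eta> x\<bar>) < e / 4" by (rule m) simp
  \<comment> \<open>As the energies sum to at most 1, Cauchy-Schwarz bounds the total of the terms
    \<open>m c sqrt (form (a k) (a k))\<close> by \<open>m c sqrt K\<close>, which is at most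
    \<open>(e / 4) K\<close> from \<open>K0\<close> on.\<close>
  define K0 where "K0 = nat \<lceil>(4 * (real m * c) / e)\<^sup>2\<rceil>"
  show thesis
  proof (rule that[of K0])
    fix K and a :: "nat \<Rightarrow> 'a \<Rightarrow> real"
    assume K: "K \<ge> K0" and a [bb]: "\<And>k. bounded_borel (a k)" and a1: "\<And>k x. \<bar>a k x\<bar> \<le> 1"
      and sum: "(\<Sum>k<K. form (a k) (a k)) \<le> 1"
    have Op1: "\<bar>Op (a k) x\<bar> \<le> 1" for k x
      using a a1 by (intro Op_bound) (auto dest: bounded_borel_measurable)
    \<comment> \<open>The three quarters are: the approximation error tested against
      \<open>Op (a k)\<close>, its mean times \<open>I (a k)\<close>, and what is left of
      \<open>\<eta>\<close> after mixing.\<close>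
    have each: "\<bar>I (\<lambda>x. \<xi> x * Op (a k) x) - I \<xi> * I (a k)\<bar> \<le> 3 * e / 4 + real m * c * sqrt (form (a k) (a k))" for k
    proof -
      have int: "integrable \<pi> (\<lambda>x. \<xi> x * Op (a k) x)" by (intro pi_mult_bb \<xi> bb)
      have "I (\<lambda>x. \<eta> x * a k x) = I (\<lambda>x. Op \<xi>' x * a k x) - I \<xi>' * I (a k)"
        unfolding \<eta>_def by (simp add: left_diff_distrib bb bb_pi)
      also have "I (\<lambda>x. Op \<xi>' x * a k x) = I (\<lambda>x. \<xi>' x * Op (a k) x)"
        by (simp add: I_Op_sym bb)
      finally have "I (\<lambda>x. \<xi> x * Op (a k) x) - I \<xi> * I (a k) =
          I (\<lambda>x. (\<xi> x - \<xi>' x) * Op (a k) x) + I (\<lambda>x. \<eta> x * a k x) - I (\<lambda>x. \<xi> x - \<xi>' x) * I (a k)"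
        using \<xi> int by (simp add: left_diff_distrib bb bb_pi)
      moreover have "\<bar>I (\<lambda>x. (\<xi> x - \<xi>' x) * Op (a k) x)\<bar> \<le> e / 4"
      proof -
        have "\<bar>I (\<lambda>x. (\<xi> x - \<xi>' x) * Op (a k) x)\<bar> \<le> I (\<lambda>x. \<bar>(\<xi> x - \<xi>' x) * Op (a k) x\<bar>)"
          by (rule integral_abs_bound)
        also have "\<dots> \<le> I (\<lambda>x. \<bar>\<xi> x - \<xi>' x\<bar>)"
          using \<xi> by (intro integral_mono integrable_abs pi_mult_bb Bochner_Integration.integrable_diff bb bb_pi[OF \<xi>'])
            (simp_all add: abs_mult mult_left_le Op1)
        finally show ?thesis using \<xi>\<xi>' by simp
      qed
      moreover have "\<bar>I (\<lambda>x. \<xi> x - \<xi>' x) * I (a k)\<bar> \<le> e / 4"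
      proof -
        have "\<bar>I (a k)\<bar> \<le> I (\<lambda>x. \<bar>a k x\<bar>)" by (rule integral_abs_bound)
        also have "\<dots> \<le> I (\<lambda>x. 1)" by (intro integral_mono bb_pi bb a1)
        finally have "\<bar>I (a k)\<bar> \<le> 1" using pi.prob_space by simp
        moreover have "\<bar>I (\<lambda>x. \<xi> x - \<xi>' x)\<bar> \<le> e / 4"
          using integral_abs_bound[of \<pi> "\<lambda>x. \<xi> x - \<xi>' x"] \<xi>\<xi>' by linarith
        ultimately show ?thesis
          using \<xi>\<xi>' mult_mono[of "\<bar>I (\<lambda>x. \<xi> x - \<xi>' x)\<bar>" "e / 4" "\<bar>I (a k)\<bar>" 1] e by (simp add: abs_mult)
      qed
      moreover have "\<bar>I (\<lambda>x. \<eta> x * a k x)\<bar> \<le> e / 4 + real m * c * sqrt (form (a k) (a k))"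
        using I_mult_le_form[OF \<eta> c(2) a a1, of k m] m2 by simp
      ultimately show ?thesis by linarith
    qed
    have "(\<Sum>k<K. sqrt (form (a k) (a k))) \<le> sqrt (real K) * sqrt (\<Sum>k<K. form (a k) (a k))"
      by (intro sum_sqrt_le form_nonneg bb)
    also have "\<dots> \<le> sqrt (real K) * 1" using sum by (intro mult_left_mono) auto
    finally have "real m * c * (\<Sum>k<K. sqrt (form (a k) (a k))) \<le> real m * c * sqrt (real K)"
      using c(1) by (intro mult_left_mono) auto
    also have "\<dots> \<le> (e / 4) * real K"
    proof -
      have "(4 * (real m * c) / e)\<^sup>2 \<le> real K" using K unfolding K0_def by linarith
      then have "4 * (real m * c) / e \<le> sqrt (real K)" by (rule real_le_rsqrt)
      then have "real m * c \<le> (e / 4) * sqrt (real K)" using e by (simp add: field_simps)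
      then have "real m * c * sqrt (real K) \<le> (e / 4) * sqrt (real K) * sqrt (real K)"
        by (intro mult_right_mono) auto
      then show ?thesis by (simp add: mult.assoc)
    qed
    finally have sqrt_sum: "real m * c * (\<Sum>k<K. sqrt (form (a k) (a k))) \<le> (e / 4) * real K" .
    have "\<bar>\<Sum>k<K. I (\<lambda>x. \<xi> x * Op (a k) x) - I \<xi> * I (a k)\<bar> \<le>
      (\<Sum>k<K. 3 * e / 4 + real m * c * sqrt (form (a k) (a k)))"
      by (rule order_trans[OF sum_abs sum_mono]) (rule each)
    also have "\<dots> = real K * (3 * e / 4) + real m * c * (\<Sum>k<K. sqrt (form (a k) (a k)))"
      by (simp add: sum.distrib sum_distrib_left)
    also have "\<dots> \<le> real K * (3 * e / 4) + (e / 4) * real K" using sqrt_sum by (rule add_left_mono)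
    also have "\<dots> = e * real K" by (simp add: field_simps)
    finally show "\<bar>\<Sum>k<K. I (\<lambda>x. \<xi> x * Op (a k) x) - I \<xi> * I (a k)\<bar> \<le> e * real K" .
  qed
qed

text \<open>Real and imaginary part of \<open>x \<mapsto> E\<^sub>x exp (i (\<theta>(X\<^sub>0) + \<dots> + \<theta>(X\<^sub>k\<^sub>-\<^sub>1)))\<close>.\<close>

primrec char_iter :: "('a \<Rightarrow> real) \<Rightarrow> nat \<Rightarrow> ('a \<Rightarrow> real) \<times> ('a \<Rightarrow> real)" where
  "char_iter \<theta> 0 = ((\<lambda>_. 1), (\<lambda>_. 0))"
| "char_iter \<theta> (Suc k) =
    ((\<lambda>x. cos (\<theta> x) * Op (fst (char_iter \<theta> k)) x - sin (\<theta> x) * Op (snd (char_iter \<theta> k)) x),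
     (\<lambda>x. sin (\<theta> x) * Op (fst (char_iter \<theta> k)) x + cos (\<theta> x) * Op (snd (char_iter \<theta> k)) x))"

lemma bounded_borel_char_iter:
  assumes "\<theta> \<in> borel_measurable borel"
  shows "bounded_borel (fst (char_iter \<theta> k))" "bounded_borel (snd (char_iter \<theta> k))"
  by (induction k) (auto intro!: bb assms)

text \<open>Multiplication by exp(i \<theta>) is a rotation, so only the application of
  \<open>Op\<close> changes the modulus; this identifies the loss of squared norm with the
  energy.\<close>

lemma char_iter_square_sum:
  "(fst (char_iter \<theta> (Suc k)) x)\<^sup>2 + (snd (char_iter \<theta> (Suc k)) x)\<^sup>2 =
   (Op (fst (char_iter \<theta> k)) x)\<^sup>2 + (Op (snd (char_iter \<theta> k)) x)\<^sup>2"
proof -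
  have *: "(c * p - s * q)\<^sup>2 + (s * p + c * q)\<^sup>2 = (s\<^sup>2 + c\<^sup>2) * (p\<^sup>2 + q\<^sup>2)" for c s p q :: real
    by (simp add: power2_eq_square algebra_simps)
  show ?thesis by (simp add: *)
qed

lemma char_iter_le_1:
  assumes \<theta>: "\<theta> \<in> borel_measurable borel"
  shows "(fst (char_iter \<theta> k) x)\<^sup>2 + (snd (char_iter \<theta> k) x)\<^sup>2 \<le> 1"
proof (induction k arbitrary: x)
  case (Suc k)
  note [bb] = bounded_borel_char_iter[OF \<theta>]
  have "(Op (fst (char_iter \<theta> k)) x)\<^sup>2 + (Op (snd (char_iter \<theta> k)) x)\<^sup>2 \<le>
      Op (\<lambda>y. (fst (char_iter \<theta> k) y)\<^sup>2) x + Op (\<lambda>y. (snd (char_iter \<theta> k) y)\<^sup>2) x"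
    by (intro add_mono Op_square_le bb)
  also have "\<dots> = Op (\<lambda>y. (fst (char_iter \<theta> k) y)\<^sup>2 + (snd (char_iter \<theta> k) y)\<^sup>2) x"
    by (simp add: Op_add bb)
  also have "\<dots> \<le> \<bar>Op (\<lambda>y. (fst (char_iter \<theta> k) y)\<^sup>2 + (snd (char_iter \<theta> k) y)\<^sup>2) x\<bar>" by simp
  also have "\<dots> \<le> 1" using Suc by (intro Op_bound bounded_borel_measurable bb) auto
  finally show ?case unfolding char_iter_square_sum .
qed simp

lemma abs_char_iter_le_1:
  assumes "\<theta> \<in> borel_measurable borel"
  shows "\<bar>fst (char_iter \<theta> k) x\<bar> \<le> 1" "\<bar>snd (char_iter \<theta> k) x\<bar> \<le> 1"
proof -
  have "(fst (char_iter \<theta> k) x)\<^sup>2 \<le> 1" "(snd (char_iter \<theta> k) x)\<^sup>2 \<le> 1"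
    using char_iter_le_1[OF assms, of k x] zero_le_power2[of "fst (char_iter \<theta> k) x"]
      zero_le_power2[of "snd (char_iter \<theta> k) x"] by linarith+
  then show "\<bar>fst (char_iter \<theta> k) x\<bar> \<le> 1" "\<bar>snd (char_iter \<theta> k) x\<bar> \<le> 1"
    by (simp_all add: abs_square_le_1)
qed

lemma sum_form_char_iter_le_1:
  assumes \<theta>: "\<theta> \<in> borel_measurable borel"
  shows "(\<Sum>k<K. form (fst (char_iter \<theta> k)) (fst (char_iter \<theta> k))) \<le> 1"
    "(\<Sum>k<K. form (snd (char_iter \<theta> k)) (snd (char_iter \<theta> k))) \<le> 1"
proof -
  note [bb] = bounded_borel_char_iter[OF \<theta>]
  let ?a = "\<lambda>k. fst (char_iter \<theta> k)" and ?b = "\<lambda>k. snd (char_iter \<theta> k)"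
  define n where "n k = I (\<lambda>x. (?a k x)\<^sup>2 + (?b k x)\<^sup>2)" for k
  have n: "form (?a k) (?a k) + form (?b k) (?b k) = n k - n (Suc k)" for k
    unfolding n_def char_iter_square_sum by (simp add: bb bb_pi form_def power2_eq_square)
  have "(\<Sum>k<K. form (?a k) (?a k)) + (\<Sum>k<K. form (?b k) (?b k)) = n 0 - n K"
    unfolding sum.distrib[symmetric] n by (rule sum_lessThan_telescope')
  moreover have "n 0 = 1" using pi.prob_space by (simp add: n_def)
  moreover have "0 \<le> n K" unfolding n_def by simp
  moreover have "0 \<le> (\<Sum>k<K. form (?a k) (?a k))" "0 \<le> (\<Sum>k<K. form (?b k) (?b k))"
    by (intro sum_nonneg form_nonneg bb)+
  ultimately show "(\<Sum>k<K. form (?a k) (?a k)) \<le> 1" "(\<Sum>k<K. form (?b k) (?b k)) \<le> 1" by linarith+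
qed

end

subsection \<open>Reversible chains\<close>

locale reversible_chain = reversible_kernel +
  fixes M :: "'w measure" and X :: "nat \<Rightarrow> 'w \<Rightarrow> 'a"
  assumes chain: "stationary_markov_chain M P \<pi> X"
begin

abbreviation "E \<equiv> integral\<^sup>L M"
abbreviation "\<F> \<equiv> natural_filtration M X"

lemma prob_M: "prob_space M"
  using chain by (simp add: stationary_markov_chain_def)

sublocale M: prob_space M by (rule prob_M)

lemma X_measurable [measurable]: "X n \<in> M \<rightarrow>\<^sub>M borel"
  using chain by (simp add: stationary_markov_chain_def)

section \<open>Bounded adapted variables and the Markov property\<close>

lemma space_filtration [simp]: "space (\<F> n) = space M"
  unfolding natural_filtration_def by (rule space_measure_of) auto

lemma sets_filtration:
  "sets (\<F> n) = sigma_sets (space M) {X k -` A \<inter> space M | k A. k \<le> n \<and> A \<in> sets borel}"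
  unfolding natural_filtration_def by (rule sets_measure_of) auto

lemma subalgebra_filtration: "subalgebra M (\<F> n)"
  unfolding subalgebra_def sets_filtration
  by (auto intro!: sets.sigma_sets_subset measurable_sets[OF X_measurable])

lemma filtration_mono: "m \<le> n \<Longrightarrow> sets (\<F> m) \<subseteq> sets (\<F> n)"
  unfolding sets_filtration by (intro sigma_sets_mono') force

lemma X_measurable_filtration: "i \<le> n \<Longrightarrow> X i \<in> \<F> n \<rightarrow>\<^sub>M borel"
  by (rule measurableI) (auto simp: sets_filtration intro!: sigma_sets.Basic)

lemma integrable_bounded_M:
  fixes Y :: "'w \<Rightarrow> 'b::{banach, second_countable_topology}"
  assumes "Y \<in> borel_measurable M" "\<And>w. norm (Y w) \<le> c"
  shows "integrable M Y"
  by (rule M.integrable_const_bound[of _ c]) (use assms in auto)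

text \<open>Boundedness is part of the notion, so that adapted variables are integrable and closed
  under products.\<close>

definition adapted :: "nat \<Rightarrow> ('w \<Rightarrow> real) \<Rightarrow> bool" where
  "adapted n Y \<longleftrightarrow> Y \<in> borel_measurable (\<F> n) \<and> (\<exists>c. \<forall>w. \<bar>Y w\<bar> \<le> c)"

lemma adapted_measurable: "adapted n Y \<Longrightarrow> Y \<in> borel_measurable M"
  unfolding adapted_def using measurable_from_subalg[OF subalgebra_filtration] by blast

lemma adapted_integrable:
  assumes "adapted n Y" shows "integrable M Y"
proof -
  obtain c where "\<And>w. \<bar>Y w\<bar> \<le> c" using assms by (auto simp: adapted_def)
  then show ?thesis by (intro integrable_bounded_M[of _ c] adapted_measurable[OF assms]) simp
qed

lemma adapted_mono: "adapted m Y \<Longrightarrow> m \<le> n \<Longrightarrow> adapted n Y"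
  unfolding adapted_def
  using measurable_mono[of borel borel "\<F> m" "\<F> n"] filtration_mono[of m n] by fastforce

lemma adapted_X: "bounded_borel f \<Longrightarrow> i \<le> n \<Longrightarrow> adapted n (\<lambda>w. f (X i w))"
  unfolding adapted_def bounded_borel_def
  using measurable_compose[OF X_measurable_filtration] by blast

lemma adapted_const: "adapted n (\<lambda>_. c)"
  unfolding adapted_def by auto

lemma adapted_add:
  assumes "adapted n Y" "adapted n Z" shows "adapted n (\<lambda>w. Y w + Z w)"
proof -
  obtain c d where "\<And>x. \<bar>Y x\<bar> \<le> c" "\<And>x. \<bar>Z x\<bar> \<le> d" using assms by (auto simp: adapted_def)
  then have "\<bar>Y x + Z x\<bar> \<le> c + d" for x by (meson abs_triangle_ineq add_mono order_trans)
  then show ?thesis using assms by (auto simp: adapted_def)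
qed

lemma adapted_mult:
  assumes "adapted n Y" "adapted n Z" shows "adapted n (\<lambda>w. Y w * Z w)"
proof -
  obtain c d where "\<And>x. \<bar>Y x\<bar> \<le> c" "\<And>x. \<bar>Z x\<bar> \<le> d" using assms by (auto simp: adapted_def)
  then have "\<bar>Y x * Z x\<bar> \<le> c * d" for x unfolding abs_mult by (smt (verit) abs_ge_zero mult_mono)
  then show ?thesis using assms by (auto simp: adapted_def)
qed

lemma adapted_diff:
  assumes "adapted n Y" "adapted n Z" shows "adapted n (\<lambda>w. Y w - Z w)"
  using adapted_add[OF assms(1) adapted_mult[OF adapted_const[of _ "-1"] assms(2)]] by simp

lemma Markov_indicator:
  assumes \<Phi>: "adapted n \<Phi>" and A: "A \<in> sets borel"
  shows "E (\<lambda>w. \<Phi> w * indicator A (X (Suc n) w)) = E (\<lambda>w. \<Phi> w * measure (P (X n w)) A)"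
proof -
  interpret F: finite_measure_subalgebra M "\<F> n"
    by unfold_locales (rule subalgebra_filtration)
  have [measurable]: "A \<in> sets borel" "\<Phi> \<in> borel_measurable M" "\<Phi> \<in> borel_measurable (\<F> n)"
    using adapted_measurable[OF \<Phi>] \<Phi> A by (simp_all add: adapted_def)
  have [measurable]: "(\<lambda>x. measure (P x) A) \<in> borel_measurable borel"
    by (rule measure_measurable_subprob_algebra2[where N=borel]) auto
  have "adapted (Suc n) (\<lambda>w. \<Phi> w * indicator A (X (Suc n) w))"
    by (intro adapted_mult adapted_mono[OF \<Phi>] adapted_X bb A) auto
  then have "integrable M (\<lambda>w. \<Phi> w * indicator A (X (Suc n) w))" by (rule adapted_integrable)
  then have "E (\<lambda>w. \<Phi> w * indicator A (X (Suc n) w)) =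
      E (\<lambda>w. \<Phi> w * real_cond_exp M (\<F> n) (\<lambda>w. indicator A (X (Suc n) w)) w)"
    by (intro F.real_cond_exp_intg(2)[symmetric]) measurable
  also have "\<dots> = E (\<lambda>w. \<Phi> w * measure (P (X n w)) A)"
  proof (intro integral_cong_AE)
    have "AE w in M. real_cond_exp M (\<F> n) (\<lambda>w. indicator A (X (Suc n) w)) w = measure (P (X n w)) A"
      using chain A by (simp add: stationary_markov_chain_def)
    then show "AE w in M. \<Phi> w * real_cond_exp M (\<F> n) (\<lambda>w. indicator A (X (Suc n) w)) w =
        \<Phi> w * measure (P (X n w)) A"
      by eventually_elim simp
  qed measurable
  finally show ?thesis .
qed

text \<open>A nonnegative \<open>\<Phi>\<close> serves as a density on the path space.
  \<open>Markov_indicator\<close> says that under the weighted measure the law of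
  \<open>X (Suc n)\<close> is the law of \<open>X n\<close> followed by \<open>P\<close>, and
  integration of \<open>f\<close> against this identity of measures gives the claim.\<close>

lemma Markov_nonneg:
  assumes \<Phi>: "adapted n \<Phi>" "\<And>w. 0 \<le> \<Phi> w" and f: "bounded_borel f" "\<And>x. 0 \<le> f x"
  shows "E (\<lambda>w. \<Phi> w * f (X (Suc n) w)) = E (\<lambda>w. \<Phi> w * Op f (X n w))"
proof -
  have [measurable]: "\<Phi> \<in> borel_measurable M" using \<Phi> by (simp add: adapted_measurable)
  have [measurable]: "f \<in> borel_measurable borel" using f by (simp add: bounded_borel_measurable)
  define D where "D = density M (\<lambda>w. ennreal (\<Phi> w))"
  have [measurable_cong, simp]: "sets D = sets M" "space D = space M" by (simp_all add: D_def)
  have XD [measurable]: "X k \<in> D \<rightarrow>\<^sub>M borel" for k by (simp add: measurable_cong_sets[OF \<open>sets D = sets M\<close> refl])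
  have nn: "(\<integral>\<^sup>+x. g x \<partial>distr D borel (X k)) = (\<integral>\<^sup>+w. ennreal (\<Phi> w) * g (X k w) \<partial>M)"
    if [measurable]: "g \<in> borel_measurable borel" for g k
    by (subst nn_integral_distr, measurable, unfold D_def, subst nn_integral_density) auto
  have eq: "distr D borel (X (Suc n)) = distr D borel (X n) \<bind> P"
  proof (rule measure_eqI)
    show sets_eq: "sets (distr D borel (X (Suc n))) = sets (distr D borel (X n) \<bind> P)"
      by (subst sets_bind[where N=borel]) auto
    fix A assume "A \<in> sets (distr D borel (X (Suc n)))"
    then have A [measurable]: "A \<in> sets borel" by simp
    have [measurable]: "(\<lambda>x. measure (P x) A) \<in> borel_measurable borel"
      by (rule measure_measurable_subprob_algebra2[where N=borel]) auto
    have 1: "adapted (Suc n) (\<lambda>w. \<Phi> w * indicator A (X (Suc n) w))"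
      by (intro adapted_mult adapted_mono[OF \<Phi>(1)] adapted_X bb A) auto
    have "bounded_borel (\<lambda>x. measure (P x) A)"
      by (rule bounded_borelI[of _ 1]) (auto simp: prob_space.prob_le_1[OF prob_kernel])
    then have 2: "adapted n (\<lambda>w. \<Phi> w * measure (P (X n w)) A)"
      by (intro adapted_mult \<Phi>(1) adapted_X) auto
    have "emeasure (distr D borel (X (Suc n))) A = (\<integral>\<^sup>+x. indicator A x \<partial>distr D borel (X (Suc n)))"
      by simp
    also have "\<dots> = (\<integral>\<^sup>+w. ennreal (\<Phi> w * indicator A (X (Suc n) w)) \<partial>M)"
      using \<Phi>(2) by (subst nn) (auto intro!: nn_integral_cong simp: ennreal_mult split: split_indicator)
    also have "\<dots> = ennreal (E (\<lambda>w. \<Phi> w * indicator A (X (Suc n) w)))"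
      using \<Phi>(2) by (intro nn_integral_eq_integral adapted_integrable[OF 1]) auto
    also have "\<dots> = ennreal (E (\<lambda>w. \<Phi> w * measure (P (X n w)) A))"
      by (simp add: Markov_indicator[OF \<Phi>(1) A])
    also have "\<dots> = (\<integral>\<^sup>+w. ennreal (\<Phi> w * measure (P (X n w)) A) \<partial>M)"
      using \<Phi>(2) by (intro nn_integral_eq_integral[symmetric] adapted_integrable[OF 2]) auto
    also have "\<dots> = (\<integral>\<^sup>+w. ennreal (\<Phi> w) * emeasure (P (X n w)) A \<partial>M)"
      using \<Phi>(2) finite_measure.emeasure_eq_measure[OF prob_space.finite_measure[OF prob_kernel]]
      by (intro nn_integral_cong) (simp add: ennreal_mult)
    also have "\<dots> = (\<integral>\<^sup>+x. emeasure (P x) A \<partial>distr D borel (X n))"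
      by (subst nn) (auto intro: emeasure_measurable_subprob_algebra2[where N=borel])
    also have "\<dots> = emeasure (distr D borel (X n) \<bind> P) A"
      by (rule emeasure_bind[symmetric, where N=borel]) auto
    finally show "emeasure (distr D borel (X (Suc n))) A = emeasure (distr D borel (X n) \<bind> P) A" .
  qed
  have Of: "0 \<le> Op f x" for x unfolding kernel_op_def using f(2) by simp
  have 1: "adapted (Suc n) (\<lambda>w. \<Phi> w * f (X (Suc n) w))"
    by (intro adapted_mult adapted_mono[OF \<Phi>(1)] adapted_X f) auto
  have 2: "adapted n (\<lambda>w. \<Phi> w * Op f (X n w))"
    by (intro adapted_mult \<Phi>(1) adapted_X bb f) auto
  have "ennreal (E (\<lambda>w. \<Phi> w * f (X (Suc n) w))) = (\<integral>\<^sup>+w. ennreal (\<Phi> w * f (X (Suc n) w)) \<partial>M)"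
    using \<Phi>(2) f(2) by (intro nn_integral_eq_integral[symmetric] adapted_integrable[OF 1]) auto
  also have "\<dots> = (\<integral>\<^sup>+x. ennreal (f x) \<partial>distr D borel (X (Suc n)))"
    using \<Phi>(2) f(2) by (subst nn) (auto intro!: nn_integral_cong simp: ennreal_mult)
  also have "\<dots> = (\<integral>\<^sup>+x. \<integral>\<^sup>+y. ennreal (f y) \<partial>P x \<partial>distr D borel (X n))"
    unfolding eq by (rule nn_integral_bind[where B=borel]) auto
  also have "\<dots> = (\<integral>\<^sup>+x. ennreal (Op f x) \<partial>distr D borel (X n))"
    using f(2) by (intro nn_integral_cong) (simp add: nn_integral_eq_integral bb_kernel f(1) kernel_op_def)
  also have "\<dots> = (\<integral>\<^sup>+w. ennreal (\<Phi> w * Op f (X n w)) \<partial>M)"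
    using \<Phi>(2) Of by (subst nn) (auto intro!: nn_integral_cong simp: ennreal_mult)
  also have "\<dots> = ennreal (E (\<lambda>w. \<Phi> w * Op f (X n w)))"
    using \<Phi>(2) Of by (intro nn_integral_eq_integral adapted_integrable[OF 2]) auto
  finally show ?thesis using \<Phi>(2) f(2) Of by (simp add: integral_nonneg_AE)
qed

lemma Markov:
  assumes \<Phi>: "adapted n \<Phi>" and f: "bounded_borel f"
  shows "E (\<lambda>w. \<Phi> w * f (X (Suc n) w)) = E (\<lambda>w. \<Phi> w * Op f (X n w))"
proof -
  obtain d where d: "\<And>x. \<bar>f x\<bar> \<le> d" using f by (metis bounded_borelE)
  obtain c where c: "\<And>w. \<bar>\<Phi> w\<bar> \<le> c" using \<Phi> by (auto simp: adapted_def)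
  have fd: "0 \<le> f x + d" for x using d[of x] by linarith
  have \<Phi>c: "0 \<le> \<Phi> w + c" for w using c[of w] by linarith
  have fX: "adapted (Suc n) (\<lambda>w. f (X (Suc n) w))" by (intro adapted_X f) auto
  have OfX: "adapted n (\<lambda>w. Op f (X n w))" by (intro adapted_X bb f) auto
  have *: "E (\<lambda>w. \<Psi> w * f (X (Suc n) w)) = E (\<lambda>w. \<Psi> w * Op f (X n w))"
    if \<Psi>: "adapted n \<Psi>" and \<Psi>0: "\<And>w. 0 \<le> \<Psi> w" for \<Psi>
  proof -
    have "E (\<lambda>w. \<Psi> w * (f (X (Suc n) w) + d)) = E (\<lambda>w. \<Psi> w * Op (\<lambda>x. f x + d) (X n w))"
      by (rule Markov_nonneg[OF \<Psi> \<Psi>0, of "\<lambda>x. f x + d"]) (intro bb f fd)+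
    then show ?thesis
      using adapted_integrable[OF adapted_mult[OF adapted_mono[OF \<Psi>, of "Suc n"] fX]]
        adapted_integrable[OF adapted_mult[OF \<Psi> OfX]] adapted_integrable[OF \<Psi>] f
      by (simp add: Op_add Op_const bb distrib_left)
  qed
  have "E (\<lambda>w. (\<Phi> w + c) * f (X (Suc n) w)) = E (\<lambda>w. (\<Phi> w + c) * Op f (X n w))"
    by (rule *) (intro adapted_add adapted_const \<Phi> \<Phi>c)+
  moreover have "E (\<lambda>w. f (X (Suc n) w)) = E (\<lambda>w. Op f (X n w))"
    using *[OF adapted_const[of n 1]] by simp
  ultimately show ?thesis
    using adapted_integrable[OF adapted_mult[OF adapted_mono[OF \<Phi>, of "Suc n"] fX]]
        adapted_integrable[OF adapted_mult[OF \<Phi> OfX]] adapted_integrable[OF fX] adapted_integrable[OF OfX]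
    by (simp add: distrib_right)
qed

lemma distr_X: "distr M borel (X n) = \<pi>"
proof -
  have E: "E (\<lambda>w. f (X n w)) = I f" if "bounded_borel f" for f
    using that
  proof (induction n arbitrary: f)
    case 0
    have "I f = integral\<^sup>L (distr M borel (X 0)) f"
      using chain by (simp add: stationary_markov_chain_def)
    also have "\<dots> = E (\<lambda>w. f (X 0 w))"
      by (rule integral_distr) (use 0 in \<open>auto dest: bounded_borel_measurable\<close>)
    finally show ?case by simp
  next
    case (Suc n)
    have "E (\<lambda>w. f (X (Suc n) w)) = E (\<lambda>w. Op f (X n w))"
      using Markov[OF adapted_const[of n 1] Suc.prems] by simp
    also have "\<dots> = I f" using Suc by (simp add: bb I_Op)
    finally show ?case .
  qed
  show ?thesis
  proof (rule measure_eqI)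
    fix A assume "A \<in> sets (distr M borel (X n))"
    then have [measurable]: "A \<in> sets borel" by simp
    interpret d: prob_space "distr M borel (X n)" by (rule M.prob_space_distr) measurable
    have "E (\<lambda>w. indicator A (X n w)) = I (indicator A :: 'a \<Rightarrow> real)" by (intro E bb) measurable
    moreover have "E (\<lambda>w. indicator A (X n w) :: real) = integral\<^sup>L (distr M borel (X n)) (indicator A)"
      by (subst integral_distr) auto
    ultimately have "measure (distr M borel (X n)) A = measure \<pi> A" by simp
    then show "emeasure (distr M borel (X n)) A = emeasure \<pi> A"
      by (simp add: d.emeasure_eq_measure pi.emeasure_eq_measure)
  qed simp
qed

lemma E_X: "g \<in> borel_measurable borel \<Longrightarrow> E (\<lambda>w. g (X n w)) = I g" for g :: "'a \<Rightarrow> real"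
  using integral_distr[of "X n" M borel g] by (simp add: distr_X)

lemma integrable_X: "integrable \<pi> g \<Longrightarrow> integrable M (\<lambda>w. g (X n w))" for g :: "'a \<Rightarrow> real"
  using integrable_distr[of "X n" M borel g] by (simp add: distr_X)

lemma E_X_mult:
  assumes a: "bounded_borel a" and b: "bounded_borel b"
  shows "E (\<lambda>w. a (X i w) * b (X (i + k) w)) = I (\<lambda>x. a x * (Op ^^ k) b x)"
  using b
proof (induction k arbitrary: b)
  case 0
  have "(\<lambda>x. a x * b x) \<in> borel_measurable borel" by (intro bounded_borel_measurable bb a 0)
  from E_X[OF this] show ?case by simp
next
  case (Suc k)
  have "E (\<lambda>w. a (X i w) * b (X (Suc (i + k)) w)) = E (\<lambda>w. a (X i w) * Op b (X (i + k) w))"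
    by (rule Markov) (use Suc.prems in \<open>auto intro: adapted_X a\<close>)
  also have "\<dots> = I (\<lambda>x. a x * (Op ^^ Suc k) b x)"
    using Suc by (simp add: bb funpow_swap1)
  finally show ?case by simp
qed

text \<open>Reversibility makes the pair of positions at times \<open>i\<close> and
  \<open>i + k\<close> exchangeable.\<close>

lemma E_X_mult':
  assumes a: "bounded_borel a" and b: "bounded_borel b"
  shows "E (\<lambda>w. a (X (i + k) w) * b (X i w)) = I (\<lambda>x. a x * (Op ^^ k) b x)"
  using E_X_mult[OF b a] I_Op_iter_sym[OF a b, of k 0]
  by (simp add: mult.commute)

section \<open>Second moments of martingales and coboundaries\<close>

abbreviation "S \<equiv> \<lambda>g. partial_sum g X"

lemma E_square_sum_orthogonal:
  fixes Y :: "nat \<Rightarrow> 'w \<Rightarrow> real"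
  assumes int: "\<And>i j. integrable M (\<lambda>w. Y i w * Y j w)"
    and orth: "\<And>i j. E (\<lambda>w. Y i w * Y j w) = (if i = j then c else 0)"
  shows "E (\<lambda>w. (\<Sum>i<n. Y i w)\<^sup>2) = real n * c"
proof -
  have "E (\<lambda>w. (\<Sum>i<n. Y i w)\<^sup>2) = (\<Sum>i<n. \<Sum>j<n. E (\<lambda>w. Y i w * Y j w))"
    by (simp add: power2_eq_square sum_product int)
  also have "\<dots> = (\<Sum>i<n. c)" by (intro sum.cong refl) (simp add: orth)
  finally show ?thesis by simp
qed

text \<open>The explicit powers of \<open>P\<close> and those produced by the time lag can all be
  collected on one factor, whatever the order of \<open>i\<close> and \<open>j\<close>; only the
  total exponent matters.\<close>

lemma E_Op_X_mult:
  assumes \<psi>: "bounded_borel \<psi>"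
  shows "E (\<lambda>w. (Op ^^ p) \<psi> (X i w) * (Op ^^ q) \<psi> (X j w)) =
    I (\<lambda>x. \<psi> x * (Op ^^ (p + q + (if i \<le> j then j - i else i - j))) \<psi> x)"
proof (cases "i \<le> j")
  case True
  then have "E (\<lambda>w. (Op ^^ p) \<psi> (X i w) * (Op ^^ q) \<psi> (X j w)) =
      I (\<lambda>x. (Op ^^ p) \<psi> x * (Op ^^ (j - i)) ((Op ^^ q) \<psi>) x)"
    using E_X_mult[of "(Op ^^ p) \<psi>" "(Op ^^ q) \<psi>" i "j - i"] \<psi> by (simp add: bb)
  also have "(Op ^^ (j - i)) ((Op ^^ q) \<psi>) = (Op ^^ (j - i + q)) \<psi>" by (simp add: funpow_add)
  finally show ?thesis using True \<psi> by (simp add: I_Op_iter_sym ac_simps)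
next
  case False
  then have "E (\<lambda>w. (Op ^^ p) \<psi> (X i w) * (Op ^^ q) \<psi> (X j w)) =
      I (\<lambda>x. (Op ^^ p) \<psi> x * (Op ^^ (i - j)) ((Op ^^ q) \<psi>) x)"
    using E_X_mult'[of "(Op ^^ p) \<psi>" "(Op ^^ q) \<psi>" j "i - j"] \<psi> by (simp add: bb)
  also have "(Op ^^ (i - j)) ((Op ^^ q) \<psi>) = (Op ^^ (i - j + q)) \<psi>" by (simp add: funpow_add)
  finally show ?thesis using False \<psi> by (simp add: I_Op_iter_sym ac_simps)
qed

lemma adapted_increment:
  "bounded_borel \<psi> \<Longrightarrow> i \<le> n \<Longrightarrow> j \<le> n \<Longrightarrow> adapted n (\<lambda>w. \<psi> (X i w) - Op \<psi> (X j w))"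
  by (intro adapted_diff adapted_X bb)

text \<open>The indices are free so that one formula serves forward increments
  (\<open>i = i' + 1\<close>) and backward increments (\<open>i' = i + 1\<close>). Orthogonality
  becomes a cancellation among the four correlations, and equal increments leave
  \<open>c 0 - c 2\<close>, which is \<open>form \<psi> \<psi>\<close>.\<close>

lemma E_increment_mult:
  assumes \<psi>: "bounded_borel \<psi>"
  defines "d \<equiv> \<lambda>i j. if i \<le> j then j - i else i - j :: nat"
    and "c \<equiv> \<lambda>k. I (\<lambda>x. \<psi> x * (Op ^^ k) \<psi> x)"
  shows "E (\<lambda>w. (\<psi> (X i w) - Op \<psi> (X i' w)) * (\<psi> (X j w) - Op \<psi> (X j' w))) =
    c (d i j) - c (d i j' + 1) - c (d i' j + 1) + c (d i' j' + 2)"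
proof -
  have int: "integrable M (\<lambda>w. (Op ^^ p) \<psi> (X k w) * (Op ^^ q) \<psi> (X l w))" for p q k l
    by (rule adapted_integrable[of "max k l"]) (intro adapted_mult adapted_X bb \<psi>; simp)
  have "E (\<lambda>w. (\<psi> (X i w) - Op \<psi> (X i' w)) * (\<psi> (X j w) - Op \<psi> (X j' w))) =
    E (\<lambda>w. (Op ^^ 0) \<psi> (X i w) * (Op ^^ 0) \<psi> (X j w) - (Op ^^ 0) \<psi> (X i w) * (Op ^^ 1) \<psi> (X j' w)
      - (Op ^^ 1) \<psi> (X i' w) * (Op ^^ 0) \<psi> (X j w) + (Op ^^ 1) \<psi> (X i' w) * (Op ^^ 1) \<psi> (X j' w))"
    by (simp add: algebra_simps)
  also have "\<dots> = E (\<lambda>w. (Op ^^ 0) \<psi> (X i w) * (Op ^^ 0) \<psi> (X j w))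
      - E (\<lambda>w. (Op ^^ 0) \<psi> (X i w) * (Op ^^ 1) \<psi> (X j' w))
      - E (\<lambda>w. (Op ^^ 1) \<psi> (X i' w) * (Op ^^ 0) \<psi> (X j w))
      + E (\<lambda>w. (Op ^^ 1) \<psi> (X i' w) * (Op ^^ 1) \<psi> (X j' w))"
    by (simp only: Bochner_Integration.integral_add Bochner_Integration.integral_diff
        Bochner_Integration.integrable_diff int)
  also have "\<dots> = c (0 + 0 + d i j) - c (0 + 1 + d i j') - c (1 + 0 + d i' j) + c (1 + 1 + d i' j')"
    unfolding E_Op_X_mult[OF \<psi>] c_def d_def ..
  finally show ?thesis by (simp add: add.commute[of _ "Suc _"])
qed

lemma form_eq_iter: "bounded_borel \<psi> \<Longrightarrow> form \<psi> \<psi> = I (\<lambda>x. \<psi> x * \<psi> x) - I (\<lambda>x. \<psi> x * (Op ^^ 2) \<psi> x)"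
  using I_Op_iter_sym[of \<psi> \<psi> 1 1] by (simp add: form_def numeral_2_eq_2)

lemma E_square_martingale:
  assumes \<psi>: "bounded_borel \<psi>"
  shows "E (\<lambda>w. (\<Sum>k<n. \<psi> (X (Suc k) w) - Op \<psi> (X k w))\<^sup>2) = real n * form \<psi> \<psi>"
proof (rule E_square_sum_orthogonal)
  show "integrable M (\<lambda>w. (\<psi> (X (Suc i) w) - Op \<psi> (X i w)) * (\<psi> (X (Suc j) w) - Op \<psi> (X j w)))" for i j
    by (rule adapted_integrable[of "Suc (max i j)"]) (intro adapted_mult adapted_increment \<psi>; simp)
  show "E (\<lambda>w. (\<psi> (X (Suc i) w) - Op \<psi> (X i w)) * (\<psi> (X (Suc j) w) - Op \<psi> (X j w))) =
     (if i = j then form \<psi> \<psi> else 0)" for i j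
  proof (cases i j rule: linorder_cases)
    case less
    then obtain d where "j = i + d + 1" using less_iff_Suc_add by auto
    then show ?thesis unfolding E_increment_mult[OF \<psi>] by (simp add: Suc_diff_le)
  next
    case greater
    then obtain d where "i = j + d + 1" using less_iff_Suc_add by auto
    then show ?thesis unfolding E_increment_mult[OF \<psi>] by (simp add: Suc_diff_le)
  next
    case equal
    then show ?thesis unfolding E_increment_mult[OF \<psi>] form_eq_iter[OF \<psi>] by (simp add: numeral_2_eq_2)
  qed
qed

text \<open>By reversibility \<open>S\<^sub>2\<^sub>n(\<psi> - P\<psi>)\<close> is the sum of a forward and a backward martingale, each with
  \<open>n\<close> increments.\<close>

lemma E_square_S_coboundary_le:
  assumes \<psi>: "bounded_borel \<psi>"
  shows "E (\<lambda>w. (S (\<lambda>x. \<psi> x - Op \<psi> x) (2 * n) w)\<^sup>2) \<le> 4 * real n * form \<psi> \<psi>"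
proof -
  \<comment> \<open>\<open>(a, b) = (1, 0)\<close> gives martingale differences of the chain,
    \<open>(0, 1)\<close> those of the chain run backwards. Their sum over \<open>i\<close> contains
    \<open>\<psi> - Op \<psi>\<close> once at time 2i and once at time 2i + 1.\<close>
  define Y where "Y a b i w = \<psi> (X (2 * i + a) w) - Op \<psi> (X (2 * i + b) w)" for a b i :: nat and w
  have ad: "adapted (2 * i + 1) (Y a b i)" if "a + b = 1" for a b i
    unfolding Y_def[abs_def] by (intro adapted_increment \<psi>) (use that in simp_all)
  have sq: "E (\<lambda>w. (\<Sum>i<n. Y a b i w)\<^sup>2) = real n * form \<psi> \<psi>" if ab: "a + b = 1" for a b
  proof (rule E_square_sum_orthogonal)
    show "integrable M (\<lambda>w. Y a b i w * Y a b j w)" for i j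
      by (rule adapted_integrable[of "2 * max i j + 1"]) (intro adapted_mult adapted_mono[OF ad[OF ab]]; simp)
    have ab': "a = 0 \<and> b = 1 \<or> a = 1 \<and> b = 0" using ab by auto
    show "E (\<lambda>w. Y a b i w * Y a b j w) = (if i = j then form \<psi> \<psi> else 0)" for i j
    proof (cases i j rule: linorder_cases)
      case less
      then obtain d where "j = i + d + 1" using less_iff_Suc_add by auto
      then show ?thesis using ab' unfolding Y_def E_increment_mult[OF \<psi>] by (auto simp: Suc_diff_le)
    next
      case greater
      then obtain d where "i = j + d + 1" using less_iff_Suc_add by auto
      then show ?thesis using ab' unfolding Y_def E_increment_mult[OF \<psi>] by (auto simp: Suc_diff_le)
    next
      case equal
      then show ?thesis
        using ab' unfolding Y_def E_increment_mult[OF \<psi>] form_eq_iter[OF \<psi>] by (auto simp: numeral_2_eq_2)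
    qed
  qed
  define fw bw where "fw = Y 1 0" and "bw = Y 0 1"
  have ad: "adapted (2 * i + 1) (fw i)" "adapted (2 * i + 1) (bw i)" for i
    unfolding fw_def bw_def by (intro ad; simp)+
  have fw: "E (\<lambda>w. (\<Sum>i<n. fw i w)\<^sup>2) = real n * form \<psi> \<psi>"
    and bw: "E (\<lambda>w. (\<Sum>i<n. bw i w)\<^sup>2) = real n * form \<psi> \<psi>"
    unfolding fw_def bw_def by (intro sq; simp)+
  have split: "S (\<lambda>x. \<psi> x - Op \<psi> x) (2 * n) w = (\<Sum>i<n. fw i w) + (\<Sum>i<n. bw i w)" for w
    by (induction n) (simp_all add: partial_sum_def fw_def bw_def Y_def)
  have int: "integrable M (\<lambda>w. (\<Sum>i<n. Y i w)\<^sup>2)" if "\<And>i. adapted (2 * i + 1) (Y i)" for Y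
  proof -
    have "adapted (2 * n) (\<lambda>w. \<Sum>i<n. Y i w)"
      by (induction n) (auto intro!: adapted_const adapted_add intro: adapted_mono that)
    from adapted_mult[OF this this] show ?thesis
      unfolding power2_eq_square by (rule adapted_integrable)
  qed
  \<comment> \<open>No independence of the two martingales is available, so (x + y)^2 <= 2 x^2 + 2
    y^2 is used; this produces the constant 4.\<close>
  have "E (\<lambda>w. (S (\<lambda>x. \<psi> x - Op \<psi> x) (2 * n) w)\<^sup>2) \<le>
      E (\<lambda>w. 2 * (\<Sum>i<n. fw i w)\<^sup>2 + 2 * (\<Sum>i<n. bw i w)\<^sup>2)"
  proof (rule integral_mono')
    show "(S (\<lambda>x. \<psi> x - Op \<psi> x) (2 * n) w)\<^sup>2 \<le> 2 * (\<Sum>i<n. fw i w)\<^sup>2 + 2 * (\<Sum>i<n. bw i w)\<^sup>2" for w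
      unfolding split using sum_squares_bound[of "\<Sum>i<n. fw i w" "\<Sum>i<n. bw i w"]
      by (simp add: power2_sum)
  qed (auto intro!: int ad)
  also have "\<dots> = 4 * real n * form \<psi> \<psi>"
    using int[OF ad(1)] int[OF ad(2)] by (simp add: fw bw)
  finally show ?thesis .
qed

section \<open>Second moments by duality\<close>

text \<open>\<open>\<phi>\<close> is a version of the conditional expectation of
  \<open>\<Phi>\<close> given \<open>X i = x\<close>, bounded at every point so that
  \<open>Op\<close> may act on it. It is a Radon-Nikodym density: with \<open>\<Phi> + c\<close> as
  density on the path space, the law of \<open>X i\<close> is dominated by \<open>2 c\<close> times
  \<open>\<pi>\<close>.\<close>

lemma conditional_expectation_X:
  fixes \<Phi> :: "'w \<Rightarrow> real"
  assumes [measurable]: "\<Phi> \<in> borel_measurable M" and c: "\<And>w. \<bar>\<Phi> w\<bar> \<le> c"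
  obtains \<phi> where "bounded_borel \<phi>"
    "\<And>g :: 'a \<Rightarrow> real. integrable \<pi> g \<Longrightarrow> E (\<lambda>w. g (X i w) * \<Phi> w) = I (\<lambda>x. g x * \<phi> x)"
proof -
  have c0: "0 \<le> c" using c abs_ge_zero order_trans by blast
  have pos: "0 \<le> \<Phi> w + c" and up: "\<Phi> w + c \<le> 2 * c" for w using c[of w] by linarith+
  define D where "D = density M (\<lambda>w. ennreal (\<Phi> w + c))"
  define \<nu> where "\<nu> = distr D borel (X i)"
  have [measurable_cong, simp]: "sets D = sets M" "space D = space M" by (simp_all add: D_def)
  have XD [measurable]: "X i \<in> D \<rightarrow>\<^sub>M borel" by (simp add: measurable_cong_sets[OF \<open>sets D = sets M\<close> refl])
  have \<nu>_le: "emeasure \<nu> A \<le> ennreal (2 * c) * emeasure \<pi> A" if [measurable]: "A \<in> sets borel" for A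
  proof -
    have "emeasure \<nu> A = (\<integral>\<^sup>+w. ennreal (\<Phi> w + c) * indicator (X i -` A \<inter> space M) w \<partial>M)"
      unfolding \<nu>_def by (subst emeasure_distr) (auto simp: D_def emeasure_density)
    also have "\<dots> \<le> (\<integral>\<^sup>+w. ennreal (2 * c) * indicator (X i -` A \<inter> space M) w \<partial>M)"
      by (intro nn_integral_mono mult_right_mono ennreal_leI up) auto
    also have "\<dots> = ennreal (2 * c) * emeasure (distr M borel (X i)) A"
      by (simp add: nn_integral_cmult emeasure_distr)
    finally show ?thesis by (simp add: distr_X)
  qed
  have "absolutely_continuous \<pi> \<nu>"
    unfolding absolutely_continuous_def
  proof
    fix A assume "A \<in> null_sets \<pi>"
    then have "A \<in> sets borel" "emeasure \<pi> A = 0" by auto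
    with \<nu>_le[of A] show "A \<in> null_sets \<nu>" by (auto simp: \<nu>_def)
  qed
  moreover have "sets \<nu> = sets \<pi>" by (simp add: \<nu>_def)
  ultimately obtain \<rho> where \<rho> [measurable]: "\<rho> \<in> borel_measurable borel" and dens: "density \<pi> \<rho> = \<nu>"
    using pi.Radon_Nikodym by (auto simp: measurable_cong_sets[OF sets_pi refl])
  have bound: "AE x in \<pi>. \<rho> x \<le> ennreal (2 * c)"
  proof (rule ccontr)
    assume neg: "\<not> ?thesis"
    define A where "A = {x. \<rho> x > ennreal (2 * c)}"
    have [measurable]: "A \<in> sets borel" unfolding A_def by measurable
    have "(\<integral>\<^sup>+x. ennreal (2 * c) * indicator A x \<partial>\<pi>) < (\<integral>\<^sup>+x. \<rho> x * indicator A x \<partial>\<pi>)"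
    proof (rule nn_integral_less)
      show "(\<integral>\<^sup>+x. ennreal (2 * c) * indicator A x \<partial>\<pi>) \<noteq> \<infinity>"
        by (simp add: nn_integral_cmult ennreal_mult_eq_top_iff)
      show "AE x in \<pi>. ennreal (2 * c) * indicator A x \<le> \<rho> x * indicator A x"
        by (rule AE_I2) (auto simp: A_def split: split_indicator)
      show "\<not> (AE x in \<pi>. \<rho> x * indicator A x \<le> ennreal (2 * c) * indicator A x)"
      proof
        assume "AE x in \<pi>. \<rho> x * indicator A x \<le> ennreal (2 * c) * indicator A x"
        then have "AE x in \<pi>. \<rho> x \<le> ennreal (2 * c)"
          by eventually_elim (auto simp: A_def not_less split: split_indicator_asm)
        with neg show False by simp
      qed
    qed measurable
    also have "\<dots> = emeasure \<nu> A" unfolding dens[symmetric] by (simp add: emeasure_density)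
    also have "\<dots> \<le> ennreal (2 * c) * emeasure \<pi> A" by (rule \<nu>_le) measurable
    finally show False by (simp add: nn_integral_cmult)
  qed
  \<comment> \<open>The density is at most \<open>2 c\<close> almost everywhere; truncation makes
    this hold at every point without changing the measure.\<close>
  define p where "p x = enn2real (min (\<rho> x) (ennreal (2 * c)))" for x
  have p_eq: "ennreal (p x) = min (\<rho> x) (ennreal (2 * c))" for x
    unfolding p_def by (rule ennreal_enn2real) (simp add: min_less_iff_disj)
  have p0: "0 \<le> p x" for x unfolding p_def by simp
  have [measurable]: "p \<in> borel_measurable borel" unfolding p_def by measurable
  have pc: "p x \<le> 2 * c" for x
    using p_eq[of x] c0 by (metis ennreal_le_iff min.cobounded2 mult_nonneg_nonneg zero_le_numeral)
  have bbp: "bounded_borel p" by (rule bounded_borelI[of _ "2 * c"]) (use p0 pc in auto)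
  have dens': "density \<pi> (\<lambda>x. ennreal (p x)) = \<nu>"
    unfolding dens[symmetric]
    by (rule density_cong) (use bound in \<open>auto elim!: eventually_mono simp: p_eq min_def\<close>)
  show thesis
  proof (rule that[of "\<lambda>x. p x - c"])
    show "bounded_borel (\<lambda>x. p x - c)" by (intro bb bbp)
    fix g :: "'a \<Rightarrow> real" assume g: "integrable \<pi> g"
    then have [measurable]: "g \<in> borel_measurable borel" by (auto dest: borel_measurable_integrable)
    have gX: "integrable M (\<lambda>w. g (X i w))" by (rule integrable_X[OF g])
    have g\<Phi>: "integrable M (\<lambda>w. g (X i w) * \<Phi> w)"
      by (rule Bochner_Integration.integrable_bound[OF integrable_mult_right[OF gX, of c]])
        (use c c0 in \<open>auto simp: abs_mult mult.commute[of c] intro!: mult_left_mono\<close>)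
    have "E (\<lambda>w. g (X i w) * \<Phi> w) + c * I g = E (\<lambda>w. (\<Phi> w + c) * g (X i w))"
      using gX g\<Phi> by (simp add: distrib_right E_X mult.commute)
    also have "\<dots> = integral\<^sup>L D (\<lambda>w. g (X i w))"
      unfolding D_def by (subst integral_density) (use pos in auto)
    also have "\<dots> = integral\<^sup>L \<nu> g"
      unfolding \<nu>_def by (rule integral_distr[symmetric]) auto
    also have "\<dots> = I (\<lambda>x. p x * g x)"
      unfolding dens'[symmetric] by (subst integral_density) (use p0 in auto)
    also have "\<dots> = I (\<lambda>x. g x * (p x - c)) + c * I g"
      using pi_mult_bb[OF g bbp] g by (simp add: right_diff_distrib mult.commute)
    finally show "E (\<lambda>w. g (X i w) * \<Phi> w) = I (\<lambda>x. g x * (p x - c))" by simp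
  qed
qed

lemma S_measurable [measurable]: "g \<in> borel_measurable borel \<Longrightarrow> S g n \<in> borel_measurable M"
  unfolding partial_sum_def[abs_def]
  by (intro borel_measurable_sum measurable_compose[OF X_measurable])

lemma integrable_S: "integrable \<pi> g \<Longrightarrow> integrable M (S g n)"
  unfolding partial_sum_def[abs_def] by (intro Bochner_Integration.integrable_sum integrable_X)

lemma integrable_X_mult:
  fixes g :: "'a \<Rightarrow> real" and \<Phi> :: "'w \<Rightarrow> real"
  assumes "integrable \<pi> g" "\<Phi> \<in> borel_measurable M" "\<And>w. \<bar>\<Phi> w\<bar> \<le> c"
  shows "integrable M (\<lambda>w. g (X i w) * \<Phi> w)"
proof (rule Bochner_Integration.integrable_bound[OF integrable_mult_right[OF integrable_X[OF assms(1)], of c]])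
  have [measurable]: "g \<in> borel_measurable borel" "\<Phi> \<in> borel_measurable M"
    using assms by (auto dest: borel_measurable_integrable)
  show "(\<lambda>w. g (X i w) * \<Phi> w) \<in> borel_measurable M" by measurable
  show "AE w in M. norm (g (X i w) * \<Phi> w) \<le> norm (c * g (X i w))"
  proof (rule AE_I2)
    fix w
    have "\<bar>g (X i w)\<bar> * \<bar>\<Phi> w\<bar> \<le> \<bar>g (X i w)\<bar> * \<bar>c\<bar>"
      using assms(3)[of w] by (intro mult_left_mono) auto
    then show "norm (g (X i w) * \<Phi> w) \<le> norm (c * g (X i w))" by (simp add: abs_mult mult.commute)
  qed
qed

text \<open>Let \<open>Z = S r (2 * n)\<close>, \<open>\<Phi>\<close> a truncation of
  \<open>Z\<close> and \<open>v\<close> its second moment. Then v = E(Z \<Phi>) = <r, \<phi>>, where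
  \<open>\<phi>\<close> sums the conditional expectations of \<open>\<Phi>\<close> given the
  positions. With \<open>\<psi>\<close> close to (1 + P)^-1 \<phi>, the energy N of
  \<open>\<psi>\<close> satisfies N <= <\<phi>, (1 - P) \<psi>>, which by the coboundary bound is at
  most sqrt(4 n N v). Hence N <= 4 n v and, in the limit, v <= C sqrt(4 n v).\<close>

lemma S_square_le:
  assumes irr: "phi_irreducible P" and aper: "aperiodic P \<pi>"
    and r: "integrable \<pi> r" "I r = 0" and C: "0 \<le> C"
    and bound: "\<And>\<psi>. bounded_borel \<psi> \<Longrightarrow> \<bar>I (\<lambda>x. r x * (\<psi> x + Op \<psi> x))\<bar> \<le> C * sqrt (form \<psi> \<psi>)"
  shows "(\<integral>\<^sup>+w. ennreal ((S r (2 * n) w)\<^sup>2) \<partial>M) \<le> ennreal (4 * real n * C\<^sup>2)"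
proof -
  define Z where "Z = S r (2 * n)"
  have rm [measurable]: "r \<in> borel_measurable borel" using r by (auto dest: borel_measurable_integrable)
  have [measurable]: "Z \<in> borel_measurable M" unfolding Z_def by measurable
  have trunc: "E (\<lambda>w. (if \<bar>Z w\<bar> \<le> c then Z w else 0)\<^sup>2) \<le> 4 * real n * C\<^sup>2" if c: "0 \<le> c" for c
  proof -
    \<comment> \<open>Truncation is needed because \<open>Z\<close> is not known to be square
      integrable; it keeps \<open>\<Phi> Z = \<Phi>^2\<close>, so \<open>v\<close> is a linear
      expression in \<open>r\<close>.\<close>
    define \<Phi> where "\<Phi> w = (if \<bar>Z w\<bar> \<le> c then Z w else 0)" for w
    have \<Phi>m [measurable]: "\<Phi> \<in> borel_measurable M" unfolding \<Phi>_def by measurable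
    have \<Phi>c: "\<bar>\<Phi> w\<bar> \<le> c" for w using c by (auto simp: \<Phi>_def)
    define v where "v = E (\<lambda>w. (\<Phi> w)\<^sup>2)"
    have v0: "0 \<le> v" unfolding v_def by simp
    have "\<forall>i. \<exists>\<phi>. bounded_borel \<phi> \<and>
      (\<forall>g :: 'a \<Rightarrow> real. integrable \<pi> g \<longrightarrow> E (\<lambda>w. g (X i w) * \<Phi> w) = I (\<lambda>x. g x * \<phi> x))"
      using conditional_expectation_X[OF \<Phi>m \<Phi>c] by metis
    then obtain \<phi>s where \<phi>s: "\<And>i. bounded_borel (\<phi>s i)"
      "\<And>i g. integrable \<pi> g \<Longrightarrow> E (\<lambda>w. g (X i w) * \<Phi> w) = I (\<lambda>x. g x * \<phi>s i x)" by metis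
    define \<phi> where "\<phi> x = (\<Sum>i<2 * n. \<phi>s i x)" for x
    have \<phi> [bb]: "bounded_borel \<phi>" unfolding \<phi>_def by (intro bb \<phi>s)
    have dual: "E (\<lambda>w. S g (2 * n) w * \<Phi> w) = I (\<lambda>x. g x * \<phi> x)" if g: "integrable \<pi> g" for g
    proof -
      have "E (\<lambda>w. S g (2 * n) w * \<Phi> w) = (\<Sum>i<2 * n. E (\<lambda>w. g (X i w) * \<Phi> w))"
        unfolding partial_sum_def sum_distrib_right
        by (rule Bochner_Integration.integral_sum) (rule integrable_X_mult[OF g \<Phi>m \<Phi>c])
      also have "\<dots> = (\<Sum>i<2 * n. I (\<lambda>x. g x * \<phi>s i x))" by (simp add: \<phi>s(2)[OF g])
      also have "\<dots> = I (\<lambda>x. g x * \<phi> x)"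
        unfolding \<phi>_def sum_distrib_left
        by (rule Bochner_Integration.integral_sum[symmetric]) (intro pi_mult_bb g \<phi>s)
      finally show ?thesis .
    qed
    have v_eq: "v = I (\<lambda>x. r x * \<phi> x)"
      unfolding dual[OF r(1), symmetric] Z_def[symmetric] v_def
      by (intro Bochner_Integration.integral_cong) (auto simp: \<Phi>_def power2_eq_square)
    have \<Phi>2: "integrable M (\<lambda>w. (\<Phi> w)\<^sup>2)"
      by (rule integrable_bounded_M[of _ "c\<^sup>2"]) (use \<Phi>c in \<open>auto intro: power_mono simp: power2_le_iff_abs_le c\<close>)
    have le: "\<bar>v - I (\<lambda>x. r x * (Op ^^ (2 * m)) \<phi> x)\<bar> \<le> C * sqrt (4 * real n * v)" for m
    proof -
      obtain \<psi> where \<psi> [bb]: "bounded_borel \<psi>"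
        and \<psi>sum: "\<And>x. \<psi> x + Op \<psi> x = \<phi> x - (Op ^^ (2 * m)) \<phi> x"
        and \<psi>N: "form \<psi> \<psi> \<le> I (\<lambda>x. \<phi> x * (\<psi> x - Op \<psi> x))"
        by (rule inverse_one_plus_Op_approx[OF \<phi>, of m]) blast
      define N where "N = form \<psi> \<psi>"
      have N0: "0 \<le> N" unfolding N_def by (intro form_nonneg bb)
      define D where "D x = \<psi> x - Op \<psi> x" for x
      have D [bb]: "bounded_borel D" unfolding D_def by (intro bb)
      have adD: "adapted (2 * n) (S D (2 * n))"
      proof -
        have "adapted (2 * n) (S D k)" if "k \<le> 2 * n" for k
          using that unfolding partial_sum_def[abs_def]
          by (induction k) (auto intro!: adapted_const adapted_add adapted_X bb)
        then show ?thesis by simp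
      qed
      have [measurable]: "S D (2 * n) \<in> borel_measurable M" using adD by (rule adapted_measurable)
      have "N \<le> E (\<lambda>w. S D (2 * n) w * \<Phi> w)"
        using \<psi>N unfolding dual[OF bb_pi[OF D]] by (simp add: N_def D_def mult.commute)
      then have "N\<^sup>2 \<le> (E (\<lambda>w. S D (2 * n) w * \<Phi> w))\<^sup>2" using N0 by (intro power_mono) auto
      also have "\<dots> \<le> E (\<lambda>w. (S D (2 * n) w)\<^sup>2) * v"
        unfolding v_def
      proof (rule M.Cauchy_Schwarz_expectation[OF _ \<Phi>2])
        show "integrable M (\<lambda>w. (S D (2 * n) w)\<^sup>2)"
          unfolding power2_eq_square by (rule adapted_integrable[OF adapted_mult[OF adD adD]])
        show "integrable M (\<lambda>w. S D (2 * n) w * \<Phi> w)"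
          unfolding partial_sum_def sum_distrib_right
          by (intro Bochner_Integration.integrable_sum integrable_X_mult[OF _ \<Phi>m \<Phi>c] bb_pi D)
      qed
      also have "\<dots> \<le> (4 * real n * N) * v"
        unfolding N_def using E_square_S_coboundary_le[OF \<psi>, of n] v0
        by (intro mult_right_mono) (simp_all add: D_def[abs_def])
      finally have "N * N \<le> N * (4 * real n * v)" by (simp add: power2_eq_square algebra_simps)
      \<comment> \<open>The energy bounds itself: one factor \<open>N\<close> cancels, and
        \<open>N = 0\<close> is trivial.\<close>
      then have Nle: "N \<le> 4 * real n * v"
        using N0 v0 by (cases "N = 0") (auto simp: mult_le_cancel_left_pos)
      have "v - I (\<lambda>x. r x * (Op ^^ (2 * m)) \<phi> x) = I (\<lambda>x. r x * (\<psi> x + Op \<psi> x))"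
        unfolding v_eq \<psi>sum right_diff_distrib
        by (rule Bochner_Integration.integral_diff[symmetric]) (intro pi_mult_bb r bb)+
      then have "\<bar>v - I (\<lambda>x. r x * (Op ^^ (2 * m)) \<phi> x)\<bar> \<le> C * sqrt N"
        using bound[OF \<psi>] by (simp add: N_def)
      also have "\<dots> \<le> C * sqrt (4 * real n * v)"
        using Nle C by (intro mult_left_mono real_sqrt_le_mono)
      finally show ?thesis .
    qed
    \<comment> \<open>The part of \<open>\<phi>\<close> not reached by \<open>1 + P\<close> is
      P^(2m) \<phi>; its pairing with \<open>r\<close> tends to a product of means, which is 0
      because \<open>r\<close> is centred.\<close>
    have "(\<lambda>m. I (\<lambda>x. r x * (Op ^^ (2 * m)) \<phi> x)) \<longlonglongrightarrow> I r * I \<phi>"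
      using filterlim_compose[OF integral_mult_Op_iter_tendsto[OF irr aper r(1) \<phi>],
          of "\<lambda>m. 2 * m" sequentially]
        filterlim_subseq[of "\<lambda>m. 2 * m"] by (simp add: strict_mono_def)
    then have "(\<lambda>m. \<bar>v - I (\<lambda>x. r x * (Op ^^ (2 * m)) \<phi> x)\<bar>) \<longlonglongrightarrow> \<bar>v - 0\<bar>"
      unfolding r(2) mult_zero_left by (intro tendsto_intros)
    then have "\<bar>v - 0\<bar> \<le> C * sqrt (4 * real n * v)"
      by (rule LIMSEQ_le_const2) (use le in auto)
    then have "v\<^sup>2 \<le> (C * sqrt (4 * real n * v))\<^sup>2" using v0 by (intro power_mono) auto
    also have "\<dots> = v * (4 * real n * C\<^sup>2)" using v0 by (simp add: power_mult_distrib)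
    finally have "v * v \<le> v * (4 * real n * C\<^sup>2)" by (simp add: power2_eq_square)
    then have "v \<le> 4 * real n * C\<^sup>2" using v0
      by (cases "v = 0") (auto simp: mult_le_cancel_left_pos)
    then show ?thesis by (simp add: v_def \<Phi>_def)
  qed
  define Zk where "Zk k w = (if \<bar>Z w\<bar> \<le> real k then Z w else 0)" for k :: nat and w
  have [measurable]: "Zk k \<in> borel_measurable M" for k unfolding Zk_def by measurable
  \<comment> \<open>Fatou's lemma removes the truncation, the bound being uniform in its
    level.\<close>
  have "(\<integral>\<^sup>+w. ennreal ((Z w)\<^sup>2) \<partial>M) = (\<integral>\<^sup>+w. liminf (\<lambda>k. ennreal ((Zk k w)\<^sup>2)) \<partial>M)"
  proof (intro nn_integral_cong)
    fix w
    obtain k0 where "\<bar>Z w\<bar> \<le> real k0" using real_arch_simple by blast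
    then have "eventually (\<lambda>k. ennreal ((Zk k w)\<^sup>2) = ennreal ((Z w)\<^sup>2)) sequentially"
      by (intro eventually_sequentiallyI[of k0]) (auto simp: Zk_def)
    then have "(\<lambda>k. ennreal ((Zk k w)\<^sup>2)) \<longlonglongrightarrow> ennreal ((Z w)\<^sup>2)" by (rule tendsto_eventually)
    then show "ennreal ((Z w)\<^sup>2) = liminf (\<lambda>k. ennreal ((Zk k w)\<^sup>2))"
      by (intro lim_imp_Liminf[symmetric]) simp_all
  qed
  also have "\<dots> \<le> liminf (\<lambda>k. \<integral>\<^sup>+w. ennreal ((Zk k w)\<^sup>2) \<partial>M)"
    by (rule nn_integral_liminf) measurable
  also have "\<dots> \<le> liminf (\<lambda>k::nat. ennreal (4 * real n * C\<^sup>2))"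
  proof (intro Liminf_mono always_eventually allI)
    fix k
    have "integrable M (\<lambda>w. (Zk k w)\<^sup>2)"
      by (rule integrable_bounded_M[of _ "(real k)\<^sup>2"]) (auto simp: Zk_def power2_le_iff_abs_le)
    then have "(\<integral>\<^sup>+w. ennreal ((Zk k w)\<^sup>2) \<partial>M) = ennreal (E (\<lambda>w. (Zk k w)\<^sup>2))"
      by (intro nn_integral_eq_integral) auto
    also have "\<dots> \<le> ennreal (4 * real n * C\<^sup>2)"
      using trunc[of "real k"] by (intro ennreal_leI) (simp add: Zk_def)
    finally show "(\<integral>\<^sup>+w. ennreal ((Zk k w)\<^sup>2) \<partial>M) \<le> ennreal (4 * real n * C\<^sup>2)" .
  qed
  also have "\<dots> = ennreal (4 * real n * C\<^sup>2)" by (simp add: Liminf_const)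
  finally show ?thesis by (simp add: Z_def)
qed

section \<open>Characteristic functions under tightness\<close>

lemma S_measurable_filtration:
  assumes \<theta>: "\<theta> \<in> borel_measurable borel" shows "S \<theta> (Suc n) \<in> borel_measurable (\<F> n)"
  unfolding partial_sum_def[abs_def]
  by (intro borel_measurable_sum measurable_compose[OF X_measurable_filtration \<theta>]) simp

lemma adapted_cos_sin_S:
  assumes \<theta>: "\<theta> \<in> borel_measurable borel"
  shows "adapted n (\<lambda>w. cos (S \<theta> (Suc n) w))" "adapted n (\<lambda>w. sin (S \<theta> (Suc n) w))"
    "adapted n (\<lambda>w. cos (S \<theta> n w))" "adapted n (\<lambda>w. sin (S \<theta> n w))"
proof -
  have 1: "S \<theta> (Suc n) \<in> borel_measurable (\<F> n)" by (rule S_measurable_filtration[OF \<theta>])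
  have 2: "S \<theta> n \<in> borel_measurable (\<F> n)"
    unfolding partial_sum_def[abs_def]
    by (intro borel_measurable_sum measurable_compose[OF X_measurable_filtration \<theta>]) simp
  show "adapted n (\<lambda>w. cos (S \<theta> (Suc n) w))" "adapted n (\<lambda>w. sin (S \<theta> (Suc n) w))"
    "adapted n (\<lambda>w. cos (S \<theta> n w))" "adapted n (\<lambda>w. sin (S \<theta> n w))"
    using 1 2 unfolding adapted_def by (auto intro!: exI[of _ 1])
qed

lemma E_cos_S:
  assumes \<theta>: "\<theta> \<in> borel_measurable borel"
  shows "I (fst (char_iter \<theta> k)) = E (\<lambda>w. cos (S \<theta> k w))"
proof -
  note [bb] = bounded_borel_char_iter[OF \<theta>]
  \<comment> \<open>The induction is on the remaining \<open>k\<close> steps with the elapsed time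
    \<open>n\<close> arbitrary: the left side is the real part of E(exp(i S_n) u_k(X_n)), with u_k
    the complex function encoded by \<open>char_iter \<theta> k\<close>.\<close>
  have "E (\<lambda>w. cos (S \<theta> n w) * fst (char_iter \<theta> k) (X n w) - sin (S \<theta> n w) * snd (char_iter \<theta> k) (X n w)) =
      E (\<lambda>w. cos (S \<theta> (n + k) w))" for n
  proof (induction k arbitrary: n)
    case (Suc k)
    let ?a = "fst (char_iter \<theta> k)" and ?b = "snd (char_iter \<theta> k)"
    have S: "S \<theta> (Suc n) w = S \<theta> n w + \<theta> (X n w)" for w by (simp add: partial_sum_def)
    have "E (\<lambda>w. cos (S \<theta> n w) * fst (char_iter \<theta> (Suc k)) (X n w) - sin (S \<theta> n w) * snd (char_iter \<theta> (Suc k)) (X n w)) =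
      E (\<lambda>w. cos (S \<theta> (Suc n) w) * Op ?a (X n w) - sin (S \<theta> (Suc n) w) * Op ?b (X n w))"
      by (simp add: S cos_add sin_add algebra_simps)
    also have "\<dots> = E (\<lambda>w. cos (S \<theta> (Suc n) w) * Op ?a (X n w)) - E (\<lambda>w. sin (S \<theta> (Suc n) w) * Op ?b (X n w))"
      by (rule Bochner_Integration.integral_diff; rule adapted_integrable[of n];
          intro adapted_mult adapted_cos_sin_S \<theta> adapted_X bb order_refl)
    also have "\<dots> = E (\<lambda>w. cos (S \<theta> (Suc n) w) * ?a (X (Suc n) w)) - E (\<lambda>w. sin (S \<theta> (Suc n) w) * ?b (X (Suc n) w))"
      by (simp add: Markov[OF adapted_cos_sin_S(1)[OF \<theta>]] Markov[OF adapted_cos_sin_S(2)[OF \<theta>]] bb)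
    also have "\<dots> = E (\<lambda>w. cos (S \<theta> (Suc n) w) * ?a (X (Suc n) w) - sin (S \<theta> (Suc n) w) * ?b (X (Suc n) w))"
      by (rule Bochner_Integration.integral_diff[symmetric]; rule adapted_integrable[of "Suc n"];
          intro adapted_mult adapted_cos_sin_S(3,4) \<theta> adapted_X bb order_refl)
    also have "\<dots> = E (\<lambda>w. cos (S \<theta> (n + Suc k) w))" using Suc[of "Suc n"] by simp
    finally show ?case .
  qed simp
  from this[of 0] have "E (\<lambda>w. fst (char_iter \<theta> k) (X 0 w)) = E (\<lambda>w. cos (S \<theta> k w))"
    by (simp add: partial_sum_def)
  then show ?thesis by (simp add: E_X bounded_borel_measurable bb)
qed

text \<open>The scale 1 / (N sqrt K) is common to all \<open>k <= K\<close>. Off the exceptional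
  event the argument of the cosine is at most 1 in absolute value, so the cosine is at least 1/2; on
  the event it is at least -1. Hence the mean is at least 1/2 - 3/2 * 1/8 = 5/16.\<close>

lemma E_cos_S_ge:
  assumes h: "h \<in> borel_measurable borel" and N: "0 < N"
    and tight: "\<And>k. 1 \<le> k \<Longrightarrow> measure M {w \<in> space M. \<bar>S h k w / sqrt (real k)\<bar> \<ge> N} \<le> 1 / 8"
    and k: "k \<le> K"
  shows "1 / 4 \<le> E (\<lambda>w. cos (S (\<lambda>x. 1 / (N * sqrt (real K)) * h x) k w))"
proof (cases "k = 0")
  case True
  then show ?thesis using M.prob_space by (simp add: partial_sum_def)
next
  case False
  let ?t = "1 / (N * sqrt (real K))"
  let ?B = "{w \<in> space M. \<bar>S h k w / sqrt (real k)\<bar> \<ge> N}"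
  have [measurable]: "S h k \<in> borel_measurable M" using h by measurable
  have B [measurable]: "?B \<in> sets M" by measurable
  have S: "S (\<lambda>x. ?t * h x) k w = ?t * S h k w" for w
    unfolding partial_sum_def by (rule sum_distrib_left[symmetric])
  have "1 / 2 - 3 / 2 * indicator ?B w \<le> cos (?t * S h k w)" if w: "w \<in> space M" for w
  proof (cases "w \<in> ?B")
    case True
    then show ?thesis using cos_ge_minus_one[of "?t * S h k w"] by simp
  next
    case nB: False
    have k0: "0 < sqrt (real k)" "sqrt (real k) \<le> sqrt (real K)" using False k by auto
    have "\<bar>S h k w\<bar> < N * sqrt (real k)" using nB w k0 by (simp add: not_le divide_less_eq)
    also have "\<dots> \<le> N * sqrt (real K)" using k0 N by (intro mult_left_mono) auto
    finally have "\<bar>?t * S h k w\<bar> \<le> 1" using N k0 by (simp add: abs_mult divide_le_eq)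
    then have "(?t * S h k w)\<^sup>2 \<le> 1" by (simp add: abs_square_le_1)
    then show ?thesis using cos_sin_approx(1)[of "?t * S h k w"] nB by simp
  qed
  then have "E (\<lambda>w. 1 / 2 - 3 / 2 * indicator ?B w) \<le> E (\<lambda>w. cos (?t * S h k w))"
  proof (intro integral_mono)
    show "integrable M (\<lambda>w. 1 / 2 - 3 / 2 * indicator ?B w :: real)"
      by (intro Bochner_Integration.integrable_diff integrable_mult_right integrable_real_indicator B)
        (simp_all add: M.emeasure_eq_measure)
    show "integrable M (\<lambda>w. cos (?t * S h k w))"
      by (rule integrable_bounded_M[where c=1]) auto
  qed
  moreover have "E (\<lambda>w. 1 / 2 - 3 / 2 * indicator ?B w) = 1 / 2 - 3 / 2 * measure M ?B"
    using M.prob_space by (simp add: M.emeasure_eq_measure)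
  moreover have "measure M ?B \<le> 1 / 8" using False by (intro tight) simp
  ultimately show ?thesis unfolding S by linarith
qed

text \<open>The constant: dividing the summed recursion by t K with t = 1 / (N sqrt K) turns sqrt K
  times the root of the energy into N times that root, and 4 is the reciprocal of the lower bound in
  \<open>E_cos_S_ge\<close>.\<close>

lemma tight_imp_bounded:
  assumes irr: "phi_irreducible P" and aper: "aperiodic P \<pi>"
    and h: "integrable \<pi> h" and N: "0 < N"
    and tight: "\<And>k. 1 \<le> k \<Longrightarrow> measure M {w \<in> space M. \<bar>S h k w / sqrt (real k)\<bar> \<ge> N} \<le> 1 / 8"
    and \<psi>: "bounded_borel \<psi>"
  shows "\<bar>I (\<lambda>x. h x * (\<psi> x + Op \<psi> x))\<bar> \<le> 4 * N * sqrt (form \<psi> \<psi>)"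
proof -
  note [bb] = \<psi>
  have hm [measurable]: "h \<in> borel_measurable borel" using h by (auto dest: borel_measurable_integrable)
  define \<rho> where "\<rho> x = \<psi> x + Op \<psi> x" for x
  have \<rho> [bb]: "bounded_borel \<rho>" unfolding \<rho>_def by (intro bb)
  have [measurable]: "\<rho> \<in> borel_measurable borel" by (rule bounded_borel_measurable[OF \<rho>])
  obtain R where R: "0 < R" "\<And>x. \<bar>\<rho> x\<bar> \<le> R" using \<rho> by (metis bounded_borelE)
  define l where "l = I (\<lambda>x. h x * \<rho> x)"
  have h\<rho>: "integrable \<pi> (\<lambda>x. h x * \<rho> x)" by (intro pi_mult_bb h bb)
  define t where "t K = 1 / (N * sqrt (real K))" for K :: nat
  \<comment> \<open>The linearisation error of exp(i t h) relative to \<open>t\<close>. It tends to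
    0 pointwise and is dominated by \<open>3 |h|\<close>, so integrability of \<open>h\<close>
    suffices. At \<open>K = 0\<close> all quotients are 0 by convention.\<close>
  define \<delta> where "\<delta> K x = (\<bar>sin (t K * h x) - t K * h x\<bar> + \<bar>cos (t K * h x) - 1\<bar>) / t K" for K x
  have [measurable]: "\<delta> K \<in> borel_measurable borel" for K unfolding \<delta>_def by measurable
  have t_pos: "0 < t K" if "0 < K" for K using that N by (simp add: t_def)
  have t_lim: "t \<longlonglongrightarrow> 0"
    unfolding t_def using N by real_asymp
  have \<delta>0: "\<bar>\<delta> K x\<bar> \<le> 3 * \<bar>h x\<bar>" for K x
  proof (cases "K = 0")
    case False
    then have "\<bar>sin (t K * h x) - t K * h x\<bar> + \<bar>cos (t K * h x) - 1\<bar> \<le> 3 * \<bar>h x\<bar> * t K"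
      using cos_sin_approx(3,4)[of "t K * h x"] t_pos[of K]
      by (simp only: abs_mult abs_of_pos mult.commute[of _ "t K"] mult.left_commute[of _ "t K"])
    then show ?thesis using t_pos[of K] False by (simp add: \<delta>_def pos_divide_le_eq)
  qed (simp add: \<delta>_def t_def)
  have \<delta>_int: "integrable \<pi> (\<delta> K)" for K
    by (rule Bochner_Integration.integrable_bound[of _ "\<lambda>x. 3 * \<bar>h x\<bar>"]) (use h \<delta>0 in auto)
  have \<delta>_lim: "(\<lambda>K. I (\<delta> K)) \<longlonglongrightarrow> I (\<lambda>x. 0)"
  proof (rule integral_dominated_convergence[where w="\<lambda>x. 3 * \<bar>h x\<bar>"])
    show "AE x in \<pi>. (\<lambda>K. \<delta> K x) \<longlonglongrightarrow> 0"
    proof (rule AE_I2, rule Lim_null_comparison)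
      fix x
      have "norm (\<delta> K x) \<le> t K * (h x)\<^sup>2" for K
      proof (cases "K = 0")
        case False
        then have "\<bar>sin (t K * h x) - t K * h x\<bar> + \<bar>cos (t K * h x) - 1\<bar> \<le> (t K * (h x)\<^sup>2) * t K"
          using cos_sin_approx(1,2)[of "t K * h x"] by (simp add: power_mult_distrib power2_eq_square algebra_simps)
        then show ?thesis using t_pos[of K] False by (simp add: \<delta>_def pos_divide_le_eq)
      qed (simp add: \<delta>_def t_def)
      then show "\<forall>\<^sub>F K in sequentially. norm (\<delta> K x) \<le> t K * (h x)\<^sup>2" by simp
      show "(\<lambda>K. t K * (h x)\<^sup>2) \<longlonglongrightarrow> 0" using tendsto_mult_left_zero[OF t_lim] by simp
    qed
  qed (use h \<delta>0 in auto)
  have main: "\<bar>l\<bar> / 4 \<le> e + N * R / sqrt (real K) + N * sqrt (form \<psi> \<psi>) + R * I (\<delta> K)"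
    if K: "0 < K" and decoup: "\<And>a. (\<And>k. bounded_borel (a k)) \<Longrightarrow> (\<And>k x. \<bar>a k x\<bar> \<le> 1) \<Longrightarrow>
      (\<Sum>k<K. form (a k) (a k)) \<le> 1 \<Longrightarrow>
      \<bar>\<Sum>k<K. I (\<lambda>x. (h x * \<rho> x) * Op (a k) x) - I (\<lambda>x. h x * \<rho> x) * I (a k)\<bar> \<le> e * real K" for K e
  proof -
    define \<theta> where "\<theta> x = t K * h x" for x
    have \<theta> [measurable]: "\<theta> \<in> borel_measurable borel" unfolding \<theta>_def by measurable
    note [bb] = bounded_borel_char_iter[OF \<theta>]
    define a b where "a k = fst (char_iter \<theta> k)" and "b k = snd (char_iter \<theta> k)" for k
    have ab [bb]: "bounded_borel (a k)" "bounded_borel (b k)" for k unfolding a_def b_def by (intro bb)+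
    have ab1: "\<bar>a k x\<bar> \<le> 1" "\<bar>b k x\<bar> \<le> 1" for k x unfolding a_def b_def by (rule abs_char_iter_le_1[OF \<theta>])+
    have Oab1: "\<bar>Op (a k) x\<bar> \<le> 1" "\<bar>Op (b k) x\<bar> \<le> 1" for k x
      using ab ab1 by (auto intro!: Op_bound dest: bounded_borel_measurable)
    have suma: "(\<Sum>k<K. form (a k) (a k)) \<le> 1" and sumb: "(\<Sum>k<K. form (b k) (b k)) \<le> 1"
      unfolding a_def b_def by (rule sum_form_char_iter_le_1[OF \<theta>])+
    have Ia: "1 / 4 \<le> I (a k)" if "k < K" for k
      unfolding a_def E_cos_S[OF \<theta>] \<theta>_def t_def using that by (intro E_cos_S_ge hm N tight) auto
    have tK: "0 < t K" by (rule t_pos[OF K])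
    \<comment> \<open>Only the imaginary part of the recursion is used: \<open>b (Suc k)\<close> is
      about \<open>\<theta> Op (a k) + Op (b k)\<close>. Tested against \<open>\<rho>\<close>, the
      difference of \<open>b k\<close> and \<open>Op (b k)\<close> becomes <(1 - P) b, (1 + P)
      \<psi>> = \<open>form (b k) \<psi>\<close>.\<close>
    have step: "\<bar>t K * I (\<lambda>x. (h x * \<rho> x) * Op (a k) x) -
       (I (\<lambda>x. b (Suc k) x * \<rho> x) - I (\<lambda>x. b k x * \<rho> x) + form (b k) \<psi>)\<bar> \<le> t K * (R * I (\<delta> K))" for k
    proof -
      have "I (\<lambda>x. b k x * \<rho> x) - I (\<lambda>x. Op (b k) x * \<rho> x) =
          I (\<lambda>x. b k x * \<psi> x) + I (\<lambda>x. b k x * Op \<psi> x) - I (\<lambda>x. Op (b k) x * \<psi> x) - I (\<lambda>x. Op (b k) x * Op \<psi> x)"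
        unfolding \<rho>_def by (simp add: distrib_left bb bb_pi)
      then have "I (\<lambda>x. b k x * \<rho> x) - I (\<lambda>x. Op (b k) x * \<rho> x) = form (b k) \<psi>"
        using I_Op_sym[of "b k" \<psi>] by (simp add: form_def bb)
      then have "I (\<lambda>x. b (Suc k) x * \<rho> x) - I (\<lambda>x. b k x * \<rho> x) + form (b k) \<psi> =
          I (\<lambda>x. b (Suc k) x * \<rho> x - Op (b k) x * \<rho> x)"
        by (simp add: bb bb_pi)
      moreover have "t K * I (\<lambda>x. (h x * \<rho> x) * Op (a k) x) = I (\<lambda>x. \<theta> x * \<rho> x * Op (a k) x)"
        unfolding \<theta>_def by (simp add: mult.assoc)
      moreover have int\<theta>: "integrable \<pi> (\<lambda>x. \<theta> x * \<rho> x * Op (a k) x)"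
        using integrable_mult_right[OF pi_mult_bb[OF h\<rho> bounded_borel_Op[OF ab(1)[of k]]], of "t K"]
        unfolding \<theta>_def by (simp only: mult.assoc)
      moreover have intb: "integrable \<pi> (\<lambda>x. b (Suc k) x * \<rho> x - Op (b k) x * \<rho> x)" by (intro bb_pi bb)
      ultimately have "t K * I (\<lambda>x. (h x * \<rho> x) * Op (a k) x) -
         (I (\<lambda>x. b (Suc k) x * \<rho> x) - I (\<lambda>x. b k x * \<rho> x) + form (b k) \<psi>) =
         I (\<lambda>x. \<theta> x * \<rho> x * Op (a k) x - (b (Suc k) x * \<rho> x - Op (b k) x * \<rho> x))"
        by simp
      also have "\<bar>\<dots>\<bar> \<le> I (\<lambda>x. \<bar>\<theta> x * \<rho> x * Op (a k) x - (b (Suc k) x * \<rho> x - Op (b k) x * \<rho> x)\<bar>)"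
        by (rule integral_abs_bound)
      also have "\<dots> \<le> I (\<lambda>x. t K * (R * \<delta> K x))"
      proof (intro integral_mono integrable_abs Bochner_Integration.integrable_diff int\<theta>
          bb_pi[OF bounded_borel_mult[OF ab(2) \<rho>]] bb_pi[OF bounded_borel_mult[OF bounded_borel_Op[OF ab(2)] \<rho>]]
          integrable_mult_right \<delta>_int)
        fix x
        have "\<theta> x * \<rho> x * Op (a k) x - (b (Suc k) x * \<rho> x - Op (b k) x * \<rho> x) =
          - (\<rho> x * ((sin (\<theta> x) - \<theta> x) * Op (a k) x + (cos (\<theta> x) - 1) * Op (b k) x))"
          unfolding b_def a_def by (simp add: algebra_simps)
        also have "\<bar>\<dots>\<bar> \<le> R * (\<bar>sin (\<theta> x) - \<theta> x\<bar> + \<bar>cos (\<theta> x) - 1\<bar>)"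
          unfolding abs_minus_cancel abs_mult
        proof (intro mult_mono R)
          show "\<bar>(sin (\<theta> x) - \<theta> x) * Op (a k) x + (cos (\<theta> x) - 1) * Op (b k) x\<bar> \<le> \<bar>sin (\<theta> x) - \<theta> x\<bar> + \<bar>cos (\<theta> x) - 1\<bar>"
            by (rule order_trans[OF abs_triangle_ineq]) (intro add_mono; simp add: abs_mult mult_left_le Oab1)
        qed (use R in auto)
        also have "\<dots> = t K * (R * \<delta> K x)" using tK by (simp add: \<delta>_def \<theta>_def)
        finally show "\<bar>\<theta> x * \<rho> x * Op (a k) x - (b (Suc k) x * \<rho> x - Op (b k) x * \<rho> x)\<bar> \<le> t K * (R * \<delta> K x)" .
      qed
      also have "\<dots> = t K * (R * I (\<delta> K))" by simp
      finally show ?thesis .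
    qed
    define B where "B = (\<Sum>k<K. I (\<lambda>x. b (Suc k) x * \<rho> x) - I (\<lambda>x. b k x * \<rho> x) + form (b k) \<psi>)"
    define A where "A = (\<Sum>k<K. I (\<lambda>x. (h x * \<rho> x) * Op (a k) x))"
    have AB: "\<bar>t K * A - B\<bar> \<le> real K * (t K * (R * I (\<delta> K)))"
    proof -
      have "t K * A - B = (\<Sum>k<K. t K * I (\<lambda>x. (h x * \<rho> x) * Op (a k) x) -
          (I (\<lambda>x. b (Suc k) x * \<rho> x) - I (\<lambda>x. b k x * \<rho> x) + form (b k) \<psi>))"
        unfolding A_def B_def sum_distrib_left sum_subtractf ..
      also have "\<bar>\<dots>\<bar> \<le> (\<Sum>k<K. t K * (R * I (\<delta> K)))"
        by (rule order_trans[OF sum_abs sum_mono]) (rule step)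
      finally show ?thesis by simp
    qed
    \<comment> \<open>The first two terms of each summand telescope to a boundary term of size
      \<open>R\<close>, as \<open>b 0 = 0\<close>; the energies are summed by Cauchy-Schwarz twice,
      over functions and over \<open>k\<close>.\<close>
    have B: "\<bar>B\<bar> \<le> R + sqrt (real K) * sqrt (form \<psi> \<psi>)"
    proof -
      have "B = (I (\<lambda>x. b K x * \<rho> x) - I (\<lambda>x. b 0 x * \<rho> x)) + (\<Sum>k<K. form (b k) \<psi>)"
        using sum_lessThan_telescope[of "\<lambda>k. I (\<lambda>x. b k x * \<rho> x)" K] by (simp add: B_def sum.distrib)
      moreover have "I (\<lambda>x. b 0 x * \<rho> x) = 0" by (simp add: b_def)
      moreover have "\<bar>I (\<lambda>x. b K x * \<rho> x)\<bar> \<le> R"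
      proof -
        have "\<bar>I (\<lambda>x. b K x * \<rho> x)\<bar> \<le> I (\<lambda>x. \<bar>b K x * \<rho> x\<bar>)" by (rule integral_abs_bound)
        also have "\<dots> \<le> I (\<lambda>x. R)"
        proof (intro integral_mono bb_pi bb)
          fix x show "\<bar>b K x * \<rho> x\<bar> \<le> R"
            unfolding abs_mult using mult_mono[OF ab1(2)[of K x] R(2)[of x]] by simp
        qed
        finally show ?thesis using pi.prob_space by simp
      qed
      moreover have "\<bar>\<Sum>k<K. form (b k) \<psi>\<bar> \<le> sqrt (real K) * sqrt (form \<psi> \<psi>)"
      proof -
        have "\<bar>\<Sum>k<K. form (b k) \<psi>\<bar> \<le> (\<Sum>k<K. sqrt (form (b k) (b k)) * sqrt (form \<psi> \<psi>))"
        proof (rule order_trans[OF sum_abs sum_mono])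
          fix k
          have "\<bar>form (b k) \<psi>\<bar> = sqrt ((form (b k) \<psi>)\<^sup>2)" by simp
          also have "\<dots> \<le> sqrt (form (b k) (b k) * form \<psi> \<psi>)"
            by (intro real_sqrt_le_mono form_Cauchy_Schwarz bb)
          finally show "\<bar>form (b k) \<psi>\<bar> \<le> sqrt (form (b k) (b k)) * sqrt (form \<psi> \<psi>)"
            by (simp add: real_sqrt_mult)
        qed
        also have "\<dots> = (\<Sum>k<K. sqrt (form (b k) (b k))) * sqrt (form \<psi> \<psi>)" by (simp add: sum_distrib_right)
        also have "\<dots> \<le> (sqrt (real K) * sqrt (\<Sum>k<K. form (b k) (b k))) * sqrt (form \<psi> \<psi>)"
          by (intro mult_right_mono sum_sqrt_le form_nonneg bb real_sqrt_ge_zero)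
        also have "\<dots> \<le> (sqrt (real K) * 1) * sqrt (form \<psi> \<psi>)"
          using sumb by (intro mult_right_mono mult_left_mono real_sqrt_ge_zero form_nonneg bb) auto
        finally show ?thesis by simp
      qed
      ultimately show ?thesis by linarith
    qed
    have "\<bar>A - l * (\<Sum>k<K. I (a k))\<bar> \<le> e * real K"
      using decoup[of a, OF ab(1) ab1(1) suma]
      by (simp add: A_def l_def sum_subtractf sum_distrib_left)
    moreover have "real K * (\<bar>l\<bar> / 4) \<le> \<bar>l * (\<Sum>k<K. I (a k))\<bar>"
    proof -
      have sum_ge: "real K * (1 / 4) \<le> (\<Sum>k<K. I (a k))"
        using sum_mono[of "{..<K}" "\<lambda>_. 1/4" "\<lambda>k. I (a k)"] Ia by simp
      then have "\<bar>l\<bar> * (real K * (1 / 4)) \<le> \<bar>l\<bar> * \<bar>\<Sum>k<K. I (a k)\<bar>"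
        by (intro mult_left_mono) auto
      then show ?thesis by (simp add: abs_mult mult.commute)
    qed
    moreover have "\<bar>A\<bar> \<le> (R + sqrt (real K) * sqrt (form \<psi> \<psi>)) / t K + real K * (R * I (\<delta> K))"
    proof -
      have "\<bar>t K * A\<bar> \<le> (R + sqrt (real K) * sqrt (form \<psi> \<psi>)) + real K * (t K * (R * I (\<delta> K)))"
        using AB B by linarith
      then have "\<bar>A\<bar> * t K \<le> (R + sqrt (real K) * sqrt (form \<psi> \<psi>)) + real K * (R * I (\<delta> K)) * t K"
        using tK by (simp add: abs_mult algebra_simps)
      then show ?thesis using tK by (simp add: field_simps)
    qed
    ultimately have "real K * (\<bar>l\<bar> / 4) \<le> e * real K + (R + sqrt (real K) * sqrt (form \<psi> \<psi>)) / t K + real K * (R * I (\<delta> K))"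
      by linarith
    also have "\<dots> = real K * (e + N * R / sqrt (real K) + N * sqrt (form \<psi> \<psi>) + R * I (\<delta> K))"
    proof -
      have "real K = sqrt (real K) * sqrt (real K)" by simp
      then have K1: "real K / sqrt (real K) = sqrt (real K)" using K by (simp add: real_div_sqrt)
      have "(R + sqrt (real K) * sqrt (form \<psi> \<psi>)) / t K = N * R * sqrt (real K) + N * sqrt (form \<psi> \<psi>) * (sqrt (real K) * sqrt (real K))"
        unfolding t_def by (simp add: algebra_simps)
      also have "\<dots> = real K * (N * R / sqrt (real K)) + real K * (N * sqrt (form \<psi> \<psi>))"
      proof -
        have "real K * (N * R / sqrt (real K)) = N * R * (real K / sqrt (real K))" by simp
        then show ?thesis unfolding K1 by (simp add: mult.commute)
      qed
      finally show ?thesis by (simp add: algebra_simps)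
    qed
    finally show ?thesis using K by simp
  qed
  \<comment> \<open>For fixed \<open>e\<close> all terms depending on \<open>K\<close> vanish in the
    limit; \<open>e\<close> is let go to 0 only afterwards, since \<open>K0\<close> depends on
    it.\<close>
  have "\<bar>l\<bar> / 4 \<le> N * sqrt (form \<psi> \<psi>) + e" if e: "0 < e" for e
  proof -
    from average_decoupling[OF irr aper h\<rho> e] obtain K0 where K0:
      "\<And>K a. K \<ge> K0 \<Longrightarrow> (\<And>k. bounded_borel (a k)) \<Longrightarrow> (\<And>k x. \<bar>a k x\<bar> \<le> 1) \<Longrightarrow>
      (\<Sum>k<K. form (a k) (a k)) \<le> 1 \<Longrightarrow>
      \<bar>\<Sum>k<K. I (\<lambda>x. (h x * \<rho> x) * Op (a k) x) - I (\<lambda>x. h x * \<rho> x) * I (a k)\<bar> \<le> e * real K" by blast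
    have "\<bar>l\<bar> / 4 \<le> e + N * R / sqrt (real K) + N * sqrt (form \<psi> \<psi>) + R * I (\<delta> K)"
      if "K \<ge> max 1 K0" for K
      using that by (intro main K0) auto
    moreover have "(\<lambda>K. e + N * R / sqrt (real K) + N * sqrt (form \<psi> \<psi>) + R * I (\<delta> K)) \<longlonglongrightarrow>
        e + 0 + N * sqrt (form \<psi> \<psi>) + R * I (\<lambda>x. 0)"
    proof (intro tendsto_intros \<delta>_lim)
      show "(\<lambda>K. N * R / sqrt (real K)) \<longlonglongrightarrow> 0" by real_asymp
    qed
    ultimately have "\<bar>l\<bar> / 4 \<le> e + 0 + N * sqrt (form \<psi> \<psi>) + R * I (\<lambda>x. 0)"
      by (intro LIMSEQ_le_const) (auto intro!: exI[of _ "max 1 K0"])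
    then show ?thesis by simp
  qed
  then have "\<bar>l\<bar> / 4 \<le> N * sqrt (form \<psi> \<psi>)" by (rule field_le_epsilon)
  then show ?thesis by (simp add: l_def \<rho>_def)
qed

section \<open>Martingale approximation and the martingale central limit theorem\<close>

abbreviation "remainder h f \<equiv> (\<lambda>x. h x - (f x - Op f x))"

definition mart :: "('a \<Rightarrow> real) \<Rightarrow> nat \<Rightarrow> 'w \<Rightarrow> real" where
  "mart f n w = (\<Sum>k<n. f (X (Suc k) w) - Op f (X k w))"

lemma adapted_mart: "bounded_borel f \<Longrightarrow> adapted n (mart f n)"
proof (induction n)
  case (Suc n)
  have "adapted (Suc n) (\<lambda>w. mart f n w + (f (X (Suc n) w) - Op f (X n w)))"
    by (intro adapted_add adapted_mono[OF Suc.IH] adapted_increment Suc.prems) auto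
  then show ?case by (simp add: mart_def[abs_def])
qed (simp add: mart_def[abs_def] adapted_const)

text \<open>Gordin's decomposition: adding \<open>f(X_0) - f(X_n)\<close> to the martingale turns
  its increments into \<open>f - Op f\<close> along the path.\<close>

lemma partial_sum_eq_martingale:
  "S h n w = mart f n w + (f (X 0 w) - f (X n w)) + S (remainder h f) n w"
  by (induction n) (simp_all add: partial_sum_def mart_def)

definition adapted_complex :: "nat \<Rightarrow> ('w \<Rightarrow> complex) \<Rightarrow> bool" where
  "adapted_complex n \<Phi> \<longleftrightarrow> adapted n (\<lambda>w. Re (\<Phi> w)) \<and> adapted n (\<lambda>w. Im (\<Phi> w))"

lemma adapted_complex_integrable:
  assumes "adapted_complex n \<Phi>" shows "integrable M \<Phi>"
proof -
  have "integrable M (\<lambda>w. complex_of_real (Re (\<Phi> w)) + \<i> * complex_of_real (Im (\<Phi> w)))"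
    using assms unfolding adapted_complex_def
    by (intro Bochner_Integration.integrable_add integrable_mult_right integrable_of_real adapted_integrable) auto
  then show ?thesis by (simp flip: complex_eq)
qed

lemma adapted_complex_mult:
  "adapted_complex n \<Phi> \<Longrightarrow> adapted n Y \<Longrightarrow> adapted_complex n (\<lambda>w. \<Phi> w * complex_of_real (Y w))"
  unfolding adapted_complex_def by (simp add: adapted_mult)

lemma adapted_complex_mono: "adapted_complex m \<Phi> \<Longrightarrow> m \<le> n \<Longrightarrow> adapted_complex n \<Phi>"
  unfolding adapted_complex_def using adapted_mono by blast

lemma Markov_complex:
  assumes \<Phi>: "adapted_complex n \<Phi>" and f: "bounded_borel f"
  shows "E (\<lambda>w. \<Phi> w * complex_of_real (f (X (Suc n) w))) = E (\<lambda>w. \<Phi> w * complex_of_real (Op f (X n w)))"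
proof -
  have 1: "integrable M (\<lambda>w. \<Phi> w * complex_of_real (f (X (Suc n) w)))"
    by (rule adapted_complex_integrable[of "Suc n"])
      (intro adapted_complex_mult adapted_complex_mono[OF \<Phi>] adapted_X f; simp)
  have 2: "integrable M (\<lambda>w. \<Phi> w * complex_of_real (Op f (X n w)))"
    by (rule adapted_complex_integrable[OF adapted_complex_mult[OF \<Phi> adapted_X]]) (auto intro: bb f)
  have re: "adapted n (\<lambda>w. Re (\<Phi> w))" and im: "adapted n (\<lambda>w. Im (\<Phi> w))"
    using \<Phi> by (simp_all add: adapted_complex_def)
  have "Re (E (\<lambda>w. \<Phi> w * complex_of_real (Y w))) = E (\<lambda>w. Re (\<Phi> w) * Y w) \<and>
      Im (E (\<lambda>w. \<Phi> w * complex_of_real (Y w))) = E (\<lambda>w. Im (\<Phi> w) * Y w)"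
    if int: "integrable M (\<lambda>w. \<Phi> w * complex_of_real (Y w))" for Y
    by (subst integral_Re[OF int, symmetric], subst integral_Im[OF int, symmetric]) (simp del: integral_Re integral_Im)
  from this[OF 1] this[OF 2] show ?thesis
    using Markov[OF re f] Markov[OF im f] by (intro complex_eqI) simp_all
qed

lemma Markov_complex_iter:
  assumes \<Phi>: "adapted_complex n \<Phi>" and f: "bounded_borel f"
  shows "E (\<lambda>w. \<Phi> w * complex_of_real (f (X (n + L) w))) = E (\<lambda>w. \<Phi> w * complex_of_real ((Op ^^ L) f (X n w)))"
  using f
proof (induction L arbitrary: f)
  case (Suc L)
  have "E (\<lambda>w. \<Phi> w * complex_of_real (f (X (Suc (n + L)) w))) = E (\<lambda>w. \<Phi> w * complex_of_real (Op f (X (n + L) w)))"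
    by (rule Markov_complex[OF adapted_complex_mono[OF \<Phi>] Suc.prems]) simp
  then show ?case using Suc by (simp add: bb funpow_swap1)
qed simp

lemma adapted_complex_iexp:
  assumes f: "bounded_borel f" shows "adapted_complex n (\<lambda>w. iexp (s * mart f n w))"
proof -
  have "mart f n \<in> borel_measurable (\<F> n)"
    using adapted_mart[OF f] by (simp add: adapted_def)
  then show ?thesis
    unfolding adapted_complex_def adapted_def by (auto simp: Re_exp Im_exp intro!: exI[of _ 1])
qed

text \<open>Second order Taylor expansion of the last factor of the characteristic function. The
  linear term vanishes by the martingale property, and the quadratic one has the conditional
  variance \<open>v(X_k)\<close> in place of its mean \<open>form f f\<close>; the last term of the
  bound is the price of exchanging them.\<close>

lemma E_iexp_martingale_step:
  fixes s :: real
  assumes f: "bounded_borel f" and d: "\<And>x y. \<bar>f y - Op f x\<bar> \<le> d"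
  defines "v \<equiv> \<lambda>x. Op (\<lambda>y. (f y)\<^sup>2) x - (Op f x)\<^sup>2"
    and "\<phi> \<equiv> \<lambda>k. E (\<lambda>w. iexp (s * mart f k w))"
  shows "cmod (\<phi> (Suc k) - complex_of_real (1 - s\<^sup>2 * form f f / 2) * \<phi> k) \<le>
     \<bar>s\<bar> ^ 3 * d ^ 3 / 6 + s\<^sup>2 / 2 * cmod (E (\<lambda>w. iexp (s * mart f k w) * complex_of_real (v (X k w) - form f f)))"
proof -
  note [bb] = f
  define \<Phi> where "\<Phi> w = iexp (s * mart f k w)" for w
  define D where "D w = f (X (Suc k) w) - Op f (X k w)" for w
  have \<Phi>: "adapted_complex k \<Phi>" unfolding \<Phi>_def by (rule adapted_complex_iexp[OF f])
  have \<Phi>S: "adapted_complex (Suc k) \<Phi>" by (rule adapted_complex_mono[OF \<Phi>]) simp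
  have norm\<Phi>: "cmod (\<Phi> w) = 1" for w by (simp add: \<Phi>_def)
  have D: "adapted (Suc k) D" unfolding D_def by (intro adapted_increment f) auto
  have v: "bounded_borel v" unfolding v_def by (intro bb)
  have i\<Phi>: "integrable M \<Phi>" by (rule adapted_complex_integrable[OF \<Phi>])
  have intS: "integrable M (\<lambda>w. \<Phi> w * complex_of_real (Y w))" if "adapted (Suc k) Y" for Y
    by (rule adapted_complex_integrable[OF adapted_complex_mult[OF \<Phi>S that]])
  have adX: "adapted (Suc k) (\<lambda>w. g (X k w))" "adapted (Suc k) (\<lambda>w. g (X (Suc k) w))" if "bounded_borel g" for g
    by (intro adapted_X that; simp)+
  have \<phi>k: "\<phi> k = E \<Phi>" by (simp add: \<phi>_def \<Phi>_def[abs_def])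
  have ED: "E (\<lambda>w. \<Phi> w * complex_of_real (D w)) = 0"
  proof -
    have "E (\<lambda>w. \<Phi> w * complex_of_real (D w)) =
        E (\<lambda>w. \<Phi> w * complex_of_real (f (X (Suc k) w))) - E (\<lambda>w. \<Phi> w * complex_of_real (Op f (X k w)))"
      unfolding D_def of_real_diff right_diff_distrib
      by (rule Bochner_Integration.integral_diff; rule intS; intro adX bb)
    then show ?thesis by (simp add: Markov_complex[OF \<Phi> f])
  qed
  have ED2: "E (\<lambda>w. \<Phi> w * complex_of_real ((D w)\<^sup>2)) = E (\<lambda>w. \<Phi> w * complex_of_real (v (X k w)))"
  proof -
    have \<Phi>f: "adapted_complex k (\<lambda>w. \<Phi> w * complex_of_real (Op f (X k w)))"
      by (intro adapted_complex_mult \<Phi> adapted_X bb) simp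
    have "E (\<lambda>w. \<Phi> w * complex_of_real ((D w)\<^sup>2)) =
        E (\<lambda>w. \<Phi> w * complex_of_real ((f (X (Suc k) w))\<^sup>2)
           - 2 * ((\<Phi> w * complex_of_real (Op f (X k w))) * complex_of_real (f (X (Suc k) w)))
           + \<Phi> w * complex_of_real ((Op f (X k w))\<^sup>2))"
      unfolding D_def by (simp add: power2_eq_square algebra_simps)
    also have "\<dots> = E (\<lambda>w. \<Phi> w * complex_of_real ((f (X (Suc k) w))\<^sup>2))
           - 2 * E (\<lambda>w. (\<Phi> w * complex_of_real (Op f (X k w))) * complex_of_real (f (X (Suc k) w)))
           + E (\<lambda>w. \<Phi> w * complex_of_real ((Op f (X k w))\<^sup>2))"
    proof -
      have 1: "integrable M (\<lambda>w. \<Phi> w * complex_of_real ((f (X (Suc k) w))\<^sup>2))"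
        by (intro intS adX(2)[of "\<lambda>x. (f x)\<^sup>2"] bb)
      have 2: "integrable M (\<lambda>w. (\<Phi> w * complex_of_real (Op f (X k w))) * complex_of_real (f (X (Suc k) w)))"
        by (rule adapted_complex_integrable[OF adapted_complex_mult[OF adapted_complex_mono[OF \<Phi>f] adX(2)[OF f]]]) simp
      have 3: "integrable M (\<lambda>w. \<Phi> w * complex_of_real ((Op f (X k w))\<^sup>2))"
        by (intro intS adX(1)[of "\<lambda>x. (Op f x)\<^sup>2"] bb)
      show ?thesis using 1 2 3 by simp
    qed
    also have "\<dots> = E (\<lambda>w. \<Phi> w * complex_of_real (Op (\<lambda>y. (f y)\<^sup>2) (X k w)))
           - 2 * E (\<lambda>w. (\<Phi> w * complex_of_real (Op f (X k w))) * complex_of_real (Op f (X k w)))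
           + E (\<lambda>w. \<Phi> w * complex_of_real ((Op f (X k w))\<^sup>2))"
      using Markov_complex[OF \<Phi>, of "\<lambda>y. (f y)\<^sup>2"] Markov_complex[OF \<Phi>f f] by (simp add: bb)
    also have "\<dots> = E (\<lambda>w. \<Phi> w * complex_of_real (Op (\<lambda>y. (f y)\<^sup>2) (X k w)))
           - E (\<lambda>w. \<Phi> w * complex_of_real ((Op f (X k w))\<^sup>2))"
      by (simp add: power2_eq_square mult.assoc)
    also have "\<dots> = E (\<lambda>w. \<Phi> w * complex_of_real (v (X k w)))"
      unfolding v_def of_real_diff right_diff_distrib
      by (rule Bochner_Integration.integral_diff[symmetric]; rule intS; intro adX bb adX(1)[of "\<lambda>x. (Op f x)\<^sup>2"])
    finally show ?thesis .
  qed
  define rem where "rem w = iexp (s * D w) - (1 + \<i> * complex_of_real (s * D w) - complex_of_real ((s * D w)\<^sup>2) / 2)" for w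
  have rem: "cmod (rem w) \<le> \<bar>s\<bar> ^ 3 * d ^ 3 / 6" for w
  proof -
    have "(\<Sum>j\<le>2. (\<i> * complex_of_real x) ^ j / fact j) = 1 + \<i> * complex_of_real x - complex_of_real (x\<^sup>2) / 2" for x
      by (simp add: numeral_2_eq_2 power_mult_distrib)
    then have "cmod (rem w) \<le> \<bar>s * D w\<bar> ^ 3 / 6"
      unfolding rem_def using iexp_approx1[of "s * D w" 2] by (simp only:) (simp add: fact_numeral)
    also have "\<dots> \<le> (\<bar>s\<bar> * d) ^ 3 / 6"
      unfolding abs_mult using d[of "X (Suc k) w" "X k w"]
      by (intro divide_right_mono power_mono mult_left_mono) (auto simp: D_def)
    finally show ?thesis by (simp add: power_mult_distrib)
  qed
  have remm: "integrable M (\<lambda>w. \<Phi> w * rem w)"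
  proof (rule integrable_bounded_M)
    have "\<Phi> \<in> borel_measurable M" "D \<in> borel_measurable M"
      using i\<Phi> D by (auto dest: adapted_measurable)
    then show "(\<lambda>w. \<Phi> w * rem w) \<in> borel_measurable M" unfolding rem_def by measurable
    show "norm (\<Phi> w * rem w) \<le> \<bar>s\<bar> ^ 3 * d ^ 3 / 6" for w
      using rem[of w] by (simp add: norm_mult norm\<Phi>)
  qed
  have D2: "adapted (Suc k) (\<lambda>w. (D w)\<^sup>2)" unfolding power2_eq_square by (intro adapted_mult D)
  have "\<phi> (Suc k) = E (\<lambda>w. \<Phi> w + (\<i> * s) * (\<Phi> w * complex_of_real (D w))
      - (s\<^sup>2 / 2) * (\<Phi> w * complex_of_real ((D w)\<^sup>2)) + \<Phi> w * rem w)"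
  proof -
    have "iexp (s * mart f (Suc k) w) = \<Phi> w * iexp (s * D w)" for w
      by (simp add: \<Phi>_def D_def mart_def exp_add[symmetric] algebra_simps)
    then show ?thesis unfolding \<phi>_def rem_def
      by (intro Bochner_Integration.integral_cong) (auto simp: algebra_simps power_mult_distrib)
  qed
  also have "\<dots> = \<phi> k + (\<i> * s) * E (\<lambda>w. \<Phi> w * complex_of_real (D w))
      - (s\<^sup>2 / 2) * E (\<lambda>w. \<Phi> w * complex_of_real ((D w)\<^sup>2)) + E (\<lambda>w. \<Phi> w * rem w)"
  proof -
    note intS[OF D] intS[OF D2]
    then show ?thesis using i\<Phi> remm by (simp add: \<phi>k)
  qed
  also have "\<dots> = \<phi> k - (s\<^sup>2 / 2) * E (\<lambda>w. \<Phi> w * complex_of_real (v (X k w))) + E (\<lambda>w. \<Phi> w * rem w)"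
    unfolding ED ED2 by simp
  also have "E (\<lambda>w. \<Phi> w * complex_of_real (v (X k w))) =
      E (\<lambda>w. \<Phi> w * complex_of_real (v (X k w) - form f f)) + form f f * \<phi> k"
  proof -
    have "integrable M (\<lambda>w. \<Phi> w * complex_of_real (v (X k w)))" by (intro intS adX v)
    then show ?thesis using i\<Phi> by (simp add: right_diff_distrib \<phi>k mult.commute)
  qed
  finally have "\<phi> (Suc k) - complex_of_real (1 - s\<^sup>2 * form f f / 2) * \<phi> k =
     E (\<lambda>w. \<Phi> w * rem w) - (s\<^sup>2 / 2) * E (\<lambda>w. \<Phi> w * complex_of_real (v (X k w) - form f f))"
    by (simp add: algebra_simps)
  also have "cmod \<dots> \<le> cmod (E (\<lambda>w. \<Phi> w * rem w)) +
      cmod ((s\<^sup>2 / 2) * E (\<lambda>w. \<Phi> w * complex_of_real (v (X k w) - form f f)))"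
    by (rule norm_triangle_ineq4)
  also have "cmod (E (\<lambda>w. \<Phi> w * rem w)) \<le> \<bar>s\<bar> ^ 3 * d ^ 3 / 6"
  proof -
    have "cmod (E (\<lambda>w. \<Phi> w * rem w)) \<le> E (\<lambda>w. cmod (\<Phi> w * rem w))" by (rule integral_norm_bound)
    also have "\<dots> \<le> E (\<lambda>w. \<bar>s\<bar> ^ 3 * d ^ 3 / 6)"
      using rem by (intro integral_mono integrable_norm remm) (simp_all add: norm_mult norm\<Phi>)
    finally show ?thesis using M.prob_space by simp
  qed
  also have "cmod ((s\<^sup>2 / 2) * E (\<lambda>w. \<Phi> w * complex_of_real (v (X k w) - form f f))) =
      s\<^sup>2 / 2 * cmod (E (\<lambda>w. \<Phi> w * complex_of_real (v (X k w) - form f f)))"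
    by (simp add: norm_mult norm_divide norm_power)
  finally show ?thesis by (simp add: \<Phi>_def)
qed

text \<open>The exponential is moved back by \<open>L\<close> steps, which changes it by at most
  \<open>|s| L d\<close>; the Markov property over these steps then replaces \<open>g\<close> by its
  \<open>L\<close>-th iterate, small in L1 when \<open>g\<close> is centred. During the first
  \<open>L\<close> steps only the trivial bound is available.\<close>

lemma E_iexp_decoupling:
  assumes f: "bounded_borel f" and d: "\<And>x y. \<bar>f y - Op f x\<bar> \<le> d"
    and g: "bounded_borel g" and G: "\<And>x. \<bar>g x\<bar> \<le> G"
  shows "cmod (E (\<lambda>w. iexp (s * mart f k w) * complex_of_real (g (X k w)))) \<le>
    (if k < L then G else I (\<lambda>x. \<bar>(Op ^^ L) g x\<bar>) + \<bar>s\<bar> * (real L * d) * G)"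
proof -
  note [bb] = g
  have G0: "0 \<le> G" using G abs_ge_zero order_trans by blast
  have int: "integrable M (\<lambda>w. iexp (s * mart f j w) * complex_of_real (g' (X i w)))"
    if "bounded_borel g'" for g' i j
    by (rule adapted_complex_integrable[of "max i j"])
      (intro adapted_complex_mult adapted_complex_mono[OF adapted_complex_iexp[OF f]] adapted_X that; simp)
  define Z where "Z j w = iexp (s * mart f j w) * complex_of_real (g (X k w))" for j w
  have intZ: "integrable M (Z j)" for j unfolding Z_def by (rule int[OF g])
  have "cmod (E (Z k)) \<le> (if k < L then G else I (\<lambda>x. \<bar>(Op ^^ L) g x\<bar>) + \<bar>s\<bar> * (real L * d) * G)"
  proof (cases "k < L")
    case True
    have "cmod (E (Z k)) \<le>
      E (\<lambda>w. cmod (Z k w))"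
      by (rule integral_norm_bound)
    also have "\<dots> \<le> E (\<lambda>w. G)"
      by (intro integral_mono integrable_norm intZ) (auto simp: Z_def norm_mult G)
    finally show ?thesis using True M.prob_space by simp
  next
    case False
    then obtain j where k: "k = j + L" by (metis add.commute le_Suc_ex not_less)
    have diff: "\<bar>mart f (j + L) w - mart f j w\<bar> \<le> real L * d" for w
    proof (induction L)
      case (Suc L)
      have "mart f (j + Suc L) w - mart f j w =
        (mart f (j + L) w - mart f j w) + (f (X (Suc (j + L)) w) - Op f (X (j + L) w))"
        by (simp add: mart_def)
      then show ?case using Suc d[of "X (Suc (j + L)) w" "X (j + L) w"] by (simp add: distrib_right)
    qed simp
    have "E (Z k) =
      E (Z j) +
      E (\<lambda>w. Z k w - Z j w)"
      by (subst Bochner_Integration.integral_diff[OF intZ intZ]) simp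
    also have "E (Z j) =
      E (\<lambda>w. iexp (s * mart f j w) * complex_of_real ((Op ^^ L) g (X j w)))"
      unfolding k Z_def by (rule Markov_complex_iter[OF adapted_complex_iexp[OF f] g])
    also have "cmod (E (\<lambda>w. iexp (s * mart f j w) * complex_of_real ((Op ^^ L) g (X j w))) +
      E (\<lambda>w. Z k w - Z j w))
      \<le> I (\<lambda>x. \<bar>(Op ^^ L) g x\<bar>) + \<bar>s\<bar> * (real L * d) * G"
    proof (rule order_trans[OF norm_triangle_ineq add_mono])
      have "cmod (E (\<lambda>w. iexp (s * mart f j w) * complex_of_real ((Op ^^ L) g (X j w)))) \<le>
        E (\<lambda>w. cmod (iexp (s * mart f j w) * complex_of_real ((Op ^^ L) g (X j w))))"
        by (rule integral_norm_bound)
      also have "\<dots> = E (\<lambda>w. \<bar>(Op ^^ L) g (X j w)\<bar>)" by (simp add: norm_mult)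
      also have "\<dots> = I (\<lambda>x. \<bar>(Op ^^ L) g x\<bar>)"
        by (rule E_X[of "\<lambda>x. \<bar>(Op ^^ L) g x\<bar>"]) (intro bounded_borel_measurable bb)
      finally show "cmod (E (\<lambda>w. iexp (s * mart f j w) * complex_of_real ((Op ^^ L) g (X j w)))) \<le>
        I (\<lambda>x. \<bar>(Op ^^ L) g x\<bar>)" .
      have "cmod (E (\<lambda>w. Z k w - Z j w))
        \<le> E (\<lambda>w. cmod (Z k w - Z j w))"
        by (rule integral_norm_bound)
      also have "\<dots> \<le> E (\<lambda>w. \<bar>s\<bar> * (real L * d) * G)"
      proof (intro integral_mono integrable_norm Bochner_Integration.integrable_diff intZ)
        fix w
        have "cmod (iexp (s * mart f k w) - iexp (s * mart f j w)) \<le> \<bar>s\<bar> * (real L * d)"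
        proof -
          have "cmod (iexp (s * mart f k w) - iexp (s * mart f j w)) \<le>
            \<bar>s * mart f k w - s * mart f j w\<bar>" by (rule iexp_diff_le)
          also have "\<dots> = \<bar>s\<bar> * \<bar>mart f k w - mart f j w\<bar>"
            by (simp add: abs_mult[symmetric] right_diff_distrib)
          also have "\<dots> \<le> \<bar>s\<bar> * (real L * d)" using diff[of w] k by (intro mult_left_mono) auto
          finally show ?thesis .
        qed
        then have "cmod (iexp (s * mart f k w) - iexp (s * mart f j w)) * \<bar>g (X k w)\<bar> \<le> \<bar>s\<bar> * (real L * d) * G"
          by (intro mult_mono G) (auto intro: order_trans[OF norm_ge_zero])
        then show "cmod (Z k w - Z j w) \<le> \<bar>s\<bar> * (real L * d) * G"
          by (simp add: Z_def left_diff_distrib[symmetric] norm_mult)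
      qed simp
      finally show "cmod (E (\<lambda>w. Z k w - Z j w)) \<le> \<bar>s\<bar> * (real L * d) * G"
        using M.prob_space by simp
    qed
    finally show ?thesis using False by simp
  qed
  then show ?thesis by (simp add: Z_def[abs_def])
qed

text \<open>With s = t / sqrt n each step multiplies the characteristic function by nearly 1 - s^2 N
  / 2, where N is the energy, and the errors are summed over \<open>n\<close> steps. First
  \<open>n\<close> tends to infinity for fixed \<open>L\<close>, and then \<open>L\<close> makes the
  mixing term small.\<close>

lemma martingale_CLT:
  assumes irr: "phi_irreducible P" and aper: "aperiodic P \<pi>" and f: "bounded_borel f"
  shows "(\<lambda>n. E (\<lambda>w. iexp (t / sqrt (real n) * mart f n w))) \<longlonglongrightarrow>
    complex_of_real (exp (- (form f f * t\<^sup>2) / 2))"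
proof -
  note [bb] = f
  define N where "N = form f f"
  have N0: "0 \<le> N" unfolding N_def by (intro form_nonneg bb)
  obtain c where c: "c > 0" "\<And>x. \<bar>f x\<bar> \<le> c" using f by (metis bounded_borelE)
  have Opc: "\<bar>Op f x\<bar> \<le> c" for x using c f by (intro Op_bound) (auto dest: bounded_borel_measurable)
  define d where "d = 2 * c"
  have d: "\<bar>f y - Op f x\<bar> \<le> d" for x y using c(2)[of y] Opc[of x] unfolding d_def by linarith
  define g where "g x = Op (\<lambda>y. (f y)\<^sup>2) x - (Op f x)\<^sup>2 - N" for x
  have g [bb]: "bounded_borel g" unfolding g_def by (intro bb)
  have Ig: "I g = 0"
    unfolding g_def N_def form_def using pi.prob_space by (simp add: bb bb_pi I_Op power2_eq_square)
  obtain G where G: "G > 0" "\<And>x. \<bar>g x\<bar> \<le> G" using g by (metis bounded_borelE)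
  define \<epsilon> where "\<epsilon> L = I (\<lambda>x. \<bar>(Op ^^ L) g x\<bar>)" for L
  have \<epsilon>: "\<epsilon> \<longlonglongrightarrow> 0" unfolding \<epsilon>_def by (rule Op_iter_L1_tendsto_0[OF irr aper g Ig])
  define \<phi> where "\<phi> n = E (\<lambda>w. iexp (t / sqrt (real n) * mart f n w))" for n
  define q where "q n = 1 + (- (N * t\<^sup>2) / 2) / real n" for n
  define err where "err L n = \<bar>t\<bar> ^ 3 * d ^ 3 / 6 / sqrt (real n) +
     t\<^sup>2 / 2 * (real L * G / real n + \<epsilon> L + \<bar>t\<bar> * (real L * d) * G / sqrt (real n))" for L n
  \<comment> \<open>The condition on \<open>n\<close> keeps \<open>q n\<close> between 0 and 1, so
    \<open>geometric_recursion_error\<close> applies.\<close>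
  have bound: "cmod (\<phi> n - complex_of_real (q n ^ n)) \<le> err L n" if n: "n > 0" "N * t\<^sup>2 \<le> 2 * real n" for n L
  proof -
    define s where "s = t / sqrt (real n)"
    have s2: "s\<^sup>2 = t\<^sup>2 / real n" by (simp add: s_def power_divide)
    have sa: "\<bar>s\<bar> = \<bar>t\<bar> / sqrt (real n)" by (simp add: s_def)
    have s3: "real n * \<bar>s\<bar> ^ 3 = \<bar>t\<bar> ^ 3 / sqrt (real n)"
    proof -
      have "\<bar>s\<bar> ^ 3 = s\<^sup>2 * \<bar>s\<bar>" by (simp add: power3_eq_cube power2_eq_square abs_mult[symmetric])
      also have "\<dots> = t\<^sup>2 / real n * (\<bar>t\<bar> / sqrt (real n))" by (simp only: s2 sa)
      finally show ?thesis using n by (simp add: power3_eq_cube power2_eq_square)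
    qed
    have qn: "1 - s\<^sup>2 * form f f / 2 = q n" by (simp add: q_def s2 N_def mult.commute)
    have q1: "\<bar>q n\<bar> \<le> 1" using n N0 by (simp add: q_def field_simps abs_le_iff)
    define ee where "ee k = \<bar>s\<bar> ^ 3 * d ^ 3 / 6 + s\<^sup>2 / 2 * (if k < L then G else \<epsilon> L + \<bar>s\<bar> * (real L * d) * G)" for k
    have "cmod (E (\<lambda>w. iexp (s * mart f n w)) - complex_of_real (q n) ^ n) \<le> (\<Sum>k<n. ee k)"
    proof (rule geometric_recursion_error[OF q1])
      show "E (\<lambda>w. iexp (s * mart f 0 w)) = 1"
        using M.prob_space by (simp add: mart_def)
      fix k
      have "cmod (E (\<lambda>w. iexp (s * mart f (Suc k) w)) - complex_of_real (q n) * E (\<lambda>w. iexp (s * mart f k w)))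
        \<le> \<bar>s\<bar> ^ 3 * d ^ 3 / 6 + s\<^sup>2 / 2 * cmod (E (\<lambda>w. iexp (s * mart f k w) * complex_of_real (g (X k w))))"
        using E_iexp_martingale_step[OF f d, of s k] unfolding qn g_def N_def by simp
      also have "\<dots> \<le> ee k"
        unfolding ee_def \<epsilon>_def
        by (intro add_left_mono mult_left_mono E_iexp_decoupling[OF f d g G(2)]) auto
      finally show "cmod (E (\<lambda>w. iexp (s * mart f (Suc k) w)) - complex_of_real (q n) * E (\<lambda>w. iexp (s * mart f k w))) \<le> ee k" .
    qed
    also have "(\<Sum>k<n. ee k) \<le> err L n"
    proof -
      let ?r = "\<epsilon> L + \<bar>s\<bar> * (real L * d) * G"
      have r0: "0 \<le> ?r" using G(1) c(1) by (auto simp: \<epsilon>_def d_def intro!: add_nonneg_nonneg mult_nonneg_nonneg)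
      have "(\<Sum>k<n. if k < L then G else ?r) \<le> (\<Sum>k<n. (if k < L then G else 0) + ?r)"
        using G(1) r0 by (intro sum_mono) auto
      also have "\<dots> = (\<Sum>k<n. if k < L then G else 0) + real n * ?r" by (simp add: sum.distrib)
      also have "(\<Sum>k<n. if k < L then G else 0) \<le> real L * G"
      proof -
        have "(\<Sum>k<n. if k < L then G else 0) = (\<Sum>k\<in>{..<n} \<inter> {..<L}. G)"
          by (subst sum.inter_restrict) auto
        also have "\<dots> = real (card ({..<n} \<inter> {..<L})) * G" by simp
        also have "\<dots> \<le> real L * G"
          using G(1) card_mono[of "{..<L}" "{..<n} \<inter> {..<L}"] by (intro mult_right_mono) auto
        finally show ?thesis .
      qed
      finally have S: "(\<Sum>k<n. if k < L then G else ?r) \<le> real L * G + real n * ?r" by simp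
      have "(\<Sum>k<n. ee k) = real n * (\<bar>s\<bar> ^ 3 * d ^ 3 / 6) + s\<^sup>2 / 2 * (\<Sum>k<n. if k < L then G else ?r)"
        unfolding ee_def by (simp add: sum.distrib sum_distrib_left)
      also have "\<dots> \<le> real n * (\<bar>s\<bar> ^ 3 * d ^ 3 / 6) + s\<^sup>2 / 2 * (real L * G + real n * ?r)"
        using S by (intro add_left_mono mult_left_mono) auto
      also have "real n * (\<bar>s\<bar> ^ 3 * d ^ 3 / 6) = \<bar>t\<bar> ^ 3 * d ^ 3 / 6 / sqrt (real n)"
        using s3 by (simp add: mult.assoc[symmetric])
      also have "s\<^sup>2 / 2 * (real L * G + real n * ?r) =
         t\<^sup>2 / 2 * (real L * G / real n + \<epsilon> L + \<bar>t\<bar> * (real L * d) * G / sqrt (real n))"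
        unfolding s2 sa using n by (simp add: field_simps)
      finally show ?thesis by (simp add: err_def)
    qed
    finally show ?thesis by (simp add: \<phi>_def s_def)
  qed
  have qlim: "(\<lambda>n. complex_of_real (q n ^ n)) \<longlonglongrightarrow> complex_of_real (exp (- (N * t\<^sup>2) / 2))"
    unfolding q_def by (intro tendsto_of_real tendsto_exp_limit_sequentially)
  have "(\<lambda>n. \<phi> n - complex_of_real (q n ^ n)) \<longlonglongrightarrow> 0"
  proof (rule LIMSEQ_I)
    fix e :: real assume e: "0 < e"
    have "(\<lambda>L. t\<^sup>2 / 2 * \<epsilon> L) \<longlonglongrightarrow> t\<^sup>2 / 2 * 0" by (intro tendsto_intros \<epsilon>)
    then have "eventually (\<lambda>L. t\<^sup>2 / 2 * \<epsilon> L < e) sequentially" using e by (intro order_tendstoD(2)) auto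
    then obtain L where L: "t\<^sup>2 / 2 * \<epsilon> L < e" by (auto simp: eventually_sequentially)
    have "(\<lambda>n. err L n) \<longlonglongrightarrow> 0 + t\<^sup>2 / 2 * (0 + \<epsilon> L + 0)"
      unfolding err_def by (intro tendsto_intros; real_asymp)
    then have "eventually (\<lambda>n. err L n < e) sequentially" using L by (intro order_tendstoD(2)) auto
    moreover have "eventually (\<lambda>n. n > 0 \<and> N * t\<^sup>2 \<le> 2 * real n) sequentially"
    proof -
      obtain n0 where "N * t\<^sup>2 \<le> real n0" using real_arch_simple by blast
      then show ?thesis by (intro eventually_sequentiallyI[of "Suc n0"]) auto
    qed
    ultimately have "eventually (\<lambda>n. norm (\<phi> n - complex_of_real (q n ^ n) - 0) < e) sequentially"
      by eventually_elim (use bound[of _ L] in \<open>auto intro: le_less_trans\<close>)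
    then show "\<exists>no. \<forall>n\<ge>no. norm (\<phi> n - complex_of_real (q n ^ n) - 0) < e"
      by (simp add: eventually_sequentially)
  qed
  from tendsto_add[OF this qlim] show ?thesis by (simp add: \<phi>_def N_def)
qed

section \<open>The variational problem and the limit variance\<close>

definition pairing :: "('a \<Rightarrow> real) \<Rightarrow> ('a \<Rightarrow> real) \<Rightarrow> real" where
  "pairing h \<psi> = I (\<lambda>x. h x * (\<psi> x + Op \<psi> x))"

lemma pairing_add:
  assumes h: "integrable \<pi> h" and "bounded_borel f" "bounded_borel g"
  shows "pairing h (\<lambda>x. f x + s * g x) = pairing h f + s * pairing h g"
proof -
  have int: "integrable \<pi> (\<lambda>x. h x * (f x + Op f x))" "integrable \<pi> (\<lambda>x. h x * (g x + Op g x))"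
    by (intro pi_mult_bb h bb assms)+
  have "(\<lambda>x. h x * (f x + s * g x + (Op f x + s * Op g x))) =
      (\<lambda>x. h x * (f x + Op f x) + s * (h x * (g x + Op g x)))"
    by (simp add: fun_eq_iff algebra_simps)
  then show ?thesis using int assms by (simp add: pairing_def Op_add Op_cmult bb)
qed

lemma pairing_coboundary:
  assumes "bounded_borel f" "bounded_borel \<psi>"
  shows "pairing (\<lambda>x. f x - Op f x) \<psi> = form f \<psi>"
proof -
  have "pairing (\<lambda>x. f x - Op f x) \<psi> =
      I (\<lambda>x. f x * \<psi> x) + I (\<lambda>x. f x * Op \<psi> x) - I (\<lambda>x. Op f x * \<psi> x) - I (\<lambda>x. Op f x * Op \<psi> x)"
    using assms by (simp add: pairing_def algebra_simps bb bb_pi)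
  then show ?thesis using I_Op_sym[of f \<psi>] assms by (simp add: form_def)
qed

text \<open>The variational problem solved here is the weak form of \<open>(1 - P) f = h\<close>; a near-maximiser
  \<open>f\<close> leaves a remainder that is small in the norm dual to \<open>form\<close>.\<close>

lemma variational_approximation:
  assumes h: "integrable \<pi> h" and C: "0 \<le> C"
    and bound: "\<And>\<psi>. bounded_borel \<psi> \<Longrightarrow> \<bar>pairing h \<psi>\<bar> \<le> C * sqrt (form \<psi> \<psi>)"
  obtains \<sigma> where "0 \<le> \<sigma>"
    "\<And>\<psi>. bounded_borel \<psi> \<Longrightarrow> \<bar>pairing h \<psi>\<bar> \<le> \<sigma> * sqrt (form \<psi> \<psi>)"
    "\<And>\<epsilon>. 0 < \<epsilon> \<Longrightarrow> \<exists>f. bounded_borel f \<and> \<bar>\<sigma> - sqrt (form f f)\<bar> \<le> \<epsilon> \<and>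
      (\<forall>\<psi>. bounded_borel \<psi> \<longrightarrow> \<bar>pairing (remainder h f) \<psi>\<bar> \<le> \<epsilon> * sqrt (form \<psi> \<psi>))"
proof -
  \<comment> \<open>If (1 - P) f = h were solvable, \<open>J\<close> would be
    \<open>form f f - form (f - \<psi>) (f - \<psi>)\<close>, with maximiser \<open>f\<close> and
    maximum the limit variance.\<close>
  define J where "J \<psi> = 2 * pairing h \<psi> - form \<psi> \<psi>" for \<psi>
  let ?B = "{\<psi>. bounded_borel \<psi>}"
  have zero: "J (\<lambda>_. 0) = 0" "bounded_borel (\<lambda>_. 0 :: real)"
    by (simp_all add: J_def pairing_def form_def Op_const bb)
  have J_le: "J \<psi> \<le> C\<^sup>2" if "bounded_borel \<psi>" for \<psi>
  proof -
    have "2 * pairing h \<psi> \<le> 2 * (C * sqrt (form \<psi> \<psi>))" using bound[OF that] by simp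
    also have "\<dots> \<le> C\<^sup>2 + (sqrt (form \<psi> \<psi>))\<^sup>2"
      using sum_squares_bound[of C "sqrt (form \<psi> \<psi>)"] by simp
    finally show ?thesis using form_nonneg[OF that] by (simp add: J_def)
  qed
  have bdd: "bdd_above (J ` ?B)" by (rule bdd_aboveI[of _ "C\<^sup>2"]) (use J_le in auto)
  define s2 where "s2 = (SUP \<psi>\<in>?B. J \<psi>)"
  have J_s2: "J \<psi> \<le> s2" if "bounded_borel \<psi>" for \<psi>
    unfolding s2_def by (rule cSUP_upper[OF _ bdd]) (use that in simp)
  have s2: "0 \<le> s2" using J_s2[OF zero(2)] zero(1) by simp
  define \<sigma> where "\<sigma> = sqrt s2"
  have \<sigma>2: "\<sigma>\<^sup>2 = s2" and \<sigma>0: "0 \<le> \<sigma>" using s2 by (simp_all add: \<sigma>_def)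
  have abs_le: "\<bar>b\<bar> \<le> a * sqrt c" if "b\<^sup>2 \<le> a\<^sup>2 * c" "0 \<le> a" for a b c :: real
  proof -
    have "\<bar>b\<bar> = sqrt (b\<^sup>2)" by simp
    also have "\<dots> \<le> sqrt (a\<^sup>2 * c)" using that(1) by (rule real_sqrt_le_mono)
    finally show ?thesis using that(2) by (simp add: real_sqrt_mult)
  qed
  have J_add: "J (\<lambda>x. f x + s * \<psi> x) = J f + 2 * s * (pairing h \<psi> - form f \<psi>) - s\<^sup>2 * form \<psi> \<psi>"
    if "bounded_borel f" "bounded_borel \<psi>" for f \<psi> s
    using that by (simp add: J_def pairing_add[OF h] form_add algebra_simps)
  \<comment> \<open>The values of \<open>J\<close> at all multiples \<open>s \<psi>\<close> are at
    most \<open>s2\<close>; the discriminant criterion converts this into a norm bound.\<close>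
  have dual: "\<bar>pairing h \<psi>\<bar> \<le> \<sigma> * sqrt (form \<psi> \<psi>)" if \<psi>: "bounded_borel \<psi>" for \<psi>
  proof (rule abs_le[OF _ \<sigma>0], rule linear_le_quadratic_imp[OF _ form_nonneg[OF \<psi>]])
    fix s
    have "J (\<lambda>x. 0 + s * \<psi> x) \<le> s2" by (intro J_s2 bb \<psi>)
    moreover have "form (\<lambda>_. 0) \<psi> = 0" by (simp add: form_def Op_const)
    ultimately show "2 * s * pairing h \<psi> \<le> \<sigma>\<^sup>2 + s\<^sup>2 * form \<psi> \<psi>"
      using J_add[OF zero(2) \<psi>, of s] zero(1) by (simp add: \<sigma>2)
  qed
  show thesis
  proof (rule that[OF \<sigma>0 dual])
    fix \<epsilon> :: real assume \<epsilon>: "0 < \<epsilon>"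
    then have "s2 - \<epsilon>\<^sup>2 < s2" by simp
    then obtain f where f: "bounded_borel f" and Jf: "s2 - \<epsilon>\<^sup>2 < J f"
      unfolding s2_def by (subst (asm) less_cSUP_iff[OF _ bdd]) (use zero in auto)
    \<comment> \<open>With N the energy of \<open>f\<close>, completing the square and the dual
      bound give (\<sigma> - sqrt N)^2 <= \<open>s2 - J f\<close>, which is less than
      \<epsilon>^2.\<close>
    have "\<bar>\<sigma> - sqrt (form f f)\<bar> \<le> \<epsilon>"
    proof -
      have "2 * pairing h f \<le> 2 * (\<sigma> * sqrt (form f f))" using dual[OF f] by simp
      then have "(\<sigma> - sqrt (form f f))\<^sup>2 \<le> \<epsilon>\<^sup>2"
        using Jf form_nonneg[OF f] by (simp add: J_def power2_diff \<sigma>2)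
      then show ?thesis using \<epsilon> by (simp add: power2_le_iff_abs_le)
    qed
    moreover have "\<bar>pairing (remainder h f) \<psi>\<bar> \<le> \<epsilon> * sqrt (form \<psi> \<psi>)"
      if \<psi>: "bounded_borel \<psi>" for \<psi>
    proof (rule abs_le)
      have "pairing (remainder h f) \<psi> = pairing h \<psi> - pairing (\<lambda>x. f x - Op f x) \<psi>"
        unfolding pairing_def left_diff_distrib[of "h _"]
        by (rule Bochner_Integration.integral_diff) (intro pi_mult_bb h bb bb_pi f \<psi>)+
      then have eq: "pairing (remainder h f) \<psi> = pairing h \<psi> - form f \<psi>"
        by (simp add: pairing_coboundary f \<psi>)
      show "(pairing (remainder h f) \<psi>)\<^sup>2 \<le> \<epsilon>\<^sup>2 * form \<psi> \<psi>"
        unfolding eq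
      proof (rule linear_le_quadratic_imp[OF _ form_nonneg[OF \<psi>]])
        fix s
        \<comment> \<open>Near-maximality: perturbing \<open>f\<close> in any direction raises
          \<open>J\<close> by less than \<epsilon>^2, and the first-order term of the perturbation
          is the pairing of the remainder with \<open>\<psi>\<close>.\<close>
        have "J (\<lambda>x. f x + s * \<psi> x) \<le> s2" by (intro J_s2 bb f \<psi>)
        then show "2 * s * (pairing h \<psi> - form f \<psi>) \<le> \<epsilon>\<^sup>2 + s\<^sup>2 * form \<psi> \<psi>"
          using J_add[OF f \<psi>, of s] Jf by linarith
      qed
    qed (use \<epsilon> in simp)
    ultimately show "\<exists>f. bounded_borel f \<and> \<bar>\<sigma> - sqrt (form f f)\<bar> \<le> \<epsilon> \<and>
      (\<forall>\<psi>. bounded_borel \<psi> \<longrightarrow> \<bar>pairing (remainder h f) \<psi>\<bar> \<le> \<epsilon> * sqrt (form \<psi> \<psi>))"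
      using f by blast
  qed
qed

lemma S_square_integrable:
  assumes irr: "phi_irreducible P" and aper: "aperiodic P \<pi>"
    and r: "integrable \<pi> r" "I r = 0" and C: "0 \<le> C"
    and bound: "\<And>\<psi>. bounded_borel \<psi> \<Longrightarrow> \<bar>pairing r \<psi>\<bar> \<le> C * sqrt (form \<psi> \<psi>)"
  shows "integrable M (\<lambda>w. (S r (2 * n) w)\<^sup>2)" "E (\<lambda>w. (S r (2 * n) w)\<^sup>2) \<le> 4 * real n * C\<^sup>2"
proof -
  have [measurable]: "r \<in> borel_measurable borel" using r by (auto dest: borel_measurable_integrable)
  have le: "(\<integral>\<^sup>+w. ennreal ((S r (2 * n) w)\<^sup>2) \<partial>M) \<le> ennreal (4 * real n * C\<^sup>2)"
    using bound unfolding pairing_def by (rule S_square_le[OF irr aper r C])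
  show int: "integrable M (\<lambda>w. (S r (2 * n) w)\<^sup>2)"
    by (rule integrableI_bounded) (use le in \<open>auto simp: order_le_less_trans\<close>)
  then show "E (\<lambda>w. (S r (2 * n) w)\<^sup>2) \<le> 4 * real n * C\<^sup>2"
    using le by (simp add: nn_integral_eq_integral)
qed

lemma bounded_in_probability_imp_tail_bound:
  assumes "bounded_in_probability M Y"
  obtains N where "0 < N" "\<And>k. 1 \<le> k \<Longrightarrow> measure M {w \<in> space M. \<bar>Y k w\<bar> \<ge> N} \<le> 1 / 8"
proof -
  have "eventually (\<lambda>N::real. (SUP n\<in>{1..}. measure M {w \<in> space M. \<bar>Y n w\<bar> \<ge> N}) < 1 / 8) at_top"
    using assms unfolding bounded_in_probability_def by (rule order_tendstoD(2)) simp
  moreover have "eventually (\<lambda>N::real. 0 < N) at_top" by (rule eventually_gt_at_top)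
  ultimately have "eventually (\<lambda>N::real. (SUP n\<in>{1..}. measure M {w \<in> space M. \<bar>Y n w\<bar> \<ge> N}) < 1 / 8 \<and> 0 < N) at_top"
    by (rule eventually_conj)
  then obtain N :: real where N: "(SUP n\<in>{1..}. measure M {w \<in> space M. \<bar>Y n w\<bar> \<ge> N}) < 1 / 8" "0 < N"
    by (auto simp: eventually_at_top_linorder)
  have "measure M {w \<in> space M. \<bar>Y k w\<bar> \<ge> N} \<le> (SUP n\<in>{1..}. measure M {w \<in> space M. \<bar>Y n w\<bar> \<ge> N})"
    if "1 \<le> k" for k
    by (rule cSUP_upper) (use that in \<open>auto intro!: bdd_aboveI[of _ 1]\<close>)
  then show thesis using that N by (meson less_imp_le order_trans)
qed

text \<open>Second moments are controlled at even times only. At odd times the characteristic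
  functions are compared through first moments, which exist because \<open>h\<close> is
  integrable.\<close>

lemma CLT_even_variance:
  assumes irr: "phi_irreducible P" and aper: "aperiodic P \<pi>"
    and h: "integrable \<pi> h" "I h = 0"
    and bounded: "bounded_in_probability M (\<lambda>n w. S h n w / sqrt (real n))"
  obtains \<sigma> where "0 \<le> \<sigma>"
    "\<And>n. integrable M (\<lambda>w. (S h (2 * n) w)\<^sup>2)"
    "\<And>n. E (\<lambda>w. (S h (2 * n) w)\<^sup>2) \<le> 4 * real n * \<sigma>\<^sup>2"
    "(\<lambda>n. E (\<lambda>w. (S h (2 * n) w)\<^sup>2) / real (2 * n)) \<longlonglongrightarrow> \<sigma>\<^sup>2"
    "\<And>t. (\<lambda>n. E (\<lambda>w. iexp (t / sqrt (real n) * S h n w))) \<longlonglongrightarrow> complex_of_real (exp (- (\<sigma>\<^sup>2 * t\<^sup>2) / 2))"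
proof -
  have hm [measurable]: "h \<in> borel_measurable borel" using h by (auto dest: borel_measurable_integrable)
  obtain N where N: "0 < N" "\<And>k. 1 \<le> k \<Longrightarrow> measure M {w \<in> space M. \<bar>S h k w / sqrt (real k)\<bar> \<ge> N} \<le> 1 / 8"
    using bounded_in_probability_imp_tail_bound[OF bounded] by blast
  have pb: "\<bar>pairing h \<psi>\<bar> \<le> 4 * N * sqrt (form \<psi> \<psi>)" if "bounded_borel \<psi>" for \<psi>
    unfolding pairing_def by (rule tight_imp_bounded[OF irr aper h(1) N that])
  have "0 \<le> 4 * N" using N by simp
  from variational_approximation[OF h(1) this pb]
  obtain \<sigma> where \<sigma>: "0 \<le> \<sigma>"
    "\<And>\<psi>. bounded_borel \<psi> \<Longrightarrow> \<bar>pairing h \<psi>\<bar> \<le> \<sigma> * sqrt (form \<psi> \<psi>)"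
    "\<And>\<epsilon>. 0 < \<epsilon> \<Longrightarrow> \<exists>f. bounded_borel f \<and> \<bar>\<sigma> - sqrt (form f f)\<bar> \<le> \<epsilon> \<and>
      (\<forall>\<psi>. bounded_borel \<psi> \<longrightarrow> \<bar>pairing (remainder h f) \<psi>\<bar> \<le> \<epsilon> * sqrt (form \<psi> \<psi>))"
    by blast
  note hS = S_square_integrable[OF irr aper h \<sigma>(1,2)]
  have approx: "\<exists>f c. bounded_borel f \<and> 0 < c \<and> (\<forall>x. \<bar>f x\<bar> \<le> c) \<and> \<bar>\<sigma> - sqrt (form f f)\<bar> \<le> \<epsilon> \<and>
      integrable \<pi> (remainder h f) \<and>
      (\<forall>n. integrable M (\<lambda>w. (S (remainder h f) (2 * n) w)\<^sup>2) \<and>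
           sqrt (E (\<lambda>w. (S (remainder h f) (2 * n) w)\<^sup>2)) \<le> 2 * \<epsilon> * sqrt (real n))"
    if \<epsilon>: "0 < \<epsilon>" for \<epsilon>
  proof -
    obtain f where f: "bounded_borel f" "\<bar>\<sigma> - sqrt (form f f)\<bar> \<le> \<epsilon>"
      "\<And>\<psi>. bounded_borel \<psi> \<Longrightarrow> \<bar>pairing (remainder h f) \<psi>\<bar> \<le> \<epsilon> * sqrt (form \<psi> \<psi>)"
      using \<sigma>(3)[OF \<epsilon>] by blast
    note [bb] = f(1)
    obtain c where c: "c > 0" "\<And>x. \<bar>f x\<bar> \<le> c" using f(1) by (metis bounded_borelE)
    have int: "integrable \<pi> (remainder h f)"
      by (intro Bochner_Integration.integrable_diff h bb_pi bb)
    have "I (remainder h f) = 0" using h by (simp add: bb bb_pi I_Op)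
    note r = S_square_integrable[OF irr aper int this less_imp_le[OF \<epsilon>] f(3)]
    have "sqrt (E (\<lambda>w. (S (remainder h f) (2 * n) w)\<^sup>2)) \<le> 2 * \<epsilon> * sqrt (real n)" for n
    proof -
      have "sqrt (E (\<lambda>w. (S (remainder h f) (2 * n) w)\<^sup>2)) \<le> sqrt (4 * real n * \<epsilon>\<^sup>2)"
        by (intro real_sqrt_le_mono r)
      also have "\<dots> = 2 * \<epsilon> * sqrt (real n)"
        using \<epsilon> by (simp add: real_sqrt_mult)
      finally show ?thesis .
    qed
    then show ?thesis using f c int r(1) by blast
  qed
  define A where "A n = E (\<lambda>w. (S h (2 * n) w)\<^sup>2) / real (2 * n)" for n
  \<comment> \<open>The boundary term contributes \<open>2 c\<close>, the remainder
    \<open>2 \<epsilon>\<close> after normalisation, and the distance of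
    \<open>sqrt (form f f)\<close> from \<open>\<sigma>\<close> the third
    \<open>\<epsilon>\<close>.\<close>
  have A_bound: "\<bar>sqrt (A n) - \<sigma>\<bar> \<le> 2 * c / sqrt (real (2 * n)) + 3 * \<epsilon>"
    if n: "n > 0" and f: "bounded_borel f" and c: "0 < c" "\<forall>x. \<bar>f x\<bar> \<le> c" and \<sigma>f: "\<bar>\<sigma> - sqrt (form f f)\<bar> \<le> \<epsilon>" "0 < \<epsilon>"
      and r: "integrable \<pi> (remainder h f)"
      "integrable M (\<lambda>w. (S (remainder h f) (2 * n) w)\<^sup>2)"
      "sqrt (E (\<lambda>w. (S (remainder h f) (2 * n) w)\<^sup>2)) \<le> 2 * \<epsilon> * sqrt (real n)" for n f c \<epsilon>
  proof -
    define R where "R = S (remainder h f) (2 * n)"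
    define W where "W w = f (X 0 w) - f (X (2 * n) w)" for w
    define m where "m = mart f (2 * n)"
    define Z where "Z = S h (2 * n)"
    have rm: "(remainder h f) \<in> borel_measurable borel" using r(1) by (auto dest: borel_measurable_integrable)
    have [measurable]: "R \<in> borel_measurable M" unfolding R_def by (rule S_measurable[OF rm])
    have Wad: "adapted (2 * n) W" unfolding W_def by (intro adapted_diff adapted_X f) auto
    have mad: "adapted (2 * n) m" unfolding m_def by (rule adapted_mart[OF f])
    have [measurable]: "W \<in> borel_measurable M" "m \<in> borel_measurable M" "Z \<in> borel_measurable M"
      using Wad mad unfolding Z_def by (auto dest: adapted_measurable)
    have i: "integrable M (\<lambda>w. (W w)\<^sup>2)" "integrable M (\<lambda>w. (m w)\<^sup>2)"
      "integrable M (\<lambda>w. (R w)\<^sup>2)" "integrable M (\<lambda>w. (Z w)\<^sup>2)"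
      using adapted_integrable[OF adapted_mult[OF Wad Wad]] adapted_integrable[OF adapted_mult[OF mad mad]] r(2) hS(1)
      by (simp_all add: power2_eq_square R_def Z_def)
    have W: "sqrt (E (\<lambda>w. (W w)\<^sup>2)) \<le> 2 * c"
    proof (rule real_le_lsqrt)
      have "E (\<lambda>w. (W w)\<^sup>2) \<le> E (\<lambda>w. (2 * c)\<^sup>2)"
      proof (intro integral_mono i)
        fix w
        have "\<bar>W w\<bar> \<le> 2 * c" using c(2)[rule_format, of "X 0 w"] c(2)[rule_format, of "X (2 * n) w"] unfolding W_def by linarith
        then show "(W w)\<^sup>2 \<le> (2 * c)\<^sup>2" using power_mono[of "\<bar>W w\<bar>" "2 * c" 2] by simp
      qed simp
      then show "E (\<lambda>w. (W w)\<^sup>2) \<le> (2 * c)\<^sup>2" using M.prob_space by simp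
    qed (use c in auto)
    have R: "sqrt (E (\<lambda>w. (R w)\<^sup>2)) \<le> 2 * \<epsilon> * sqrt (real n)" using r(3) by (simp add: R_def)
    have m: "sqrt (E (\<lambda>w. (m w)\<^sup>2)) = sqrt (real (2 * n)) * sqrt (form f f)"
      using E_square_martingale[OF f, of "2 * n"] by (simp add: m_def mart_def real_sqrt_mult)
    have Z: "Z w = m w + (W w + R w)" for w
      unfolding Z_def m_def W_def R_def by (subst partial_sum_eq_martingale[of h _ _ f]) simp
    note WR = M.sqrt_expectation_square_add_le[OF i(1,3), simplified]
    have WR': "sqrt (E (\<lambda>w. (W w + R w)\<^sup>2)) \<le> 2 * c + 2 * \<epsilon> * sqrt (real n)"
      using WR(2) W R by linarith
    have "sqrt (E (\<lambda>w. (Z w)\<^sup>2)) \<le> sqrt (E (\<lambda>w. (m w)\<^sup>2)) + sqrt (E (\<lambda>w. (W w + R w)\<^sup>2))"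
      unfolding Z by (rule M.sqrt_expectation_square_add_le(2)[OF i(2) WR(1)]) measurable
    \<comment> \<open>The reverse triangle inequality, obtained by writing the martingale as the
      partial sum minus the correction.\<close>
    moreover have "sqrt (E (\<lambda>w. (m w)\<^sup>2)) \<le> sqrt (E (\<lambda>w. (Z w)\<^sup>2)) + sqrt (E (\<lambda>w. (W w + R w)\<^sup>2))"
    proof -
      have eqm: "m w = Z w + - (W w + R w)" for w by (simp add: Z)
      have "sqrt (E (\<lambda>w. (Z w + - (W w + R w))\<^sup>2)) \<le> sqrt (E (\<lambda>w. (Z w)\<^sup>2)) + sqrt (E (\<lambda>w. (- (W w + R w))\<^sup>2))"
        by (rule M.sqrt_expectation_square_add_le(2)[OF i(4)]) (use WR(1) in \<open>simp_all only: power2_minus\<close>, measurable)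
      then show ?thesis by (simp only: eqm[symmetric] power2_minus)
    qed
    ultimately have "\<bar>sqrt (E (\<lambda>w. (Z w)\<^sup>2)) - sqrt (real (2 * n)) * sqrt (form f f)\<bar> \<le> 2 * c + 2 * \<epsilon> * sqrt (real n)"
      using WR' m by linarith
    also have "\<dots> \<le> 2 * c + 2 * \<epsilon> * sqrt (real (2 * n))"
      using \<sigma>f(2) by (intro add_left_mono mult_left_mono real_sqrt_le_mono) auto
    finally have *: "\<bar>sqrt (E (\<lambda>w. (Z w)\<^sup>2)) - sqrt (real (2 * n)) * sqrt (form f f)\<bar> \<le> 2 * c + 2 * \<epsilon> * sqrt (real (2 * n))" .
    define q where "q = sqrt (real (2 * n))"
    have q: "0 < q" using n by (simp add: q_def)
    have "sqrt (A n) = sqrt (E (\<lambda>w. (Z w)\<^sup>2)) / q" by (simp add: A_def Z_def q_def real_sqrt_divide)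
    then have "sqrt (A n) - sqrt (form f f) = (sqrt (E (\<lambda>w. (Z w)\<^sup>2)) - q * sqrt (form f f)) / q"
      using q by (simp add: diff_divide_distrib)
    then have "\<bar>sqrt (A n) - sqrt (form f f)\<bar> = \<bar>sqrt (E (\<lambda>w. (Z w)\<^sup>2)) - q * sqrt (form f f)\<bar> / q"
      using q by (simp only: abs_divide abs_of_pos)
    also have "\<dots> \<le> (2 * c + 2 * \<epsilon> * q) / q" using * q by (intro divide_right_mono) (auto simp: q_def)
    also have "\<dots> = 2 * c / q + 2 * \<epsilon>" using q by (simp add: field_simps)
    finally show ?thesis using \<sigma>f(1) unfolding q_def by linarith
  qed
  have A_lim: "(\<lambda>n. sqrt (A n)) \<longlonglongrightarrow> \<sigma>"
  proof (rule LIMSEQ_I)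
    fix e :: real assume e: "0 < e"
    then have e6: "0 < e / 6" by simp
    from approx[OF this] obtain f c where fc: "bounded_borel f" "0 < c" "\<forall>x. \<bar>f x\<bar> \<le> c" "\<bar>\<sigma> - sqrt (form f f)\<bar> \<le> e / 6"
      "integrable \<pi> (remainder h f)"
      "\<And>n. integrable M (\<lambda>w. (S (remainder h f) (2 * n) w)\<^sup>2)"
      "\<And>n. sqrt (E (\<lambda>w. (S (remainder h f) (2 * n) w)\<^sup>2)) \<le> 2 * (e / 6) * sqrt (real n)" by blast
    have "(\<lambda>n. 2 * c / sqrt (real (2 * n)) + 3 * (e / 6)) \<longlonglongrightarrow> 0 + 3 * (e / 6)"
      by (intro tendsto_intros) real_asymp
    then have "eventually (\<lambda>n. 2 * c / sqrt (real (2 * n)) + 3 * (e / 6) < e) sequentially"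
      by (rule order_tendstoD(2)) (use e in simp)
    then have "eventually (\<lambda>n. norm (sqrt (A n) - \<sigma>) < e) sequentially"
      using eventually_gt_at_top[of 0]
    proof eventually_elim
      case (elim n)
      show ?case using A_bound[OF elim(2) fc(1-4) e6 fc(5-7)] elim(1) by simp
    qed
    then show "\<exists>no. \<forall>n\<ge>no. norm (sqrt (A n) - \<sigma>) < e" by (simp add: eventually_sequentially)
  qed
  have A_nonneg: "0 \<le> A n" for n by (simp add: A_def)
  have A_lim2: "A \<longlonglongrightarrow> \<sigma>\<^sup>2"
    using tendsto_power[OF A_lim, of 2] A_nonneg by simp
  have clt: "(\<lambda>n. E (\<lambda>w. iexp (t / sqrt (real n) * S h n w))) \<longlonglongrightarrow> complex_of_real (exp (- (\<sigma>\<^sup>2 * t\<^sup>2) / 2))" for t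
  proof -
    have diff: "cmod (E (\<lambda>w. iexp (t / sqrt (real n) * S h n w)) - E (\<lambda>w. iexp (t / sqrt (real n) * mart f n w)))
      \<le> \<bar>t\<bar> / sqrt (real n) * (2 * c + I (\<lambda>x. \<bar>h x - (f x - Op f x)\<bar>) + 2 * \<epsilon> * sqrt (real n))"
      if f: "bounded_borel f" and c: "0 < c" "\<forall>x. \<bar>f x\<bar> \<le> c" and \<epsilon>: "0 < \<epsilon>"
      and r: "integrable \<pi> (remainder h f)"
      "\<And>n. integrable M (\<lambda>w. (S (remainder h f) (2 * n) w)\<^sup>2)"
      "\<And>n. sqrt (E (\<lambda>w. (S (remainder h f) (2 * n) w)\<^sup>2)) \<le> 2 * \<epsilon> * sqrt (real n)" for n f c \<epsilon>
    proof -
      define s where "s = t / sqrt (real n)"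
      define \<rho> where "\<rho> x = h x - (f x - Op f x)" for x
      have \<rho>: "integrable \<pi> \<rho>" using r(1) by (simp add: \<rho>_def[abs_def])
      have \<rho>m [measurable]: "\<rho> \<in> borel_measurable borel" using \<rho> by (auto dest: borel_measurable_integrable)
      have [measurable]: "mart f n \<in> borel_measurable M"
        by (rule adapted_measurable[OF adapted_mart[OF f]])
      have even: "E (\<lambda>w. \<bar>S \<rho> (2 * k) w\<bar>) \<le> 2 * \<epsilon> * sqrt (real k)" for k
        using M.expectation_abs_le_sqrt[OF r(2)[of k] integrable_S[OF r(1)]] r(3)[of k] by (simp add: \<rho>_def[abs_def])
      \<comment> \<open>For odd \<open>n\<close> the last summand of the remainder is split off and
        bounded in L1, where it has a fixed norm that division by sqrt n makes negligible; it need
        not be square integrable.\<close>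
      have R: "E (\<lambda>w. \<bar>S \<rho> n w\<bar>) \<le> I (\<lambda>x. \<bar>\<rho> x\<bar>) + 2 * \<epsilon> * sqrt (real n)"
      proof -
        define k where "k = n div 2"
        have "2 * \<epsilon> * sqrt (real k) \<le> 2 * \<epsilon> * sqrt (real n)"
          using \<epsilon> by (intro mult_left_mono real_sqrt_le_mono) (auto simp: k_def)
        then have even': "E (\<lambda>w. \<bar>S \<rho> (2 * k) w\<bar>) \<le> 2 * \<epsilon> * sqrt (real n)" using even[of k] by linarith
        have I0: "0 \<le> I (\<lambda>x. \<bar>\<rho> x\<bar>)" by simp
        show ?thesis
        proof (cases "even n")
          case True
          then have "2 * k = n" by (simp add: k_def)
          then have "E (\<lambda>w. \<bar>S \<rho> n w\<bar>) \<le> 2 * \<epsilon> * sqrt (real n)" using even' by (simp only:)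
          then show ?thesis using I0 by linarith
        next
          case False
          then have nk: "n = Suc (2 * k)" by (simp add: k_def)
          have "E (\<lambda>w. \<bar>S \<rho> n w\<bar>) \<le> E (\<lambda>w. \<bar>S \<rho> (2 * k) w\<bar> + \<bar>\<rho> (X (2 * k) w)\<bar>)"
            by (intro integral_mono integrable_abs Bochner_Integration.integrable_add integrable_S integrable_X \<rho>)
              (simp add: nk partial_sum_def)
          also have "\<dots> = E (\<lambda>w. \<bar>S \<rho> (2 * k) w\<bar>) + E (\<lambda>w. \<bar>\<rho> (X (2 * k) w)\<bar>)"
            by (intro Bochner_Integration.integral_add integrable_abs integrable_S integrable_X \<rho>)
          also have "E (\<lambda>w. \<bar>\<rho> (X (2 * k) w)\<bar>) = I (\<lambda>x. \<bar>\<rho> x\<bar>)"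
            by (rule E_X[of "\<lambda>x. \<bar>\<rho> x\<bar>"]) measurable
          finally show ?thesis using even' by linarith
        qed
      qed
      have Sm: "integrable M (\<lambda>w. iexp (s * S h n w))" "integrable M (\<lambda>w. iexp (s * mart f n w))"
        by (rule integrable_bounded_M[where c=1]; simp)+
      have "E (\<lambda>w. iexp (s * S h n w)) - E (\<lambda>w. iexp (s * mart f n w)) =
        E (\<lambda>w. iexp (s * S h n w) - iexp (s * mart f n w))"
        by (rule Bochner_Integration.integral_diff[OF Sm, symmetric])
      also have "cmod \<dots> \<le> E (\<lambda>w. cmod (iexp (s * S h n w) - iexp (s * mart f n w)))"
        by (rule integral_norm_bound)
      also have "\<dots> \<le> E (\<lambda>w. \<bar>s\<bar> * (2 * c + \<bar>S \<rho> n w\<bar>))"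
      proof (intro integral_mono integrable_norm Bochner_Integration.integrable_diff Sm integrable_mult_right
          Bochner_Integration.integrable_add integrable_abs integrable_S \<rho>)
        fix w
        have "cmod (iexp (s * S h n w) - iexp (s * mart f n w)) \<le> \<bar>s * S h n w - s * mart f n w\<bar>"
          by (rule iexp_diff_le)
        also have "\<dots> = \<bar>s\<bar> * \<bar>f (X 0 w) - f (X n w) + S \<rho> n w\<bar>"
          unfolding right_diff_distrib[symmetric] abs_mult \<rho>_def[abs_def]
          by (subst partial_sum_eq_martingale[of h _ _ f]) (simp add: algebra_simps)
        also have "\<dots> \<le> \<bar>s\<bar> * (2 * c + \<bar>S \<rho> n w\<bar>)"
          using c(2)[rule_format, of "X 0 w"] c(2)[rule_format, of "X n w"]
          by (intro mult_left_mono) (linarith | simp)+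
        finally show "cmod (iexp (s * S h n w) - iexp (s * mart f n w)) \<le> \<bar>s\<bar> * (2 * c + \<bar>S \<rho> n w\<bar>)" .
      qed simp
      also have "\<dots> = \<bar>s\<bar> * (2 * c + E (\<lambda>w. \<bar>S \<rho> n w\<bar>))"
        using M.prob_space integrable_abs[OF integrable_S[OF \<rho>, of n]] by simp
      also have "\<dots> \<le> \<bar>s\<bar> * (2 * c + I (\<lambda>x. \<bar>\<rho> x\<bar>) + 2 * \<epsilon> * sqrt (real n))"
        using R by (intro mult_left_mono) auto
      finally show ?thesis by (simp add: s_def \<rho>_def)
    qed
    show ?thesis
    proof (rule LIMSEQ_I)
      fix e :: real assume e: "0 < e"
      have "(\<lambda>y. complex_of_real (exp (- (y\<^sup>2 * t\<^sup>2) / 2))) \<midarrow>\<sigma>\<rightarrow> complex_of_real (exp (- (\<sigma>\<^sup>2 * t\<^sup>2) / 2))"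
        by (intro tendsto_intros) simp
      from LIM_D[OF this, of "e / 4"] e obtain \<delta> where \<delta>: "0 < \<delta>"
        "\<And>y. y \<noteq> \<sigma> \<and> norm (y - \<sigma>) < \<delta> \<Longrightarrow>
          cmod (complex_of_real (exp (- (y\<^sup>2 * t\<^sup>2) / 2)) - complex_of_real (exp (- (\<sigma>\<^sup>2 * t\<^sup>2) / 2))) < e / 4" by auto
      \<comment> \<open>One bound on \<epsilon> brings \<open>sqrt (form f f)\<close> within the
        continuity radius of the Gaussian limit at \<open>\<sigma>\<close>; the other makes the
        remainder's share \<open>2 \<epsilon> |t|\<close> at most \<open>e / 4\<close>.\<close>
      define \<epsilon> where "\<epsilon> = min (\<delta> / 2) (e / (8 * (\<bar>t\<bar> + 1)))"
      have \<epsilon>: "0 < \<epsilon>" "\<epsilon> < \<delta>" "\<epsilon> \<le> e / (8 * (\<bar>t\<bar> + 1))" using \<delta>(1) e by (auto simp: \<epsilon>_def min_less_iff_disj)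
      have t\<epsilon>: "2 * \<epsilon> * \<bar>t\<bar> \<le> e / 4"
      proof -
        have "2 * \<epsilon> * \<bar>t\<bar> \<le> 2 * \<epsilon> * (\<bar>t\<bar> + 1)" using \<epsilon> by (intro mult_left_mono) auto
        also have "\<dots> \<le> e / 4" using \<epsilon>(3) by (simp add: field_simps)
        finally show ?thesis .
      qed
      from approx[OF \<epsilon>(1)] obtain f c where fc: "bounded_borel f" "0 < c" "\<forall>x. \<bar>f x\<bar> \<le> c" "\<bar>\<sigma> - sqrt (form f f)\<bar> \<le> \<epsilon>"
        "integrable \<pi> (remainder h f)"
        "\<And>n. integrable M (\<lambda>w. (S (remainder h f) (2 * n) w)\<^sup>2)"
        "\<And>n. sqrt (E (\<lambda>w. (S (remainder h f) (2 * n) w)\<^sup>2)) \<le> 2 * \<epsilon> * sqrt (real n)" by blast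
      have form_close: "cmod (complex_of_real (exp (- (form f f * t\<^sup>2) / 2)) - complex_of_real (exp (- (\<sigma>\<^sup>2 * t\<^sup>2) / 2))) < e / 4"
      proof (cases "sqrt (form f f) = \<sigma>")
        case True
        then have "form f f = \<sigma>\<^sup>2" using form_nonneg[OF fc(1)] by auto
        then show ?thesis using e by simp
      next
        case False
        then show ?thesis using \<delta>(2)[of "sqrt (form f f)"] fc(4) \<epsilon>(2) form_nonneg[OF fc(1)] by simp
      qed
      define B where "B n = \<bar>t\<bar> / sqrt (real n) * (2 * c + I (\<lambda>x. \<bar>h x - (f x - Op f x)\<bar>) + 2 * \<epsilon> * sqrt (real n))" for n
      define b where "b = 2 * c + I (\<lambda>x. \<bar>h x - (f x - Op f x)\<bar>)"
      have "(\<lambda>n. \<bar>t\<bar> / sqrt (real n) * b + 2 * \<epsilon> * \<bar>t\<bar>) \<longlonglongrightarrow> 0 * b + 2 * \<epsilon> * \<bar>t\<bar>"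
        by (intro tendsto_intros) real_asymp
      then have "eventually (\<lambda>n. \<bar>t\<bar> / sqrt (real n) * b + 2 * \<epsilon> * \<bar>t\<bar> < e / 2) sequentially"
        using t\<epsilon> e by (intro order_tendstoD(2)) auto
      moreover have "eventually (\<lambda>n. cmod (E (\<lambda>w. iexp (t / sqrt (real n) * mart f n w)) -
          complex_of_real (exp (- (form f f * t\<^sup>2) / 2))) < e / 4) sequentially"
        using tendstoD[OF martingale_CLT[OF irr aper fc(1), of t], of "e / 4"] e by (simp add: dist_norm)
      ultimately have "eventually (\<lambda>n. norm (E (\<lambda>w. iexp (t / sqrt (real n) * S h n w)) - complex_of_real (exp (- (\<sigma>\<^sup>2 * t\<^sup>2) / 2))) < e) sequentially"
        using eventually_gt_at_top[of 0]
      proof eventually_elim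
        case (elim n)
        have "B n = \<bar>t\<bar> / sqrt (real n) * b + 2 * \<epsilon> * \<bar>t\<bar>"
          using elim(3) by (simp add: B_def b_def field_simps)
        then have Bn: "B n < e / 2" using elim(1) by simp
        have "cmod (E (\<lambda>w. iexp (t / sqrt (real n) * S h n w)) - E (\<lambda>w. iexp (t / sqrt (real n) * mart f n w))) \<le> B n"
          unfolding B_def by (rule diff[OF fc(1-3) \<epsilon>(1) fc(5-7)])
        moreover have "norm (a - d) < e"
          if "cmod (a - b) \<le> B n" "cmod (b - c) < e / 4" "cmod (c - d) < e / 4" for a b c d :: complex
        proof -
          have "cmod (a - d) \<le> cmod (a - b) + cmod (b - c) + cmod (c - d)"
            using norm_triangle_ineq[of "a - b" "b - c"] norm_triangle_ineq[of "a - c" "c - d"] by simp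
          then show ?thesis using that Bn by simp
        qed
        ultimately show ?case using elim(2) form_close by blast
      qed
      then show "\<exists>no. \<forall>n\<ge>no. norm (E (\<lambda>w. iexp (t / sqrt (real n) * S h n w)) - complex_of_real (exp (- (\<sigma>\<^sup>2 * t\<^sup>2) / 2))) < e"
        by (simp add: eventually_sequentially)
    qed
  qed
  show thesis
    by (rule that[OF \<sigma>(1) hS]) (use A_lim2 clt in \<open>simp_all add: A_def[abs_def]\<close>)
qed

end

theorem theorem3p1:
  fixes P :: "'a::polish_space \<Rightarrow> 'a measure"
    and \<pi> :: "'a measure"
    and M :: "'w measure"
    and X :: "nat \<Rightarrow> 'w \<Rightarrow> 'a"
    and h :: "'a \<Rightarrow> real"
  defines "S \<equiv> partial_sum h X"
    and "A \<equiv> (\<lambda>n. ext_variance M (partial_sum h X n) / of_nat n)"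
  assumes "markov_kernel P"
    and "stationary_distribution P \<pi>"
    and "reversible P \<pi>"
    and "ergodic P \<pi>"
    and "stationary_markov_chain M P \<pi> X"
    and "integrable \<pi> h"
    and "(\<integral>x. h x \<partial>\<pi>) = 0"
    and "bounded_in_probability M (\<lambda>n w. S n w / sqrt (real n))"
  shows "\<exists>\<sigma>::real. 0 \<le> \<sigma> \<and>
    weak_conv_m (\<lambda>n. distr M borel (\<lambda>w. S n w / sqrt (real n))) (normal_law 0 (\<sigma>\<^sup>2)) \<and>
    (SUP n\<in>{1..}. A (2 * n)) \<le> ennreal (2 * \<sigma>\<^sup>2) \<and>
    (\<lambda>n. A (2 * n)) \<longlonglongrightarrow> ennreal (\<sigma>\<^sup>2) \<and>
    (\<sigma>\<^sup>2 = 0 \<longrightarrow> (\<forall>n\<ge>1. AE w in M. S (2 * n) w = 0))"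
proof -
  interpret reversible_chain P \<pi> M X
    using assms(3-5,7) by unfold_locales
  have irr: "phi_irreducible P" and aper: "aperiodic P \<pi>" using assms(6) by (simp_all add: ergodic_def)
  have h: "integrable \<pi> h" "(\<integral>x. h x \<partial>\<pi>) = 0" by fact+
  have [measurable]: "h \<in> borel_measurable borel" using h by (auto dest: borel_measurable_integrable)
  have Sm [measurable]: "S n \<in> borel_measurable M" for n unfolding S_def by measurable
  have "bounded_in_probability M (\<lambda>n w. partial_sum h X n w / sqrt (real n))"
    using assms(10) by (simp add: S_def)
  from CLT_even_variance[OF irr aper h this] obtain \<sigma> where \<sigma>: "0 \<le> \<sigma>"
    "\<And>n. integrable M (\<lambda>w. (S (2 * n) w)\<^sup>2)"
    "\<And>n. E (\<lambda>w. (S (2 * n) w)\<^sup>2) \<le> 4 * real n * \<sigma>\<^sup>2"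
    "(\<lambda>n. E (\<lambda>w. (S (2 * n) w)\<^sup>2) / real (2 * n)) \<longlonglongrightarrow> \<sigma>\<^sup>2"
    "\<And>t. (\<lambda>n. E (\<lambda>w. iexp (t / sqrt (real n) * S n w))) \<longlonglongrightarrow> complex_of_real (exp (- (\<sigma>\<^sup>2 * t\<^sup>2) / 2))"
    unfolding S_def by blast
  \<comment> \<open>Because the mean vanishes, \<open>ext_variance\<close> is the plain second
    moment.\<close>
  have ES: "E (S n) = 0" for n
    using h integrable_X[OF h(1)] by (simp add: S_def partial_sum_def[abs_def] E_X)
  have A: "A (2 * n) = ennreal (E (\<lambda>w. (S (2 * n) w)\<^sup>2) / real (2 * n))" if "n \<ge> 1" for n
  proof -
    have "ext_variance M (S (2 * n)) = ennreal (E (\<lambda>w. (S (2 * n) w)\<^sup>2))"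
      using \<sigma>(2)[of n] by (simp add: ext_variance_def ES nn_integral_eq_integral)
    then show ?thesis
      using that by (simp add: A_def S_def ennreal_of_nat_eq_real_of_nat divide_ennreal)
  qed
  have weak: "weak_conv_m (\<lambda>n. distr M borel (\<lambda>w. S n w / sqrt (real n))) (normal_law 0 (\<sigma>\<^sup>2))"
  proof (rule levy_continuity)
    show "real_distribution (distr M borel (\<lambda>w. S n w / sqrt (real n)))" for n
      by (rule M.real_distribution_distr) measurable
    show "real_distribution (normal_law 0 (\<sigma>\<^sup>2))" by (rule real_distribution_normal_law)
    fix t
    have "char (distr M borel (\<lambda>w. S n w / sqrt (real n))) t = E (\<lambda>w. iexp (t / sqrt (real n) * S n w))" for n
      unfolding char_def by (subst integral_distr) (auto simp: ac_simps)
    then show "(\<lambda>n. char (distr M borel (\<lambda>w. S n w / sqrt (real n))) t) \<longlonglongrightarrow> char (normal_law 0 (\<sigma>\<^sup>2)) t"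
      using \<sigma>(5)[of t] by (simp add: char_normal_law)
  qed
  have sup: "(SUP n\<in>{1..}. A (2 * n)) \<le> ennreal (2 * \<sigma>\<^sup>2)"
  proof (rule SUP_least)
    fix n :: nat assume "n \<in> {1..}"
    then have n: "n \<ge> 1" by simp
    then have "E (\<lambda>w. (S (2 * n) w)\<^sup>2) / real (2 * n) \<le> 2 * \<sigma>\<^sup>2"
      using \<sigma>(3)[of n] by (simp add: divide_le_eq ac_simps)
    then show "A (2 * n) \<le> ennreal (2 * \<sigma>\<^sup>2)" unfolding A[OF n] by (rule ennreal_leI)
  qed
  have lim: "(\<lambda>n. A (2 * n)) \<longlonglongrightarrow> ennreal (\<sigma>\<^sup>2)"
  proof (rule Lim_transform_eventually)
    show "(\<lambda>n. ennreal (E (\<lambda>w. (S (2 * n) w)\<^sup>2) / real (2 * n))) \<longlonglongrightarrow> ennreal (\<sigma>\<^sup>2)"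
      by (intro tendsto_ennrealI \<sigma>(4))
    show "\<forall>\<^sub>F n in sequentially. ennreal (E (\<lambda>w. (S (2 * n) w)\<^sup>2) / real (2 * n)) = A (2 * n)"
      by (rule eventually_sequentiallyI[of 1]) (simp add: A)
  qed
  \<comment> \<open>For \<open>\<sigma> = 0\<close> the bound \<open>4 n \<sigma>^2\<close> is 0 at
    each \<open>n\<close>, not merely in the limit.\<close>
  have null: "AE w in M. S (2 * n) w = 0" if "\<sigma>\<^sup>2 = 0" for n
  proof -
    have "E (\<lambda>w. (S (2 * n) w)\<^sup>2) = 0" using \<sigma>(3)[of n] that by (intro antisym) auto
    then show ?thesis using \<sigma>(2)[of n] by (simp add: integral_nonneg_eq_0_iff_AE)
  qed
  show ?thesis using \<sigma>(1) weak sup lim null by blast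
qed

end
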